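(* Let $\varphi:\mathbb{C}\to\mathbb{H}P^n$ be a linearly full totally real flat minimal surface (i.e. a minimal isometric immersion) of isotropy order $n$ with the induced metric $\varphi^*ds^2_{\mathbb{H}P^n}=2\,dz\,d\bar z$. Then, up to a symplectic isometry of $\mathbb{H}P^n$, $\varphi$ lies in $\mathbb{C}P^n\subset\mathbb{H}P^n$ and is given by $$\varphi(z)=\left[e^{a_0z-\bar a_0\bar z},\ e^{a_1z-\bar a_1\bar z},\ \dots,\ e^{a_nz-\bar a_n\bar z}\right]^T,$$ where either $a_k=e^{\mathrm{i}\frac{2k\pi}{n+1}}$ for $k=0,1,\dots,n$ (the Clifford solution in $\mathbb{C}P^n$), or $a_k=e^{\mathrm{i}\frac{k\pi}{n+1}}$ for $k=0,1,\dots,n$.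
   Context: Here $n\ge 1$. Identify $\mathbb{C}^{2n+2}$ with $\mathbb{H}^{n+1}$ by $(z_1,z_2,\dots,z_{2n+1},z_{2n+2})\leftrightarrow(z_1+z_2\mathrm{j},\dots,z_{2n+1}+z_{2n+2}\mathrm{j})$, with the standard Hermitian product $\langle z,w\rangle=\sum_k z_k\bar w_k$ and real inner product $\mathrm{Re}\langle\cdot,\cdot\rangle$. Left multiplication by $\mathrm{j}$ is the conjugate-linear map $\mathrm{j}v=J_{n+1}\bar v$ on $\mathbb{C}^{2n+2}$, where $J_{n+1}$ is block diagonal with $n+1$ blocks $\begin{pmatrix}0&-1\\1&0\end{pmatrix}$; $\mathrm{j}^2=-\mathrm{id}$. $\mathbb{H}P^n$ is the space of one-dimensional quaternionic subspaces of $\mathbb{H}^{n+1}$ for left scalar multiplication. Write $\pi:S^{4n+3}\to\mathbb{H}P^n$, $\pi(q)=[z_1+z_2\mathrm{j},\dots,z_{2n+1}+z_{2n+2}\mathrm{j}]$; its horizontal space at $q$ is $\mathcal H_q=\{v:\langle v,q\rangle=\langle v,\mathrm{j}q\rangle=0\}$, and $\mathbb{H}P^n$ has the metric $ds^2_{\mathbb{H}P^n}$ (also written $g$) making $\pi$ a Riemannian submersion from the unit sphere. The local quaternionic Kähler structure $\{I,J,K\}$ is induced on $\mathcal H_q\cong T_{\pi(q)}\mathbb{H}P^n$ by left multiplication by $\mathrm{i},\mathrm{j},\mathrm{k}$. Here $dz\,d\bar z=dx^2+dy^2$. An isometric immersion $\varphi:M\to\mathbb{H}P^n$ of a surface is totally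 real if at each point the two-forms $\omega_I(X,Y)=g(IX,Y)$, $\omega_J(X,Y)=g(JX,Y)$, $\omega_K(X,Y)=g(KX,Y)$ all pull back to zero under $\varphi$. It is linearly full if its image is contained in no proper quaternionic projective subspace $\mathbb{H}P^m\subset\mathbb{H}P^n$, $m<n$. $\mathbb{H}P^n$ is viewed as a totally geodesic submanifold of the complex Grassmannian $G(2,2n+2)$ by sending $\pi(q)$ to the complex plane spanned by $q$ and $\mathrm{j}q$. Thus a minimal $\varphi$ corresponds to a harmonic rank-2 subbundle $\underline\varphi_0=\underline\varphi$ of the trivial bundle $M\times\mathbb{C}^{2n+2}$, and it generates the harmonic sequence $\underline\varphi_k$, where $\underline\varphi_{k+1}$ is the image (extended across isolated points) of $A'_{\varphi_k}:\underline\varphi_k\to\underline\varphi_k^\perp$, $A'_{\varphi_k}(v)=\pi_{\varphi_k^\perp}(\partial_z v)$ (with $\pi_{\varphi_k^\perp}$ orthogonal projection onto $\underline\varphi_k^\perp$); the $\underline\varphi_k$ are of rank 2. The isotropy order of $\varphi$ is the greatest $r$ such that $\underline\varphi_0\perp\underline\varphi_i$ for all $1\le i\le r$. (When $r=n$ the sequence is cyclic: $\underline\varphi_p\perp\underline\varphi_q$ for $0\le p<q\le n$ and $\underline\varphi_{n+1}=\underline\varphi_0$.) The symplectic isometries of $\mathbb{H}P^n$ are those induced by $Sp(n+1)=\{U\in U(2n+2): UJ_{n+1}U^T=J_{n+1}\}$. $\mathbb{C}P^n\subset\mathbb{H}P^n$ consists of the points $[w_0,\dots,w_n]$ having complex homogeneous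 coordinates $w_k\in\mathbb{C}\subset\mathbb{H}$.
   Formalization: The formula is proved for φ after a rotation of the coordinate, z replaced by e^{iθ}z for some real θ; without it the claim fails, e.g. for the Clifford solution with n=2 precomposed with a generic rotation, which satisfies every hypothesis. *)

theory Defs
  imports "HOL-Analysis.Analysis"
begin

section \<open>Quaternionic linear algebra on complex coordinates\<close>

text \<open>
  If the index type \<open>'n\<close> has n + 1 elements, \<open>complex ^ ('n \<times> bool)\<close> is C^(2n+2): the k-th quaternionic
  coordinate of \<open>v\<close> is \<open>v $ (k, False) + v $ (k, True) j\<close>. The library's real inner product \<open>\<bullet>\<close> on this
  type is the real part of the Hermitian product below, and \<open>norm\<close> is the induced norm.
\<close>

definition herm :: "complex ^ 'm::finite \<Rightarrow> complex ^ 'm \<Rightarrow> complex" where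
  "herm v w = (\<Sum>p\<in>UNIV. v $ p * cnj (w $ p))"

text \<open>The block diagonal matrix with blocks (0, -1; 1, 0).\<close>

definition Jmat :: "complex ^ ('n::finite \<times> bool) ^ ('n \<times> bool)" where
  "Jmat = (\<chi> p q. if fst p \<noteq> fst q then 0
                  else if \<not> snd p \<and> snd q then - 1
                  else if snd p \<and> \<not> snd q then 1 else 0)"

text \<open>Left multiplication by j; left multiplication by i is \<open>\<i> *s v\<close>, and by k it is \<open>\<i> *s jmul v\<close>.\<close>

definition jmul :: "complex ^ ('n::finite \<times> bool) \<Rightarrow> complex ^ ('n \<times> bool)" where
  "jmul v = Jmat *v (\<chi> p. cnj (v $ p))"

definition quat_subspace :: "(complex ^ ('n::finite \<times> bool)) set \<Rightarrow> bool" where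
  "quat_subspace V \<longleftrightarrow> vec.subspace V \<and> (\<forall>v\<in>V. jmul v \<in> V)"

text \<open>The left quaternionic line through \<open>q\<close>: the scalar a + b j sends \<open>q\<close> to a q + b (j q).\<close>

definition qline :: "complex ^ ('n::finite \<times> bool) \<Rightarrow> (complex ^ ('n \<times> bool)) set" where
  "qline q = {a *s q + b *s jmul q | a b. True}"

definition HPn :: "(complex ^ ('n::finite \<times> bool)) set set" where
  "HPn = {qline q | q. q \<noteq> 0}"

definition CPn :: "(complex ^ ('n::finite \<times> bool)) set set" where
  "CPn = {qline w | w. w \<noteq> 0 \<and> (\<forall>k. w $ (k, True) = 0)}"

definition Sp :: "(complex ^ ('n::finite \<times> bool) ^ ('n \<times> bool)) set" where
  "Sp = {U. U ** (\<chi> p q. cnj (U $ q $ p)) = mat 1 \<and> U ** Jmat ** transpose U = Jmat}"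


section \<open>Smooth maps and local lifts to the sphere\<close>

text \<open>Meant for open \<open>U\<close>.\<close>

primrec Ck_on :: "nat \<Rightarrow> complex set \<Rightarrow> (complex \<Rightarrow> 'b::real_normed_vector) \<Rightarrow> bool" where
  "Ck_on 0 U f \<longleftrightarrow> continuous_on U f"
| "Ck_on (Suc k) U f \<longleftrightarrow> (\<forall>z\<in>U. f differentiable (at z)) \<and>
     (\<forall>v. Ck_on k U (\<lambda>z. frechet_derivative f (at z) v))"

definition smooth_on :: "complex set \<Rightarrow> (complex \<Rightarrow> 'b::real_normed_vector) \<Rightarrow> bool" where
  "smooth_on U f \<longleftrightarrow> (\<forall>k. Ck_on k U f)"

text \<open>The real directional derivative in direction \<open>X\<close>; the tangent vectors \<open>1\<close> and \<open>\<i>\<close> are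
  d/dx and d/dy.\<close>

definition dir :: "complex \<Rightarrow> (complex \<Rightarrow> 'b::real_normed_vector) \<Rightarrow> complex \<Rightarrow> 'b" where
  "dir X f z = frechet_derivative f (at z) X"

definition local_lift ::
  "(complex \<Rightarrow> (complex ^ ('n::finite \<times> bool)) set) \<Rightarrow> (complex \<Rightarrow> complex ^ ('n \<times> bool)) \<Rightarrow> complex set \<Rightarrow> bool"
  where
  "local_lift \<phi> f U \<longleftrightarrow> open U \<and> smooth_on U f \<and> (\<forall>z\<in>U. norm (f z) = 1 \<and> \<phi> z = qline (f z))"

text \<open>Since the projection from the unit sphere is a submersion, the smooth maps into the quaternionic
  projective space are exactly those with smooth local lifts.\<close>

definition smooth_HP :: "(complex \<Rightarrow> (complex ^ ('n::finite \<times> bool)) set) \<Rightarrow> bool" where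
  "smooth_HP \<phi> \<longleftrightarrow> (\<forall>z. \<phi> z \<in> HPn) \<and> (\<forall>z. \<exists>f U. local_lift \<phi> f U \<and> z \<in> U)"


section \<open>Riemannian geometry of maps into the quaternionic projective space\<close>

text \<open>
  Tangent vectors of the projective space at \<open>qline q\<close>, with \<open>q\<close> in the unit sphere, are represented
  by their horizontal lifts at \<open>q\<close>. Replacing a local lift \<open>f\<close> by \<open>\<mu> f\<close>, with \<open>\<mu>\<close> a function into the
  unit quaternions, multiplies all horizontal lifts by \<open>\<mu>\<close>, so that none of the notions below
  depends on the choice of the lift.
\<close>

definition hor :: "complex ^ ('n::finite \<times> bool) \<Rightarrow> complex ^ ('n \<times> bool) \<Rightarrow> complex ^ ('n \<times> bool)" where
  "hor q v = v - herm v q *s q - herm v (jmul q) *s jmul q"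

text \<open>The horizontal lift at \<open>f z\<close> of the differential of the map applied to \<open>X\<close>.\<close>

definition dmap :: "(complex \<Rightarrow> complex ^ ('n::finite \<times> bool)) \<Rightarrow> complex \<Rightarrow> complex \<Rightarrow> complex ^ ('n \<times> bool)" where
  "dmap f X z = hor (f z) (dir X f z)"

text \<open>The pullback of the metric making the projection from the unit sphere a Riemannian submersion.\<close>

definition induced_metric ::
  "(complex \<Rightarrow> complex ^ ('n::finite \<times> bool)) \<Rightarrow> complex \<Rightarrow> complex \<Rightarrow> complex \<Rightarrow> real" where
  "induced_metric f z X Y = dmap f X z \<bullet> dmap f Y z"

text \<open>The pullback metric is 2 (dx^2 + dy^2).\<close>

definition induced_metric_flat :: "(complex \<Rightarrow> (complex ^ ('n::finite \<times> bool)) set) \<Rightarrow> bool" where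
  "induced_metric_flat \<phi> \<longleftrightarrow>
     (\<forall>f U z X Y. local_lift \<phi> f U \<and> z \<in> U \<longrightarrow> induced_metric f z X Y = 2 * (X \<bullet> Y))"

definition totally_real :: "(complex \<Rightarrow> (complex ^ ('n::finite \<times> bool)) set) \<Rightarrow> bool" where
  "totally_real \<phi> \<longleftrightarrow>
     (\<forall>f U z X Y. local_lift \<phi> f U \<and> z \<in> U \<longrightarrow>
        (\<i> *s dmap f X z) \<bullet> dmap f Y z = 0 \<and>
        jmul (dmap f X z) \<bullet> dmap f Y z = 0 \<and>
        (\<i> *s jmul (dmap f X z)) \<bullet> dmap f Y z = 0)"

text \<open>
  The Levi-Civita derivative in direction \<open>X\<close> of a vector field along the map whose horizontal lift
  along \<open>f\<close> is \<open>V\<close>. By O'Neill's formula it is the horizontal part of the derivative of \<open>V\<close> if \<open>f\<close> is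
  horizontal in direction \<open>X\<close>. In general the derivative of \<open>f\<close> has vertical part \<open>\<lambda> f\<close> with the quaternion
  \<open>\<lambda> = herm (dir X f z) (f z) + herm (dir X f z) (jmul (f z)) j\<close>, and passing to a lift that is horizontal
  at the point gives the correction \<open>- \<lambda> V\<close>.
\<close>

definition levi_civita ::
  "(complex \<Rightarrow> complex ^ ('n::finite \<times> bool)) \<Rightarrow> complex \<Rightarrow> (complex \<Rightarrow> complex ^ ('n \<times> bool)) \<Rightarrow>
   complex \<Rightarrow> complex ^ ('n \<times> bool)" where
  "levi_civita f X V z = hor (f z) (dir X V z)
     - (herm (dir X f z) (f z) *s V z + herm (dir X f z) (jmul (f z)) *s jmul (V z))"

text \<open>
  For \<open>X, Y\<close> orthonormal in the induced metric at \<open>z\<close>: the mean curvature vector, half the trace of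
  the second fundamental form. The latter is the normal part of the Levi-Civita derivative, so
  that \<open>X\<close> and \<open>Y\<close> may be extended to constant vector fields.
\<close>

definition mean_curvature ::
  "(complex \<Rightarrow> complex ^ ('n::finite \<times> bool)) \<Rightarrow> complex \<Rightarrow> complex \<Rightarrow> complex \<Rightarrow> complex ^ ('n \<times> bool)" where
  "mean_curvature f X Y z =
     (let A = dmap f X z; B = dmap f Y z; normal = (\<lambda>w. w - (w \<bullet> A) *\<^sub>R A - (w \<bullet> B) *\<^sub>R B)
      in (1 / 2) *\<^sub>R (normal (levi_civita f X (dmap f X) z) + normal (levi_civita f Y (dmap f Y) z)))"

definition minimal_surface :: "(complex \<Rightarrow> (complex ^ ('n::finite \<times> bool)) set) \<Rightarrow> bool" where
  "minimal_surface \<phi> \<longleftrightarrow>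
     (\<forall>f U z X Y. local_lift \<phi> f U \<and> z \<in> U \<and>
        induced_metric f z X X = 1 \<and> induced_metric f z Y Y = 1 \<and> induced_metric f z X Y = 0 \<longrightarrow>
        mean_curvature f X Y z = 0)"

definition linearly_full :: "(complex \<Rightarrow> (complex ^ ('n::finite \<times> bool)) set) \<Rightarrow> bool" where
  "linearly_full \<phi> \<longleftrightarrow> (\<forall>V. quat_subspace V \<and> (\<forall>z. \<phi> z \<subseteq> V) \<longrightarrow> V = UNIV)"


section \<open>The harmonic sequence\<close>

definition perp_proj :: "(complex ^ 'm::finite) set \<Rightarrow> complex ^ 'm \<Rightarrow> complex ^ 'm" where
  "perp_proj W v = (THE w. (\<forall>u\<in>W. herm w u = 0) \<and> v - w \<in> W)"

definition dz :: "(complex \<Rightarrow> complex ^ 'm::finite) \<Rightarrow> complex \<Rightarrow> complex ^ 'm" where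
  "dz s z = (1 / 2) *s (dir 1 s z - \<i> *s dir \<i> s z)"

definition rank2_bundle :: "(complex \<Rightarrow> (complex ^ 'm::finite) set) \<Rightarrow> bool" where
  "rank2_bundle W \<longleftrightarrow>
     (\<forall>z\<^sub>0. \<exists>U s t. open U \<and> z\<^sub>0 \<in> U \<and> smooth_on U s \<and> smooth_on U t \<and>
        (\<forall>z\<in>U. W z = vec.span {s z, t z} \<and> vec.dim (W z) = 2))"

text \<open>The image at \<open>z\<close> of the bundle map A', evaluated on smooth local sections through \<open>z\<close>.\<close>

definition A'_image :: "(complex \<Rightarrow> (complex ^ 'm::finite) set) \<Rightarrow> complex \<Rightarrow> (complex ^ 'm) set" where
  "A'_image W z = {perp_proj (W z) (dz s z) | s U. open U \<and> z \<in> U \<and> smooth_on U s \<and> (\<forall>w\<in>U. s w \<in> W w)}"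

text \<open>\<open>\<psi> (Suc k)\<close> is the image of A' on \<open>\<psi> k\<close>, extended smoothly across a closed discrete set.\<close>

definition harmonic_sequence ::
  "(complex \<Rightarrow> (complex ^ 'm::finite) set) \<Rightarrow> (nat \<Rightarrow> complex \<Rightarrow> (complex ^ 'm) set) \<Rightarrow> bool" where
  "harmonic_sequence \<phi> \<psi> \<longleftrightarrow> \<psi> 0 = \<phi> \<and>
     (\<forall>k. rank2_bundle (\<psi> k) \<and> {z. A'_image (\<psi> k) z \<noteq> \<psi> (Suc k) z} sparse_in UNIV)"

definition perp_upto :: "(nat \<Rightarrow> complex \<Rightarrow> (complex ^ 'm::finite) set) \<Rightarrow> nat \<Rightarrow> bool" where
  "perp_upto \<psi> r \<longleftrightarrow> (\<forall>i\<in>{1..r}. \<forall>z. \<forall>u\<in>\<psi> 0 z. \<forall>v\<in>\<psi> i z. herm u v = 0)"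

definition isotropy_order_is :: "(nat \<Rightarrow> complex \<Rightarrow> (complex ^ 'm::finite) set) \<Rightarrow> nat \<Rightarrow> bool" where
  "isotropy_order_is \<psi> r \<longleftrightarrow> perp_upto \<psi> r \<and> (\<forall>r'. perp_upto \<psi> r' \<longrightarrow> r' \<le> r)"


section \<open>Homogeneous exponential maps\<close>

text \<open>The point with complex homogeneous coordinates \<open>exp (a k * z - cnj (a k) * cnj z)\<close>, where \<open>idx\<close>
  numbers the homogeneous coordinates. The metric condition above determines the coordinate \<open>z\<close> only up
  to isometries of the plane, so normalising the exponents to specific roots of unity requires
  rotating \<open>z\<close> by a constant phase.\<close>

definition exp_map :: "('n::finite \<Rightarrow> nat) \<Rightarrow> (nat \<Rightarrow> complex) \<Rightarrow> complex \<Rightarrow> (complex ^ ('n \<times> bool)) set" where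
  "exp_map idx a z = qline (\<chi> p. if snd p then 0
      else exp (a (idx (fst p)) * z - cnj (a (idx (fst p))) * cnj z))"

end

theory Submission
  imports Defs
begin

text \<open>
  Let \<open>P z\<close> be the orthogonal projector of rank 2 onto \<open>\<phi> z\<close>. The covariant derivatives
  \<open>(\<partial>\<^sub>z F) P\<close> and \<open>(\<partial>\<^sub>z\<^sub>b F) P\<close> of matrix functions with \<open>F P = F\<close> commute because \<open>\<phi>\<close> is totally
  real and isometric, and minimality gives \<open>B (a + 1)\<close> and \<open>- B (a - 1)\<close> for the derivatives of
  \<open>B a\<close>, where \<open>B 0 = P\<close> and \<open>a\<close> runs through the integers. By isotropy the products
  \<open>star (B a) * B b\<close> are \<open>P\<close> for \<open>a = b\<close> and vanish for \<open>0 < \<bar>a - b\<bar> \<le> n\<close>, so the ranges of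
  \<open>B 0, \<dots>, B n\<close> decompose the whole space. Hence there is a unitary matrix \<open>T\<close> with
  \<open>T B a = B (a + 1)\<close> for all \<open>a\<close>, and it is constant. Therefore \<open>\<phi> z\<close> is the image of \<open>\<phi> 0\<close> under
  \<open>exp (z T - z\<^sub>b T\<^sup>*)\<close>, and \<open>T ^ (n + 1)\<close> preserves \<open>\<phi> 0\<close>. Expanding an eigenvector of \<open>T ^ (n + 1)\<close>
  in \<open>\<phi> 0\<close> into eigenvectors of \<open>T\<close>, whose eigenvalues are the \<open>(n + 1)\<close>-st roots of one
  unimodular number, gives the Clifford solution, up to a rotation of the coordinate \<open>z\<close>.
\<close>

section \<open>The algebra of complex square matrices\<close>

text \<open>Local lifts are determined only up to unit quaternions; the projector \<open>P\<close>
  and the connection that it induces on the bundle are global. Totally real and isometric together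
  say that the Hermitian products of the differential are real and symmetric. Hence P P_z P_zb P and
  P P_zb P_z P are both \<open>P\<close>: equality kills the curvature, and the value
  \<open>P\<close>, due to the factor 2 of the metric, makes every \<open>B a\<close> isometric
  instead of merely conformal. Minimality gives the covariant Laplacian the eigenvalue -1 on
  \<open>P\<close>. So one covariant derivative and the negative of the other are mutually inverse
  along the sequence; this is why the index runs through all integers. The products
  \<open>star (B a) * B b\<close> obey a shift principle: if a whole diagonal is constantly
  \<open>P\<close> or 0, the neighbouring diagonals depend on the index difference only. So one
  vanishing entry per diagonal is enough, and that is all the isotropy order supplies. The
  quaternionic structure gives \<open>jc T = - star T\<close>. It turns the eigenvectors of
  \<open>T\<close> into a symplectic frame, which puts the surface into the complex projective
  space.\<close>

typedef 'm cop = "UNIV :: (complex ^ 'm::finite ^ 'm) set" morphisms mtx Op ..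

setup_lifting type_definition_cop

lemma bounded_linear_mv: "bounded_linear ((*v) (A :: complex ^ 'm::finite ^ 'm))"
  by (rule matrix_vector_mul_bounded_linear)

lemma scaleR_mv: "(r *\<^sub>R A) *v v = r *\<^sub>R (A *v (v :: complex ^ 'm::finite))"
  by (simp add: vec_eq_iff matrix_vector_mult_def scaleR_sum_right)

instantiation cop :: (finite) scaleR
begin
lift_definition scaleR_cop :: "real \<Rightarrow> 'a cop \<Rightarrow> 'a cop" is "(*\<^sub>R)" .
instance ..
end

text \<open>A separate type lets \<open>*\<close> and \<open>^\<close> denote matrix product and
  powers, so that ring rewriting and the product rule for normed algebras apply. The operator norm
  is submultiplicative and gives the identity norm 1, as the class demands.\<close>

instantiation cop :: (finite) real_normed_algebra_1
begin

lift_definition zero_cop :: "'a cop" is 0 .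
lift_definition one_cop :: "'a cop" is "mat 1" .
lift_definition plus_cop :: "'a cop \<Rightarrow> 'a cop \<Rightarrow> 'a cop" is "(+)" .
lift_definition minus_cop :: "'a cop \<Rightarrow> 'a cop \<Rightarrow> 'a cop" is "(-)" .
lift_definition uminus_cop :: "'a cop \<Rightarrow> 'a cop" is uminus .
lift_definition times_cop :: "'a cop \<Rightarrow> 'a cop \<Rightarrow> 'a cop" is "(**)" .
lift_definition norm_cop :: "'a cop \<Rightarrow> real" is "\<lambda>A. onorm ((*v) A)" .
definition dist_cop :: "'a cop \<Rightarrow> 'a cop \<Rightarrow> real" where "dist_cop A B = norm (A - B)"
definition sgn_cop :: "'a cop \<Rightarrow> 'a cop" where "sgn_cop A = scaleR (inverse (norm A)) A"
definition uniformity_cop :: "('a cop \<times> 'a cop) filter"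
  where "uniformity_cop = (INF e\<in>{0 <..}. principal {(x, y). dist x y < e})"
definition open_cop :: "'a cop set \<Rightarrow> bool"
  where "open_cop S \<longleftrightarrow> (\<forall>x\<in>S. \<forall>\<^sub>F (x', y) in uniformity. x' = x \<longrightarrow> y \<in> S)"

instance
proof
  fix A B C :: "'a cop" and r s :: real
  show "A + B + C = A + (B + C)" "A + B = B + A" "0 + A = A" "- A + A = 0" "A - B = A + - B"
    by (transfer, simp add: algebra_simps)+
  show "r *\<^sub>R (A + B) = r *\<^sub>R A + r *\<^sub>R B" "(r + s) *\<^sub>R A = r *\<^sub>R A + s *\<^sub>R A"
    "r *\<^sub>R s *\<^sub>R A = (r * s) *\<^sub>R A" "1 *\<^sub>R A = A"
    by (transfer, simp add: algebra_simps)+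
  show "A * B * C = A * (B * C)" by transfer (simp add: matrix_mul_assoc)
  show "(A + B) * C = A * C + B * C"
    by transfer (simp add: matrix_matrix_mult_def vec_eq_iff sum.distrib algebra_simps)
  show "A * (B + C) = A * B + A * C" by transfer (rule matrix_add_ldistrib)
  show "1 * A = A" "A * 1 = A" by (transfer, simp)+
  show "(0::'a cop) \<noteq> 1" by transfer (auto simp: mat_def vec_eq_iff)
  show "r *\<^sub>R A * B = r *\<^sub>R (A * B)" by transfer (simp add: scalar_matrix_assoc)
  show "A * r *\<^sub>R B = r *\<^sub>R (A * B)" by transfer (simp add: matrix_scalar_ac scalar_matrix_assoc)
  show "dist A B = norm (A - B)" by (rule dist_cop_def)
  show "sgn A = A /\<^sub>R norm A" by (rule sgn_cop_def)
  show "uniformity = (INF e\<in>{0 <..}. principal {(x, y::'a cop). dist x y < e})"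
    by (rule uniformity_cop_def)
  fix S :: "'a cop set"
  show "open S \<longleftrightarrow> (\<forall>x\<in>S. \<forall>\<^sub>F (x', y) in uniformity. x' = x \<longrightarrow> y \<in> S)" by (rule open_cop_def)
next
  fix A B :: "'a cop" and r :: real
  show "norm A = 0 \<longleftrightarrow> A = 0"
    by transfer (simp add: onorm_eq_0[OF bounded_linear_mv] matrix_eq)
  show "norm (A + B) \<le> norm A + norm B"
  proof transfer
    fix A B :: "complex ^ 'a ^ 'a"
    have "(*v) (A + B) = (\<lambda>v. A *v v + B *v v)"
      by (rule ext) (simp add: matrix_vector_mult_add_rdistrib)
    then show "onorm ((*v) (A + B)) \<le> onorm ((*v) A) + onorm ((*v) B)"
      by (simp add: onorm_triangle bounded_linear_mv)
  qed
  show "norm (r *\<^sub>R A) = \<bar>r\<bar> * norm A"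
  proof (transfer fixing: r)
    fix A :: "complex ^ 'a ^ 'a"
    have "(*v) (r *\<^sub>R A) = (\<lambda>v. r *\<^sub>R (A *v v))"
      by (rule ext) (simp add: scaleR_mv)
    then show "onorm ((*v) (r *\<^sub>R A)) = \<bar>r\<bar> * onorm ((*v) A)"
      by (simp add: onorm_scaleR bounded_linear_mv)
  qed
  show "norm (A * B) \<le> norm A * norm B"
  proof transfer
    fix A B :: "complex ^ 'a ^ 'a"
    have "(*v) (A ** B) = (*v) A \<circ> (*v) B"
      by (rule ext) (simp add: matrix_vector_mul_assoc)
    then show "onorm ((*v) (A ** B)) \<le> onorm ((*v) A) * onorm ((*v) B)"
      by (simp add: onorm_compose bounded_linear_mv)
  qed
  have "(*v) (mat 1) = (\<lambda>v :: complex ^ 'a. v)" by (rule ext) simp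
  then show "norm (1::'a cop) = 1" by transfer (simp add: onorm_id)
qed

end

section \<open>Action on vectors, adjoint, trace and Hermitian products\<close>

lift_definition act :: "'m::finite cop \<Rightarrow> complex ^ 'm \<Rightarrow> complex ^ 'm" is "(*v)" .
lift_definition star :: "'m::finite cop \<Rightarrow> 'm cop" is "\<lambda>A. \<chi> i j. cnj (A $ j $ i)" .
text \<open>The algebra is a real one; complex scalars enter as multiplication by this central
  element.\<close>

lift_definition iu :: "'m::finite cop" is "mat \<i>" .
lift_definition tr :: "'m::finite cop \<Rightarrow> complex" is trace .
lift_definition outer :: "complex ^ 'm::finite \<Rightarrow> complex ^ 'm \<Rightarrow> 'm cop"
  is "\<lambda>v w. \<chi> i j. v $ i * cnj (w $ j)" .

lemma cop_eqI: "(\<And>v. act A v = act B v) \<Longrightarrow> A = B"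
  by transfer (simp add: matrix_eq)

lemma mat_mv: "mat c *v v = c *s (v :: complex ^ 'm::finite)"
  by (simp add: vec_eq_iff matrix_vector_mult_def mat_def if_distrib[of "\<lambda>x. x * _"] cong: if_cong)

lemma act_simps:
  shows act_add: "act (A + B) v = act A v + act B v"
    and act_diff: "act (A - B) v = act A v - act B v"
    and act_uminus: "act (- A) v = - act A v"
    and act_mult: "act (A * B) v = act A (act B v)"
    and act_zero: "act 0 v = 0"
    and act_one: "act 1 v = v"
    and act_scaleR: "act (r *\<^sub>R A) v = r *\<^sub>R act A v"
    and act_iu: "act iu v = \<i> *s v"
  subgoal by transfer (simp add: matrix_vector_mult_add_rdistrib)
  subgoal by transfer (simp add: matrix_vector_mult_diff_rdistrib)
  subgoal by transfer (simp add: vec_eq_iff matrix_vector_mult_def sum_negf)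
  subgoal by transfer (simp add: matrix_vector_mul_assoc)
  subgoal by transfer (simp add: vec_eq_iff matrix_vector_mult_def)
  subgoal by transfer simp
  subgoal by transfer (rule scaleR_mv)
  subgoal by transfer (rule mat_mv)
  done

lemma act_vec_simps:
  shows act_vadd: "act A (v + w) = act A v + act A w"
    and act_vdiff: "act A (v - w) = act A v - act A w"
    and act_vuminus: "act A (- v) = - act A v"
    and act_vzero: "act A 0 = 0"
    and act_vscale: "act A (c *s v) = c *s act A v"
    and act_vscaleR: "act A (r *\<^sub>R v) = r *\<^sub>R act A v"
  by (transfer; simp add: vec_eq_iff matrix_vector_mult_def sum.distrib sum_subtractf sum_negf
      sum_distrib_left scaleR_sum_right algebra_simps)+

lemma act_sum: "act (\<Sum>i\<in>I. A i) v = (\<Sum>i\<in>I. act (A i) v)"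
  by (induction I rule: infinite_finite_induct) (simp_all add: act_simps)

lemma act_vsum: "act A (\<Sum>i\<in>I. v i) = (\<Sum>i\<in>I. act A (v i))"
  by (induction I rule: infinite_finite_induct) (simp_all add: act_vec_simps)

lemma star_simps:
  shows star_star: "star (star A) = A"
    and star_add: "star (A + B) = star A + star B"
    and star_diff: "star (A - B) = star A - star B"
    and star_uminus: "star (- A) = - star A"
    and star_mult: "star (A * B) = star B * star A"
    and star_zero: "star 0 = 0"
    and star_one: "star 1 = 1"
    and star_scaleR: "star (r *\<^sub>R A) = r *\<^sub>R star A"
    and star_iu: "star iu = - iu"
    and star_outer: "star (outer v w) = outer w v"
  by (transfer; auto simp: vec_eq_iff matrix_matrix_mult_def mat_def mult.commute)+

lemma star_sum: "star (\<Sum>i\<in>I. A i) = (\<Sum>i\<in>I. star (A i))"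
  by (induction I rule: infinite_finite_induct) (simp_all add: star_simps)

lemma iu_mult_iu: "iu * iu = - 1"
  by (rule cop_eqI) (simp add: act_simps vec_eq_iff)

lemma iu_commute: "A * iu = iu * A"
  by (rule cop_eqI) (simp add: act_simps act_vec_simps)

lemma tr_simps:
  shows tr_add: "tr (A + B) = tr A + tr B"
    and tr_diff: "tr (A - B) = tr A - tr B"
    and tr_zero: "tr 0 = 0"
    and tr_outer: "tr (outer v w) = herm v w"
    and tr_one: "tr (1 :: 'm::finite cop) = of_nat CARD('m)"
  by (transfer; simp add: trace_def sum.distrib sum_subtractf herm_def mat_def)+

lemma tr_mult_commute: "tr (A * B) = tr (B * A)"
  by transfer (rule trace_mul_sym)

lemma tr_sum: "tr (\<Sum>i\<in>I. A i) = (\<Sum>i\<in>I. tr (A i))"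
  by (induction I rule: infinite_finite_induct) (simp_all add: tr_simps)

lemma herm_simps:
  shows herm_ladd: "herm (u + v) w = herm u w + herm v w"
    and herm_radd: "herm w (u + v) = herm w u + herm w v"
    and herm_ldiff: "herm (u - v) w = herm u w - herm v w"
    and herm_rdiff: "herm w (u - v) = herm w u - herm w v"
    and herm_luminus: "herm (- u) w = - herm u w"
    and herm_ruminus: "herm w (- u) = - herm w u"
    and herm_lscale: "herm (c *s u) w = c * herm u w"
    and herm_rscale: "herm w (c *s u) = cnj c * herm w u"
    and herm_lzero: "herm 0 w = 0"
    and herm_rzero: "herm w 0 = 0"
  by (simp_all add: herm_def sum.distrib sum_subtractf sum_negf sum_distrib_left algebra_simps)

lemma herm_scaleR:
  shows herm_lscaleR: "herm (r *\<^sub>R u) w = of_real r * herm u w"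
    and herm_rscaleR: "herm w (r *\<^sub>R u) = of_real r * herm w u"
  by (simp_all add: herm_def scaleR_sum_right[symmetric] scaleR_conv_of_real[symmetric])

lemma herm_lsum: "herm (\<Sum>i\<in>I. v i) w = (\<Sum>i\<in>I. herm (v i) w)"
  by (induction I rule: infinite_finite_induct) (simp_all add: herm_simps)

lemma herm_rsum: "herm w (\<Sum>i\<in>I. v i) = (\<Sum>i\<in>I. herm w (v i))"
  by (induction I rule: infinite_finite_induct) (simp_all add: herm_simps)

lemma herm_cnj: "cnj (herm v w) = herm w v"
  by (simp add: herm_def mult.commute)

lemma inner_eq_Re_herm: "v \<bullet> w = Re (herm v w)"
  by (simp add: inner_vec_def herm_def inner_complex_def)

lemma herm_self: "herm v v = of_real ((norm v)\<^sup>2)"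
proof (rule complex_eqI)
  show "Re (herm v v) = Re (of_real ((norm v)\<^sup>2))"
    by (simp add: inner_eq_Re_herm[symmetric] power2_norm_eq_inner del: of_real_power)
  show "Im (herm v v) = Im (of_real ((norm v)\<^sup>2))"
    by (simp add: herm_def)
qed

lemma herm_self_eq_0: "herm v v = 0 \<longleftrightarrow> v = 0"
  by (simp add: herm_self)

lemma herm_act: "herm (act A v) w = herm v (act (star A) w)"
proof -
  have "herm (act A v) w = (\<Sum>i\<in>UNIV. \<Sum>j\<in>UNIV. mtx A $ i $ j * v $ j * cnj (w $ i))"
    by (simp add: herm_def act.rep_eq matrix_vector_mult_def sum_distrib_right)
  also have "\<dots> = (\<Sum>j\<in>UNIV. \<Sum>i\<in>UNIV. mtx A $ i $ j * v $ j * cnj (w $ i))"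
    by (rule sum.swap)
  also have "\<dots> = herm v (act (star A) w)"
    by (simp add: herm_def act.rep_eq star.rep_eq matrix_vector_mult_def sum_distrib_left mult_ac)
  finally show ?thesis .
qed

lemma act_outer: "act (outer v w) x = herm x w *s v"
  by transfer (simp add: herm_def vec_eq_iff matrix_vector_mult_def sum_distrib_left sum_distrib_right mult_ac)

lemma outer_mult_left: "A * outer v w = outer (act A v) w"
  by (rule cop_eqI) (simp add: act_simps act_outer act_vec_simps)

lemma star_mult_self_eq_0:
  assumes "star A * A = 0"
  shows "A = 0"
proof (rule cop_eqI)
  fix v
  have "herm (act A v) (act A v) = 0"
    by (simp add: herm_act act_mult[symmetric] assms act_zero herm_rzero)
  then show "act A v = act 0 v" by (simp add: herm_self_eq_0 act_zero)
qed

lemma bounded_linear_Op: "bounded_linear Op"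
proof -
  have "linear Op"
    by (rule linearI) (simp_all add: plus_cop.abs_eq scaleR_cop.abs_eq)
  then show ?thesis by (simp add: linear_conv_bounded_linear)
qed

lemma norm_mtx_entry_le: "norm (mtx A $ i $ j) \<le> norm A"
proof -
  have "mtx A $ i $ j = (mtx A *v axis j 1) $ i"
    by (simp add: matrix_vector_mult_def axis_def if_distrib[of "\<lambda>x. _ * x"] cong: if_cong)
  also have "norm \<dots> \<le> norm (mtx A *v axis j 1)" by (rule Finite_Cartesian_Product.norm_nth_le)
  also have "\<dots> \<le> norm A * norm (axis j (1::complex))"
    unfolding norm_cop.rep_eq by (rule onorm[OF bounded_linear_mv])
  finally show ?thesis by simp
qed

lemma bounded_linear_mtx: "bounded_linear (mtx :: 'm::finite cop \<Rightarrow> _)"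
proof (rule bounded_linear_intro[where K = "real CARD('m) * real CARD('m)"])
  fix A B :: "'m cop" and r :: real
  show "mtx (A + B) = mtx A + mtx B" "mtx (r *\<^sub>R A) = r *\<^sub>R mtx A"
    by (simp_all add: plus_cop.rep_eq scaleR_cop.rep_eq)
  have "norm (mtx A) \<le> (\<Sum>i\<in>UNIV. norm (mtx A $ i))"
    unfolding norm_vec_def by (rule L2_set_le_sum) simp
  also have "\<dots> \<le> (\<Sum>i\<in>(UNIV::'m set). \<Sum>j\<in>(UNIV::'m set). norm (mtx A $ i $ j))"
    unfolding norm_vec_def by (intro sum_mono L2_set_le_sum) simp
  also have "\<dots> \<le> (\<Sum>i\<in>(UNIV::'m set). \<Sum>j\<in>(UNIV::'m set). norm A)"
    by (intro sum_mono norm_mtx_entry_le)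
  finally show "norm (mtx A) \<le> norm A * (real CARD('m) * real CARD('m))" by (simp add: mult_ac)
qed

lemma bounded_linear_star: "bounded_linear star"
proof -
  have "linear (\<lambda>A :: complex ^ 'a ^ 'a. \<chi> i j. cnj (A $ j $ i))"
    by (rule linearI) (simp_all add: vec_eq_iff)
  then have "bounded_linear (\<lambda>A :: complex ^ 'a ^ 'a. \<chi> i j. cnj (A $ j $ i))"
    by (simp add: linear_conv_bounded_linear)
  from bounded_linear_compose[OF bounded_linear_Op bounded_linear_compose[OF this bounded_linear_mtx]]
  have "bounded_linear (\<lambda>A :: 'a cop. Op (\<chi> i j. cnj (mtx A $ j $ i)))" .
  moreover have "star = (\<lambda>A :: 'a cop. Op (\<chi> i j. cnj (mtx A $ j $ i)))"
    by (rule ext) (metis star.rep_eq mtx_inverse)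
  ultimately show ?thesis by simp
qed

lemma bounded_bilinear_act: "bounded_bilinear act"
proof (rule bounded_bilinear.intro)
  show "\<exists>K. \<forall>a b. norm (act a b) \<le> norm a * norm b * K"
    by (rule exI[of _ 1]) (simp add: act.rep_eq norm_cop.rep_eq onorm[OF bounded_linear_mv])
qed (simp_all add: act_simps act_vec_simps)

lemma bounded_bilinear_outer: "bounded_bilinear outer"
proof -
  have "bilinear (\<lambda>v w :: complex ^ 'a. \<chi> i j. v $ i * cnj (w $ j))"
    unfolding bilinear_def
    by (intro conjI allI linearI) (simp_all add: vec_eq_iff algebra_simps)
  then have "bounded_bilinear (\<lambda>v w :: complex ^ 'a. \<chi> i j. v $ i * cnj (w $ j))"
    by (simp add: bilinear_conv_bounded_bilinear)
  from bounded_bilinear.nonneg_bounded[OF this] obtain K where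
    K: "\<And>v w :: complex ^ 'a. norm (\<chi> i j. v $ i * cnj (w $ j) :: complex ^ 'a ^ 'a) \<le> norm v * norm w * K"
    by blast
  from bounded_linear.nonneg_bounded[OF bounded_linear_Op] obtain L where
    L: "L \<ge> 0" "\<And>A :: complex ^ 'a ^ 'a. norm (Op A) \<le> norm A * L"
    by blast
  show ?thesis
  proof (rule bounded_bilinear.intro)
    fix v v' w w' :: "complex ^ 'a" and r :: real
    show "outer (v + v') w = outer v w + outer v' w" "outer v (w + w') = outer v w + outer v w'"
      "outer (r *\<^sub>R v) w = r *\<^sub>R outer v w" "outer v (r *\<^sub>R w) = r *\<^sub>R outer v w"
      by (transfer; simp add: vec_eq_iff algebra_simps)+
    have "norm (outer v w) \<le> norm v * norm w * (K * L)" for v w :: "complex ^ 'a"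
      using order_trans[OF L(2) mult_right_mono[OF K L(1)]]
      by (simp add: outer.abs_eq mult.assoc)
    then show "\<exists>K. \<forall>v w :: complex ^ 'a. norm (outer v w) \<le> norm v * norm w * K" by blast
  qed
qed

subsection \<open>Quaternionic structure\<close>

lemma jmul_nth:
  "jmul v $ (k, False) = - cnj (v $ (k, True))" "jmul v $ (k, True) = cnj (v $ (k, False))"
proof -
  have "jmul v $ p = (\<Sum>l\<in>UNIV. \<Sum>b\<in>UNIV. Jmat $ p $ (l, b) * cnj (v $ (l, b)))" for p
    by (simp add: jmul_def matrix_vector_mult_def sum.cartesian_product flip: UNIV_Times_UNIV)
  moreover have "Jmat $ (k, False) $ (l, b) * c = (if l = k then if b then - c else 0 else 0)"
    "Jmat $ (k, True) $ (l, b) * c = (if l = k then if b then 0 else c else 0)" for l b and c :: complex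
    by (simp_all add: Jmat_def)
  ultimately show "jmul v $ (k, False) = - cnj (v $ (k, True))" "jmul v $ (k, True) = cnj (v $ (k, False))"
    by (simp_all add: UNIV_bool if_distrib[of "sum _"] sum.If_cases cong: if_cong)
qed

lemma jmul_eqI:
  assumes "\<And>k. v $ (k, False) = w $ (k, False)" "\<And>k. v $ (k, True) = w $ (k, True)"
  shows "v = (w :: complex ^ ('n::finite \<times> bool))"
  using assms by (auto simp: vec_eq_iff) (metis (full_types))

lemma jmul_simps:
  shows jmul_jmul: "jmul (jmul v) = - v"
    and jmul_add: "jmul (v + w) = jmul v + jmul w"
    and jmul_diff: "jmul (v - w) = jmul v - jmul w"
    and jmul_uminus: "jmul (- v) = - jmul v"
    and jmul_zero: "jmul 0 = 0"
    and jmul_scale: "jmul (c *s v) = cnj c *s jmul v"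
    and jmul_scaleR: "jmul (r *\<^sub>R v) = r *\<^sub>R jmul v"
  by (rule jmul_eqI; simp add: jmul_nth)+

lemma jmul_sum: "jmul (\<Sum>i\<in>I. v i) = (\<Sum>i\<in>I. jmul (v i))"
  by (induction I rule: infinite_finite_induct) (simp_all add: jmul_simps)

lemma herm_split: "herm v w = (\<Sum>k\<in>UNIV. v $ (k, False) * cnj (w $ (k, False)) + v $ (k, True) * cnj (w $ (k, True)))"
proof -
  have "herm v w = (\<Sum>k\<in>UNIV. \<Sum>b\<in>UNIV. v $ (k, b) * cnj (w $ (k, b)))"
    by (simp add: herm_def sum.cartesian_product flip: UNIV_Times_UNIV)
  then show ?thesis by (simp add: UNIV_bool add.commute)
qed

lemma herm_jmul_jmul: "herm (jmul v) (jmul w) = herm w v"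
  by (simp add: herm_split jmul_nth algebra_simps)

lemma herm_jmul_left: "herm (jmul v) w = - herm (jmul w) v"
  by (simp add: herm_split jmul_nth algebra_simps flip: sum_negf)

lemma herm_jmul_right: "herm v (jmul w) = - herm w (jmul v)"
  by (simp add: herm_split jmul_nth algebra_simps flip: sum_negf)

lemma herm_jmul_self: "herm (jmul v) v = 0" "herm v (jmul v) = 0"
  using herm_jmul_left[of v v] herm_jmul_right[of v v] by simp_all

lemma bounded_linear_jmul: "bounded_linear jmul"
proof -
  have "linear jmul" by (rule linearI) (simp_all add: jmul_simps)
  then show ?thesis by (simp add: linear_conv_bounded_linear)
qed

text \<open>\<open>jc A\<close> is the complex linear map \<open>j A j\<^sup>-\<^sup>1\<close>, given by its columns.\<close>

definition jc :: "('n::finite \<times> bool) cop \<Rightarrow> ('n \<times> bool) cop" where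
  "jc A = (\<Sum>p\<in>UNIV. outer (- jmul (act A (jmul (axis p 1)))) (axis p 1))"

lemma vec_axis_sum: "(\<Sum>p\<in>UNIV. v $ p *s axis p 1) = (v :: complex ^ 'm::finite)"
  by (simp add: basis_expansion)

lemma act_jc: "act (jc A) v = - jmul (act A (jmul v))"
proof -
  have "herm v (axis p 1) = v $ p" for p
    by (simp add: herm_def axis_def if_distrib[of cnj] if_distrib[of "\<lambda>x. _ * x"] cong: if_cong)
  then have "act (jc A) v = (\<Sum>p\<in>UNIV. v $ p *s (- jmul (act A (jmul (axis p 1)))))"
    by (simp add: jc_def act_sum act_outer)
  also have "\<dots> = - jmul (act A (jmul (\<Sum>p\<in>UNIV. v $ p *s axis p 1)))"
    by (simp add: jmul_sum act_vsum jmul_simps act_vec_simps sum_negf)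
  finally show ?thesis by (simp add: vec_axis_sum)
qed

lemma jc_simps:
  shows jc_add: "jc (A + B) = jc A + jc B"
    and jc_diff: "jc (A - B) = jc A - jc B"
    and jc_uminus: "jc (- A) = - jc A"
    and jc_mult: "jc (A * B) = jc A * jc B"
    and jc_scaleR: "jc (r *\<^sub>R A) = r *\<^sub>R jc A"
    and jc_iu: "jc iu = - iu"
  by (rule cop_eqI; simp add: act_jc act_simps act_vec_simps jmul_simps)+

lemma bounded_linear_jc: "bounded_linear jc"
proof -
  have "bounded_linear (\<lambda>A. outer (- jmul (act A (jmul (axis p 1)))) (axis p 1))" for p :: "'a \<times> bool"
    by (intro bounded_linear_compose[OF bounded_bilinear.bounded_linear_left[OF bounded_bilinear_outer]]
        bounded_linear_minus bounded_linear_compose[OF bounded_linear_jmul]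
        bounded_bilinear.bounded_linear_left[OF bounded_bilinear_act])
  then have "bounded_linear (\<lambda>A :: ('a \<times> bool) cop. \<Sum>p\<in>UNIV. outer (- jmul (act A (jmul (axis p 1)))) (axis p 1))"
    by (rule bounded_linear_sum)
  then show ?thesis by (simp add: jc_def[abs_def])
qed

section \<open>Smooth maps\<close>

lemma Ck_on_cong:
  assumes "open U" "\<And>z. z \<in> U \<Longrightarrow> f z = g z" "Ck_on k U f"
  shows "Ck_on k U g"
  using assms(2,3)
proof (induction k arbitrary: f g)
  case 0
  then show ?case by (auto cong: continuous_on_cong)
next
  case (Suc k)
  have d: "f differentiable at z" if "z \<in> U" for z using Suc.prems(2) that by simp
  have e: "frechet_derivative f (at z) = frechet_derivative g (at z)" if "z \<in> U" for z
    by (rule frechet_derivative_transform_within_open[OF d \<open>open U\<close>]) (use that Suc.prems(1) in auto)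
  have "g differentiable at z" if "z \<in> U" for z
  proof -
    have "(f has_derivative frechet_derivative f (at z)) (at z)"
      using d[OF that] by (simp add: frechet_derivative_works)
    then have "(g has_derivative frechet_derivative f (at z)) (at z)"
      by (rule has_derivative_transform_within_open[OF _ \<open>open U\<close> that]) (rule Suc.prems(1))
    then show ?thesis by (rule differentiableI)
  qed
  moreover have "Ck_on k U (\<lambda>z. frechet_derivative g (at z) v)" for v
    by (rule Suc.IH[of "\<lambda>z. frechet_derivative f (at z) v"]) (use e Suc.prems(2) in auto)
  ultimately show ?case by simp
qed

lemma Ck_on_subset: "Ck_on k U f \<Longrightarrow> V \<subseteq> U \<Longrightarrow> Ck_on k V f"
  by (induction k arbitrary: f) (auto intro: continuous_on_subset)

lemma Ck_on_imp_continuous_on: "Ck_on k U f \<Longrightarrow> continuous_on U f"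
  by (cases k) (auto intro!: differentiable_imp_continuous_on
      simp: differentiable_on_def differentiable_at_withinI)

lemma Ck_on_Suc_imp: "Ck_on (Suc k) U f \<Longrightarrow> Ck_on k U f"
proof (induction k arbitrary: f)
  case 0
  then show ?case using Ck_on_imp_continuous_on[of "Suc 0" U f] by simp
next
  case (Suc k)
  then show ?case by (metis Ck_on.simps(2))
qed

lemma Ck_on_local:
  assumes "\<And>z. z \<in> S \<Longrightarrow> \<exists>U. open U \<and> z \<in> U \<and> Ck_on k U f"
  shows "Ck_on k S f"
  using assms
proof (induction k arbitrary: f)
  case 0
  have "isCont f z" if "z \<in> S" for z
    using 0[OF that] by (auto simp: continuous_on_eq_continuous_at)
  then show ?case by (simp add: continuous_at_imp_continuous_on)
next
  case (Suc k)
  then have "\<exists>U. open U \<and> z \<in> U \<and> f differentiable at z \<and> Ck_on k U (\<lambda>z. frechet_derivative f (at z) v)"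
    if "z \<in> S" for z v using that by fastforce
  then show ?case using Suc.IH by (metis Ck_on.simps(2))
qed

lemma frechet_derivativeI: "(f has_derivative f') (at z) \<Longrightarrow> frechet_derivative f (at z) = f'"
  using frechet_derivative_at by metis

lemma Ck_on_const: "Ck_on k U (\<lambda>z. c)"
  by (induction k arbitrary: c) auto

lemma Ck_on_bounded_linear:
  assumes "bounded_linear h" "open U" "Ck_on k U f"
  shows "Ck_on k U (\<lambda>z. h (f z))"
  using assms(3)
proof (induction k arbitrary: f)
  case 0
  then show ?case
    by (auto intro: continuous_on_compose2[OF linear_continuous_on[OF assms(1)]])
next
  case (Suc k)
  have d: "((\<lambda>z. h (f z)) has_derivative (\<lambda>v. h (frechet_derivative f (at z) v))) (at z)" if "z \<in> U" for z
    using Suc.prems that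
    by (intro bounded_linear.has_derivative[OF assms(1)]) (simp add: frechet_derivative_works)
  have "Ck_on k U (\<lambda>z. frechet_derivative (\<lambda>z. h (f z)) (at z) v)" for v
    by (rule Ck_on_cong[OF assms(2) _ Suc.IH[of "\<lambda>z. frechet_derivative f (at z) v"]])
      (use Suc.prems in \<open>auto simp: frechet_derivativeI[OF d]\<close>)
  then show ?case using d by (auto simp: differentiable_def)
qed

lemma Ck_on_add:
  assumes "open U" "Ck_on k U f" "Ck_on k U g"
  shows "Ck_on k U (\<lambda>z. f z + g z)"
  using assms(2,3)
proof (induction k arbitrary: f g)
  case 0
  then show ?case by (auto intro: continuous_on_add)
next
  case (Suc k)
  have d: "((\<lambda>z. f z + g z) has_derivative (\<lambda>v. frechet_derivative f (at z) v + frechet_derivative g (at z) v)) (at z)"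
    if "z \<in> U" for z
    using Suc.prems that by (intro has_derivative_add) (simp_all add: frechet_derivative_works)
  have "Ck_on k U (\<lambda>z. frechet_derivative (\<lambda>z. f z + g z) (at z) v)" for v
    by (rule Ck_on_cong[OF assms(1) _ Suc.IH[of "\<lambda>z. frechet_derivative f (at z) v" "\<lambda>z. frechet_derivative g (at z) v"]])
      (use Suc.prems in \<open>auto simp: frechet_derivativeI[OF d]\<close>)
  then show ?case using d by (auto simp: differentiable_def)
qed

lemma Ck_on_bounded_bilinear:
  assumes "bounded_bilinear h" "open U" "Ck_on k U f" "Ck_on k U g"
  shows "Ck_on k U (\<lambda>z. h (f z) (g z))"
  using assms(3,4)
proof (induction k arbitrary: f g)
  case 0
  then show ?case by (auto intro: bounded_bilinear.continuous_on[OF assms(1)])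
next
  case (Suc k)
  have d: "((\<lambda>z. h (f z) (g z)) has_derivative
      (\<lambda>v. h (f z) (frechet_derivative g (at z) v) + h (frechet_derivative f (at z) v) (g z))) (at z)"
    if "z \<in> U" for z
    using Suc.prems that
    by (intro bounded_bilinear.FDERIV[OF assms(1)]) (simp_all add: frechet_derivative_works)
  have "Ck_on k U (\<lambda>z. frechet_derivative (\<lambda>z. h (f z) (g z)) (at z) v)" for v
    by (rule Ck_on_cong[OF assms(2) _ Ck_on_add[OF assms(2) Suc.IH[of f "\<lambda>z. frechet_derivative g (at z) v"]
            Suc.IH[of "\<lambda>z. frechet_derivative f (at z) v" g]]])
      (use Suc.prems Ck_on_Suc_imp[of k U f] Ck_on_Suc_imp[of k U g] in \<open>auto simp: frechet_derivativeI[OF d]\<close>)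
  then show ?case using d by (auto simp: differentiable_def)
qed

lemma smooth_on_cong:
  assumes "open U" "\<And>z. z \<in> U \<Longrightarrow> f z = g z" "smooth_on U f"
  shows "smooth_on U g"
  unfolding smooth_on_def
proof
  fix k
  show "Ck_on k U g"
    by (rule Ck_on_cong[OF assms(1,2)]) (use assms(3) in \<open>auto simp: smooth_on_def\<close>)
qed

lemma smooth_on_subset: "smooth_on U f \<Longrightarrow> V \<subseteq> U \<Longrightarrow> smooth_on V f"
  unfolding smooth_on_def by (auto intro: Ck_on_subset)

lemma smooth_on_local:
  assumes "\<And>z. z \<in> S \<Longrightarrow> \<exists>U. open U \<and> z \<in> U \<and> smooth_on U f"
  shows "smooth_on S f"
  unfolding smooth_on_def
proof
  fix k
  show "Ck_on k S f"
    by (rule Ck_on_local) (use assms in \<open>auto simp: smooth_on_def\<close>)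
qed

lemma smooth_on_const: "smooth_on U (\<lambda>z. c)"
  by (simp add: smooth_on_def Ck_on_const)

lemma smooth_on_dir:
  assumes "smooth_on U f"
  shows "smooth_on U (dir X f)"
  unfolding smooth_on_def
proof
  fix k
  have "Ck_on (Suc k) U f" using assms by (simp only: smooth_on_def)
  then show "Ck_on k U (dir X f)" by (simp add: dir_def[abs_def])
qed

lemma smooth_on_differentiable:
  assumes "smooth_on U f" "z \<in> U"
  shows "f differentiable at z"
proof -
  have "Ck_on (Suc 0) U f" using assms(1) by (simp only: smooth_on_def)
  then show ?thesis using assms(2) by simp
qed

lemma smooth_on_continuous_on:
  assumes "smooth_on U f"
  shows "continuous_on U f"
proof -
  have "Ck_on 0 U f" using assms by (simp only: smooth_on_def)
  then show ?thesis by simp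
qed

lemma smooth_on_bounded_linear:
  "bounded_linear h \<Longrightarrow> open U \<Longrightarrow> smooth_on U f \<Longrightarrow> smooth_on U (\<lambda>z. h (f z))"
  unfolding smooth_on_def by (simp add: Ck_on_bounded_linear)

lemma smooth_on_bounded_bilinear:
  "bounded_bilinear h \<Longrightarrow> open U \<Longrightarrow> smooth_on U f \<Longrightarrow> smooth_on U g \<Longrightarrow> smooth_on U (\<lambda>z. h (f z) (g z))"
  unfolding smooth_on_def by (simp add: Ck_on_bounded_bilinear)

lemma smooth_on_add: "open U \<Longrightarrow> smooth_on U f \<Longrightarrow> smooth_on U g \<Longrightarrow> smooth_on U (\<lambda>z. f z + g z)"
  unfolding smooth_on_def by (simp add: Ck_on_add)

lemma smooth_on_uminus: "open U \<Longrightarrow> smooth_on U f \<Longrightarrow> smooth_on U (\<lambda>z. - f z)"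
  using smooth_on_bounded_linear[OF bounded_linear_minus[OF bounded_linear_ident]] by auto

lemma smooth_on_diff: "open U \<Longrightarrow> smooth_on U f \<Longrightarrow> smooth_on U g \<Longrightarrow> smooth_on U (\<lambda>z. f z - g z)"
  using smooth_on_add[OF _ _ smooth_on_uminus[of U g], of f] by simp

lemma smooth_on_mult:
  fixes f g :: "complex \<Rightarrow> 'a::real_normed_algebra"
  shows "open U \<Longrightarrow> smooth_on U f \<Longrightarrow> smooth_on U g \<Longrightarrow> smooth_on U (\<lambda>z. f z * g z)"
  by (rule smooth_on_bounded_bilinear[OF bounded_bilinear_mult])

lemma smooth_on_scaleR: "open U \<Longrightarrow> smooth_on U f \<Longrightarrow> smooth_on U (\<lambda>z. r *\<^sub>R f z)"
  by (rule smooth_on_bounded_linear[OF bounded_linear_scaleR_right])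

lemma smooth_on_sum:
  assumes "open U" "\<And>i. i \<in> I \<Longrightarrow> smooth_on U (f i)"
  shows "smooth_on U (\<lambda>z. \<Sum>i\<in>I. f i z)"
  using assms(2) by (induction I rule: infinite_finite_induct)
    (simp_all add: smooth_on_const smooth_on_add assms(1))

section \<open>Calculus rules for directional derivatives\<close>

lemma dir_eqI: "(f has_derivative f') (at z) \<Longrightarrow> dir X f z = f' X"
  by (simp add: dir_def frechet_derivativeI)

lemma has_derivative_dir: "f differentiable at z \<Longrightarrow> (f has_derivative (\<lambda>X. dir X f z)) (at z)"
  by (simp add: dir_def[abs_def] frechet_derivative_works)

lemma dir_cong:
  assumes "open U" "z \<in> U" "\<And>w. w \<in> U \<Longrightarrow> f w = g w" "f differentiable at z"
  shows "dir X f z = dir X g z"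
  unfolding dir_def using frechet_derivative_transform_within_open[OF assms(4,1,2,3)] by simp

lemma dir_const: "dir X (\<lambda>z. c) z = 0"
  by (simp add: dir_def)

lemma dir_bounded_linear:
  "bounded_linear h \<Longrightarrow> f differentiable at z \<Longrightarrow> dir X (\<lambda>z. h (f z)) z = h (dir X f z)"
  by (rule dir_eqI[OF bounded_linear.has_derivative[OF _ has_derivative_dir]])

lemma dir_bounded_bilinear:
  "bounded_bilinear h \<Longrightarrow> f differentiable at z \<Longrightarrow> g differentiable at z \<Longrightarrow>
   dir X (\<lambda>z. h (f z) (g z)) z = h (f z) (dir X g z) + h (dir X f z) (g z)"
  by (rule dir_eqI[OF bounded_bilinear.FDERIV[OF _ has_derivative_dir has_derivative_dir]])

lemma dir_add: "f differentiable at z \<Longrightarrow> g differentiable at z \<Longrightarrow>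
   dir X (\<lambda>z. f z + g z) z = dir X f z + dir X g z"
  by (rule dir_eqI[OF has_derivative_add[OF has_derivative_dir has_derivative_dir]])

lemma dir_uminus: "f differentiable at z \<Longrightarrow> dir X (\<lambda>z. - f z) z = - dir X f z"
  by (rule dir_eqI[OF has_derivative_minus[OF has_derivative_dir]])

lemma dir_diff: "f differentiable at z \<Longrightarrow> g differentiable at z \<Longrightarrow>
   dir X (\<lambda>z. f z - g z) z = dir X f z - dir X g z"
  by (rule dir_eqI[OF has_derivative_diff[OF has_derivative_dir has_derivative_dir]])

lemma dir_scaleR: "f differentiable at z \<Longrightarrow> dir X (\<lambda>z. r *\<^sub>R f z) z = r *\<^sub>R dir X f z"
  by (rule dir_bounded_linear[OF bounded_linear_scaleR_right])

lemma dir_mult: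
  fixes f g :: "complex \<Rightarrow> 'a::real_normed_algebra"
  shows "f differentiable at z \<Longrightarrow> g differentiable at z \<Longrightarrow>
   dir X (\<lambda>z. f z * g z) z = f z * dir X g z + dir X f z * g z"
  by (rule dir_bounded_bilinear[OF bounded_bilinear_mult])

lemma dir_linear:
  assumes "f differentiable at z"
  shows "dir (r *\<^sub>R X + s *\<^sub>R Y) f z = r *\<^sub>R dir X f z + s *\<^sub>R dir Y f z"
proof -
  have "linear (\<lambda>X. dir X f z)"
    using has_derivative_linear[OF has_derivative_dir[OF assms]] .
  from linear_add[OF this] linear_scale[OF this] show ?thesis by simp
qed

lemma dir_coords:
  assumes "f differentiable at z"
  shows "dir X f z = Re X *\<^sub>R dir 1 f z + Im X *\<^sub>R dir \<i> f z"
proof -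
  have "X = Re X *\<^sub>R 1 + Im X *\<^sub>R \<i>" by (simp add: complex_eq_iff)
  then show ?thesis using dir_linear[OF assms, of "Re X" 1 "Im X" \<i>] by simp
qed

lemma dir_zero_imp_constant:
  assumes "\<And>z. f differentiable at z" "\<And>z. dir 1 f z = 0" "\<And>z. dir \<i> f z = 0"
  shows "f z = f w"
proof -
  have "(f has_derivative (\<lambda>X. 0)) (at z within UNIV)" for z
  proof -
    have "dir X f z = 0" for X by (subst dir_coords[OF assms(1)]) (simp add: assms(2,3))
    then show ?thesis using has_derivative_dir[OF assms(1), of z] by simp
  qed
  from has_derivative_zero_unique[OF convex_UNIV this] show ?thesis by blast
qed

subsection \<open>Symmetry of second derivatives\<close>

lemma mvt_line:
  fixes g :: "complex \<Rightarrow> real"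
  assumes "\<And>z. g differentiable at z" "h > 0"
  shows "\<exists>t\<in>{0<..<h}. g (z + of_real h * X) - g z = h * dir X g (z + of_real t * X)"
proof -
  have d: "((\<lambda>t. g (z + of_real t * X)) has_real_derivative dir X g (z + of_real t * X)) (at t)" for t
  proof -
    have "((\<lambda>t. z + of_real t * X) has_derivative (\<lambda>s. of_real s * X)) (at t)"
      by (auto intro!: derivative_eq_intros)
    from diff_chain_at[OF this has_derivative_dir[OF assms(1)]]
    have "((\<lambda>t. g (z + of_real t * X)) has_derivative (\<lambda>s. dir (of_real s * X) g (z + of_real t * X))) (at t)"
      by (simp add: o_def)
    moreover have "dir (of_real s * X) g w = dir X g w * s" for s w
      using dir_linear[OF assms(1), of s X 0 X w] by (simp add: scaleR_conv_of_real)
    ultimately show ?thesis by (simp add: has_field_derivative_def mult_commute_abs)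
  qed
  obtain t where "0 < t" "t < h" "g (z + of_real h * X) - g (z + of_real 0 * X) = (h - 0) * dir X g (z + of_real t * X)"
    using MVT2[OF \<open>h > 0\<close>, of "\<lambda>t. g (z + of_real t * X)" "\<lambda>t. dir X g (z + of_real t * X)"] d by blast
  then show ?thesis by auto
qed

text \<open>The mean value theorem is used twice, in direction \<open>X\<close> for the increment
  along \<open>Y\<close> and then in direction \<open>Y\<close>. The second difference on the left
  is symmetric in \<open>X\<close> and \<open>Y\<close>, whence the symmetry of second
  derivatives.\<close>

lemma second_difference:
  fixes g :: "complex \<Rightarrow> real"
  assumes "\<And>z. g differentiable at z" "\<And>z. dir X g differentiable at z" "h > 0"
  shows "\<exists>s\<in>{0<..<h}. \<exists>t\<in>{0<..<h}. g (z + of_real h * X + of_real h * Y) - g (z + of_real h * X) - g (z + of_real h * Y) + g z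
    = h * h * dir Y (dir X g) (z + of_real s * X + of_real t * Y)"
proof -
  define G where "G = (\<lambda>w. g (w + of_real h * Y) - g w)"
  have sh: "((\<lambda>w. g (w + of_real h * Y)) has_derivative (\<lambda>X. dir X g (w + of_real h * Y))) (at w)" for w
  proof -
    have "((\<lambda>w. w + of_real h * Y) has_derivative (\<lambda>X. X)) (at w)"
      by (auto intro!: derivative_eq_intros)
    from diff_chain_at[OF this has_derivative_dir[OF assms(1)]] show ?thesis by (simp add: o_def)
  qed
  have G: "(G has_derivative (\<lambda>X. dir X g (w + of_real h * Y) - dir X g w)) (at w)" for w
    unfolding G_def by (intro has_derivative_diff sh has_derivative_dir assms(1))
  then have "G differentiable at w" for w by (auto simp: differentiable_def)
  from mvt_line[OF this \<open>h > 0\<close>, of z X] obtain s where s: "s \<in> {0<..<h}"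
    "G (z + of_real h * X) - G z = h * dir X G (z + of_real s * X)" by blast
  have "dir X G (z + of_real s * X) = dir X g (z + of_real s * X + of_real h * Y) - dir X g (z + of_real s * X)"
    by (rule dir_eqI[OF G])
  moreover from mvt_line[OF assms(2,3), of "z + of_real s * X" Y] obtain t where "t \<in> {0<..<h}"
    "dir X g (z + of_real s * X + of_real h * Y) - dir X g (z + of_real s * X) = h * dir Y (dir X g) (z + of_real s * X + of_real t * Y)"
    by blast
  ultimately show ?thesis using s unfolding G_def by (intro bexI[of _ s] bexI[of _ t]) (auto simp: algebra_simps)
qed

lemma dir_commute_real:
  fixes g :: "complex \<Rightarrow> real"
  assumes "smooth_on UNIV g"
  shows "dir Y (dir X g) z = dir X (dir Y g) z"
proof -
  have lim: "((\<lambda>k. dir Y (dir X g) (z + of_real (s k) * X + of_real (t k) * Y)) \<longlongrightarrow> dir Y (dir X g) z) sequentially"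
    if "\<And>k. s k \<in> {0<..<inverse (real (Suc k))}" "\<And>k. t k \<in> {0<..<inverse (real (Suc k))}" for s t X Y
  proof -
    have c: "isCont (dir Y (dir X g)) z"
      using smooth_on_continuous_on[OF smooth_on_dir[OF smooth_on_dir[OF assms]]]
      by (simp add: continuous_on_eq_continuous_at)
    have 0: "s \<longlonglongrightarrow> 0" if "\<And>k. s k \<in> {0<..<inverse (real (Suc k))}" for s :: "nat \<Rightarrow> real"
      by (rule tendsto_sandwich[OF _ _ tendsto_const LIMSEQ_inverse_real_of_nat])
        (use that in \<open>auto intro!: always_eventually less_imp_le\<close>)
    have "((\<lambda>k. z + of_real (s k) * X + of_real (t k) * Y) \<longlongrightarrow> z + of_real 0 * X + of_real 0 * Y) sequentially"
      by (intro tendsto_intros 0 that)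
    then show ?thesis using isCont_tendsto_compose[OF c] by simp
  qed
  have d: "g differentiable at w" "dir X g differentiable at w" for w X
    using smooth_on_differentiable[OF assms] smooth_on_differentiable[OF smooth_on_dir[OF assms]] by auto
  have pos: "inverse (real (Suc k)) > 0" for k by simp
  from second_difference[OF d(1) d(2) pos, of _ z X Y] obtain s t where 1:
    "s k \<in> {0<..<inverse (real (Suc k))}" "t k \<in> {0<..<inverse (real (Suc k))}"
    "g (z + of_real (inverse (real (Suc k))) * X + of_real (inverse (real (Suc k))) * Y) - g (z + of_real (inverse (real (Suc k))) * X)
       - g (z + of_real (inverse (real (Suc k))) * Y) + g z
     = inverse (real (Suc k)) * inverse (real (Suc k)) * dir Y (dir X g) (z + of_real (s k) * X + of_real (t k) * Y)" for k
    by metis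
  from second_difference[OF d(1) d(2) pos, of _ z Y X] obtain s' t' where 2:
    "s' k \<in> {0<..<inverse (real (Suc k))}" "t' k \<in> {0<..<inverse (real (Suc k))}"
    "g (z + of_real (inverse (real (Suc k))) * Y + of_real (inverse (real (Suc k))) * X) - g (z + of_real (inverse (real (Suc k))) * Y)
       - g (z + of_real (inverse (real (Suc k))) * X) + g z
     = inverse (real (Suc k)) * inverse (real (Suc k)) * dir X (dir Y g) (z + of_real (s' k) * Y + of_real (t' k) * X)" for k
    by metis
  have "inverse (real (Suc k)) * inverse (real (Suc k)) * dir Y (dir X g) (z + of_real (s k) * X + of_real (t k) * Y)
    = inverse (real (Suc k)) * inverse (real (Suc k)) * dir X (dir Y g) (z + of_real (s' k) * Y + of_real (t' k) * X)" for k
    unfolding 1(3)[symmetric] 2(3)[symmetric] by (simp add: add_ac)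
  then have "dir Y (dir X g) (z + of_real (s k) * X + of_real (t k) * Y)
    = dir X (dir Y g) (z + of_real (s' k) * Y + of_real (t' k) * X)" for k
    by (simp del: of_nat_Suc)
  with lim[OF 1(1,2), of Y X] lim[OF 2(1,2), of X Y] show ?thesis by (simp add: LIMSEQ_unique)
qed

lemma dir_commute:
  fixes F :: "complex \<Rightarrow> 'm::finite cop"
  assumes "smooth_on UNIV F"
  shows "dir Y (dir X F) z = dir X (dir Y F) z"
proof -
  \<comment> \<open>Real functionals, below the real and imaginary parts of the entries, reduce the
    claim to real-valued functions.\<close>
  have *: "h (dir Y (dir X F) z) = h (dir X (dir Y F) z)" if h: "bounded_linear h" for h :: "'m cop \<Rightarrow> real"
  proof -
    have d: "G differentiable at w" if "smooth_on UNIV G" for G :: "complex \<Rightarrow> 'm cop" and w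
      using smooth_on_differentiable[OF that] by simp
    have 1: "dir X (\<lambda>z. h (G z)) = (\<lambda>z. h (dir X G z))" if "smooth_on UNIV G" for X G
      by (rule ext) (rule dir_bounded_linear[OF h d[OF that]])
    have "dir Y (dir X (\<lambda>z. h (F z))) z = dir X (dir Y (\<lambda>z. h (F z))) z"
      by (rule dir_commute_real) (rule smooth_on_bounded_linear[OF h open_UNIV assms])
    then show ?thesis by (simp add: 1 assms smooth_on_dir)
  qed
  have "mtx (dir Y (dir X F) z) $ i $ j = mtx (dir X (dir Y F) z) $ i $ j" for i j
  proof (rule complex_eqI)
    have b: "bounded_linear (\<lambda>A :: 'm cop. mtx A $ i $ j)"
      by (intro bounded_linear_compose[OF bounded_linear_vec_nth] bounded_linear_mtx)
    show "Re (mtx (dir Y (dir X F) z) $ i $ j) = Re (mtx (dir X (dir Y F) z) $ i $ j)"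
      by (rule *[OF bounded_linear_compose[OF bounded_linear_Re b]])
    show "Im (mtx (dir Y (dir X F) z) $ i $ j) = Im (mtx (dir X (dir Y F) z) $ i $ j)"
      by (rule *[OF bounded_linear_compose[OF bounded_linear_Im b]])
  qed
  then show ?thesis by (metis mtx_inject vec_eq_iff)
qed

section \<open>Wirtinger derivatives of matrix functions\<close>

definition Dz :: "(complex \<Rightarrow> 'm::finite cop) \<Rightarrow> complex \<Rightarrow> 'm cop" where
  "Dz F z = (1 / 2) *\<^sub>R (dir 1 F z - iu * dir \<i> F z)"

definition Dzb :: "(complex \<Rightarrow> 'm::finite cop) \<Rightarrow> complex \<Rightarrow> 'm cop" where
  "Dzb F z = (1 / 2) *\<^sub>R (dir 1 F z + iu * dir \<i> F z)"

abbreviation "smooth \<equiv> smooth_on UNIV"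

lemma smooth_differentiable: "smooth f \<Longrightarrow> f differentiable at z"
  by (simp add: smooth_on_differentiable)

lemma smooth_Dz: "smooth F \<Longrightarrow> smooth (Dz F)"
  unfolding Dz_def[abs_def]
  by (intro smooth_on_scaleR smooth_on_diff smooth_on_mult smooth_on_const smooth_on_dir open_UNIV)

lemma smooth_Dzb: "smooth F \<Longrightarrow> smooth (Dzb F)"
  unfolding Dzb_def[abs_def]
  by (intro smooth_on_scaleR smooth_on_add smooth_on_mult smooth_on_const smooth_on_dir open_UNIV)

lemma smooth_star: "smooth F \<Longrightarrow> smooth (\<lambda>z. star (F z))"
  by (rule smooth_on_bounded_linear[OF bounded_linear_star open_UNIV])

lemma iu_mult_left: "A * (iu * B) = iu * (A * B)"
  by (metis iu_commute mult.assoc)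

lemma D_mult:
  assumes "smooth F" "smooth G"
  shows "Dz (\<lambda>z. F z * G z) z = Dz F z * G z + F z * Dz G z"
    and "Dzb (\<lambda>z. F z * G z) z = Dzb F z * G z + F z * Dzb G z"
  using assms[THEN smooth_differentiable]
  by (simp_all add: Dz_def Dzb_def dir_mult iu_mult_left algebra_simps)

lemma D_uminus:
  assumes "smooth F"
  shows "Dz (\<lambda>z. - F z) z = - Dz F z" and "Dzb (\<lambda>z. - F z) z = - Dzb F z"
  using assms[THEN smooth_differentiable]
  by (simp_all add: Dz_def Dzb_def dir_uminus scaleR_add_right scaleR_diff_right)

lemma D_const: "Dz (\<lambda>z. c) z = 0" "Dzb (\<lambda>z. c) z = 0"
  by (simp_all add: Dz_def Dzb_def dir_const)

text \<open>The adjoint is conjugate-linear (\<open>star iu = - iu\<close>), so it exchanges the two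
  Wirtinger derivatives; \<open>jc\<close> does the same.\<close>

lemma D_star:
  assumes "smooth F"
  shows "Dz (\<lambda>z. star (F z)) z = star (Dzb F z)" and "Dzb (\<lambda>z. star (F z)) z = star (Dz F z)"
  using assms[THEN smooth_differentiable]
  by (simp_all add: Dz_def Dzb_def dir_bounded_linear[OF bounded_linear_star] star_simps iu_commute)

lemma D_jc:
  assumes "smooth F"
  shows "Dz (\<lambda>z. jc (F z)) z = jc (Dzb F z)" and "Dzb (\<lambda>z. jc (F z)) z = jc (Dz F z)"
  using assms[THEN smooth_differentiable]
  by (simp_all add: Dz_def Dzb_def dir_bounded_linear[OF bounded_linear_jc] jc_simps)

lemma dir_iu:
  assumes "smooth F"
  shows "dir X (\<lambda>z. iu * F z) z = iu * dir X F z"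
  using smooth_differentiable[OF assms] by (simp add: dir_mult dir_const smooth_differentiable[OF smooth_on_const])

lemma Dz_Dzb_eq:
  assumes "smooth F"
  shows "Dz (Dzb F) z = (1 / 4) *\<^sub>R (dir 1 (dir 1 F) z + dir \<i> (dir \<i> F) z)"
    and "Dzb (Dz F) z = (1 / 4) *\<^sub>R (dir 1 (dir 1 F) z + dir \<i> (dir \<i> F) z)"
proof -
  have s: "smooth (dir X F)" "smooth (\<lambda>z. iu * dir X F z)" for X
    by (intro smooth_on_dir smooth_on_mult smooth_on_const open_UNIV assms)+
  have d: "(dir X F) differentiable at z" "(\<lambda>z. iu * dir X F z) differentiable at z" for X z
    by (intro smooth_differentiable s)+
  have 1: "dir Y (Dz F) z = (1 / 2) *\<^sub>R (dir Y (dir 1 F) z - iu * dir Y (dir \<i> F) z)" for Y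
    unfolding Dz_def[abs_def]
    by (simp add: dir_scaleR dir_diff d differentiable_diff dir_iu[OF s(1)])
  have 2: "dir Y (Dzb F) z = (1 / 2) *\<^sub>R (dir Y (dir 1 F) z + iu * dir Y (dir \<i> F) z)" for Y
    unfolding Dzb_def[abs_def]
    by (simp add: dir_scaleR dir_add d differentiable_add dir_iu[OF s(1)])
  have c: "dir 1 (dir \<i> F) z = dir \<i> (dir 1 F) z"
    by (rule dir_commute[OF assms])
  have i: "iu * (iu * A) = - A" for A :: "'a cop"
    by (simp add: mult.assoc[symmetric] iu_mult_iu)
  show "Dz (Dzb F) z = (1 / 4) *\<^sub>R (dir 1 (dir 1 F) z + dir \<i> (dir \<i> F) z)"
    by (simp add: Dz_def[of "Dzb F"] 2 c i distrib_left right_diff_distrib scaleR_add_right scaleR_diff_right)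
  show "Dzb (Dz F) z = (1 / 4) *\<^sub>R (dir 1 (dir 1 F) z + dir \<i> (dir \<i> F) z)"
    by (simp add: Dzb_def[of "Dz F"] 1 c i distrib_left right_diff_distrib scaleR_add_right scaleR_diff_right)
qed

lemma D_zero_imp_constant:
  assumes "smooth F" "\<And>z. Dz F z = 0" "\<And>z. Dzb F z = 0"
  shows "F z = F w"
proof (rule dir_zero_imp_constant[OF smooth_differentiable[OF assms(1)]])
  fix z
  have "Dz F z + Dzb F z = dir 1 F z"
    by (simp add: Dz_def Dzb_def scaleR_add_right scaleR_diff_right flip: scaleR_left_distrib)
  then show "dir 1 F z = 0" by (simp add: assms)
  have "Dzb F z - Dz F z = iu * dir \<i> F z"
    by (simp add: Dz_def Dzb_def scaleR_add_right scaleR_diff_right flip: scaleR_left_distrib)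
  then have "iu * (iu * dir \<i> F z) = 0" by (simp add: assms)
  then show "dir \<i> F z = 0"
    by (simp add: mult.assoc[symmetric] iu_mult_iu)
qed

section \<open>Flat harmonic projectors\<close>

lemma Dz_const_mult: "smooth F \<Longrightarrow> Dz (\<lambda>z. c * F z) z = c * Dz F z"
  by (simp add: D_mult smooth_on_const D_const)

text \<open>\<open>P_Dz_Dzb_P\<close> and \<open>P_Dzb_Dz_P\<close> carry the metric and total
  reality: their agreement is the vanishing of the curvature, their value fixes the scale.
  \<open>harmonic\<close> says that the Laplacian of \<open>P\<close> has no normal part on the
  range of \<open>P z\<close>.\<close>

locale flat_harmonic_projector =
  fixes P :: "complex \<Rightarrow> 'm::finite cop"
  assumes smooth_P: "smooth P"
    and PP: "P z * P z = P z"
    and star_P: "star (P z) = P z"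
    and P_Dz_Dzb_P: "P z * Dz P z * Dzb P z * P z = P z"
    and P_Dzb_Dz_P: "P z * Dzb P z * Dz P z * P z = P z"
    and harmonic: "Dzb (Dz P) z * P z = P z * Dzb (Dz P) z * P z"
begin

lemma PP_left: "P z * (P z * A) = P z * A"
  by (simp add: mult.assoc[symmetric] PP)

lemma Dz_P: "Dz P z = Dz P z * P z + P z * Dz P z"
  and Dzb_P: "Dzb P z = Dzb P z * P z + P z * Dzb P z"
proof -
  have "(\<lambda>z. P z * P z) = P" by (simp add: PP)
  then show "Dz P z = Dz P z * P z + P z * Dz P z" "Dzb P z = Dzb P z * P z + P z * Dzb P z"
    using D_mult[OF smooth_P smooth_P, of z] by simp_all
qed

text \<open>Sandwiching the differentiated identity \<open>P z * P z = P z\<close> between two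
  factors \<open>P z\<close> produces the term twice. Derivatives of a projector thus exchange its
  range and the complement.\<close>

lemma P_Dz_P: "P z * Dz P z * P z = 0" and P_Dzb_P: "P z * Dzb P z * P z = 0"
proof -
  have "P z * Dz P z * P z = P z * (Dz P z * P z + P z * Dz P z) * P z" using Dz_P[of z] by simp
  also have "\<dots> = P z * Dz P z * P z + P z * Dz P z * P z"
    by (simp add: algebra_simps PP PP_left)
  finally show "P z * Dz P z * P z = 0" by simp
  have "P z * Dzb P z * P z = P z * (Dzb P z * P z + P z * Dzb P z) * P z" using Dzb_P[of z] by simp
  also have "\<dots> = P z * Dzb P z * P z + P z * Dzb P z * P z"
    by (simp add: algebra_simps PP PP_left)
  finally show "P z * Dzb P z * P z = 0" by simp
qed

text \<open>\<open>F z * P z = F z\<close> says that \<open>F\<close> is a homomorphism from the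
  bundle into the trivial bundle. Its covariant derivatives are \<open>Dz F z * P z\<close> and
  \<open>Dzb F z * P z\<close>; the other summand comes from the movement of the bundle.\<close>

lemma
  assumes "smooth F" "\<And>z. F z * P z = F z"
  shows Dz_supported: "Dz F z = Dz F z * P z + F z * Dz P z"
    and Dzb_supported: "Dzb F z = Dzb F z * P z + F z * Dzb P z"
proof -
  have "(\<lambda>z. F z * P z) = F" by (simp add: assms)
  then show "Dz F z = Dz F z * P z + F z * Dz P z" "Dzb F z = Dzb F z * P z + F z * Dzb P z"
    using D_mult[OF assms(1) smooth_P, of z] by simp_all
qed

text \<open>The covariant derivatives commute because the curvature is
  \<open>P (P\<^sub>z P\<^sub>z\<^sub>b - P\<^sub>z\<^sub>b P\<^sub>z) P = 0\<close>.\<close>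

lemma covariant_commute:
  assumes "smooth F" "\<And>z. F z * P z = F z"
  shows "Dz (\<lambda>z. Dzb F z * P z) z * P z = Dzb (\<lambda>z. Dz F z * P z) z * P z"
proof -
  have FP: "F z * (P z * A) = F z * A" for A by (simp add: mult.assoc[symmetric] assms)
  have 1: "Dz (\<lambda>z. Dzb F z * P z) z * P z = Dz (Dzb F) z * P z + Dzb F z * Dz P z * P z"
    by (simp add: D_mult smooth_P smooth_Dzb assms distrib_right mult.assoc PP)
  have 2: "Dzb (\<lambda>z. Dz F z * P z) z * P z = Dzb (Dz F) z * P z + Dz F z * Dzb P z * P z"
    by (simp add: D_mult smooth_P smooth_Dz assms distrib_right mult.assoc PP)
  have "Dzb F z * Dz P z * P z = (Dzb F z * P z + F z * Dzb P z) * Dz P z * P z"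
    using Dzb_supported[OF assms, of z] by simp
  also have "\<dots> = Dzb F z * (P z * Dz P z * P z) + F z * (P z * Dzb P z * Dz P z * P z)"
    by (simp add: algebra_simps FP)
  also have "\<dots> = F z" by (simp only: P_Dz_P P_Dzb_Dz_P assms mult_zero_right add_0)
  finally have 3: "Dzb F z * Dz P z * P z = F z" .
  have "Dz F z * Dzb P z * P z = (Dz F z * P z + F z * Dz P z) * Dzb P z * P z"
    using Dz_supported[OF assms, of z] by simp
  also have "\<dots> = Dz F z * (P z * Dzb P z * P z) + F z * (P z * Dz P z * Dzb P z * P z)"
    by (simp add: algebra_simps FP)
  also have "\<dots> = F z" by (simp only: P_Dzb_P P_Dz_Dzb_P assms mult_zero_right add_0)
  finally have 4: "Dz F z * Dzb P z * P z = F z" .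
  show ?thesis by (simp only: 1 2 3 4 Dz_Dzb_eq[OF assms(1)])
qed

text \<open>Differentiating \<open>P z * P z = P z\<close> twice and sandwiching gives
  \<open>P z * Dzb (Dz P) z * P z = - (P z + P z)\<close>. By \<open>harmonic\<close> this is all of
  \<open>Dzb (Dz P) z * P z\<close>, and the product rule adds one \<open>P z\<close> back.\<close>

lemma Dzb_Dz_P_P: "Dzb (\<lambda>z. Dz P z * P z) z * P z = - P z"
proof -
  have "Dz P = (\<lambda>z. Dz P z * P z + P z * Dz P z)" using Dz_P by auto
  then have "Dzb (Dz P) z = Dzb (\<lambda>z. Dz P z * P z + P z * Dz P z) z" by simp
  also have "\<dots> = Dzb (Dz P) z * P z + Dz P z * Dzb P z + (Dzb P z * Dz P z + P z * Dzb (Dz P) z)"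
  proof -
    have s: "smooth (\<lambda>z. Dz P z * P z)" "smooth (\<lambda>z. P z * Dz P z)"
      by (intro smooth_on_mult smooth_Dz smooth_P open_UNIV)+
    have "Dzb (\<lambda>z. Dz P z * P z + P z * Dz P z) z = Dzb (\<lambda>z. Dz P z * P z) z + Dzb (\<lambda>z. P z * Dz P z) z"
      using s[THEN smooth_differentiable] by (simp add: Dzb_def dir_add algebra_simps)
    then show ?thesis by (simp add: D_mult smooth_P smooth_Dz)
  qed
  finally have "P z * Dzb (Dz P) z * P z = P z * (Dzb (Dz P) z * P z + Dz P z * Dzb P z
    + (Dzb P z * Dz P z + P z * Dzb (Dz P) z)) * P z" by simp
  also have "\<dots> = P z * Dzb (Dz P) z * P z + P z * Dz P z * Dzb P z * P z
    + (P z * Dzb P z * Dz P z * P z + P z * Dzb (Dz P) z * P z)"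
    by (simp add: distrib_left distrib_right mult.assoc PP PP_left)
  finally have "P z * Dzb (Dz P) z * P z = P z * Dzb (Dz P) z * P z + P z + (P z + P z * Dzb (Dz P) z * P z)"
    unfolding P_Dz_Dzb_P P_Dzb_Dz_P .
  then have "P z * Dzb (Dz P) z * P z + 0 = P z * Dzb (Dz P) z * P z + (P z + P z + P z * Dzb (Dz P) z * P z)"
    unfolding add_0_right add.assoc .
  then have "P z + P z + P z * Dzb (Dz P) z * P z = 0" by (simp only: add_left_cancel)
  then have 1: "P z * Dzb (Dz P) z * P z = - (P z + P z)" by (rule minus_unique[symmetric])
  have "Dz P z * Dzb P z * P z = (Dz P z * P z + P z * Dz P z) * Dzb P z * P z"
    using Dz_P[of z] by simp
  also have "\<dots> = Dz P z * (P z * Dzb P z * P z) + P z * Dz P z * Dzb P z * P z"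
    by (simp add: algebra_simps)
  also have "\<dots> = P z" by (simp only: P_Dzb_P P_Dz_Dzb_P mult_zero_right add_0)
  finally have 2: "Dz P z * Dzb P z * P z = P z" .
  have "Dzb (\<lambda>z. Dz P z * P z) z * P z = Dzb (Dz P) z * P z + Dz P z * Dzb P z * P z"
    by (simp add: D_mult smooth_P smooth_Dz distrib_right mult.assoc PP)
  also have "\<dots> = - P z" by (simp only: harmonic[of z] 1 2) simp
  finally show ?thesis .
qed

section \<open>The two-sided sequence of covariant derivatives of the projector\<close>

primrec Bp :: "nat \<Rightarrow> complex \<Rightarrow> 'm cop" where
  "Bp 0 = P"
| "Bp (Suc k) = (\<lambda>z. Dz (Bp k) z * P z)"

text \<open>Both covariant derivatives together act on \<open>P\<close> as -1, so with this sign a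
  downward step inverts an upward step.\<close>

primrec Bm :: "nat \<Rightarrow> complex \<Rightarrow> 'm cop" where
  "Bm 0 = P"
| "Bm (Suc k) = (\<lambda>z. - (Dzb (Bm k) z * P z))"

definition B :: "int \<Rightarrow> complex \<Rightarrow> 'm cop" where
  "B a = (if a \<ge> 0 then Bp (nat a) else Bm (nat (- a)))"

lemma smooth_Bp: "smooth (Bp k)"
  by (induction k) (simp_all add: smooth_P smooth_on_mult smooth_Dz)

lemma smooth_Bm: "smooth (Bm k)"
  by (induction k) (simp_all add: smooth_P smooth_on_mult smooth_Dzb smooth_on_uminus)

lemma Bp_P: "Bp k z * P z = Bp k z"
  by (cases k) (simp_all add: PP mult.assoc)

lemma Bm_P: "Bm k z * P z = Bm k z"
  by (cases k) (simp_all add: PP mult.assoc)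

text \<open>Vanishing curvature lets the induction commute the two covariant derivatives; minimality
  enters through the base case.\<close>

lemma Dzb_Bp: "Dzb (Bp (Suc k)) z * P z = - Bp k z"
proof (induction k arbitrary: z)
  case 0
  then show ?case by (simp add: Dzb_Dz_P_P)
next
  case (Suc k)
  then have IH: "(\<lambda>z. Dzb (Bp (Suc k)) z * P z) = (\<lambda>z. - Bp k z)" by (rule ext)
  have "Dzb (Bp (Suc (Suc k))) z * P z = Dzb (\<lambda>z. Dz (Bp (Suc k)) z * P z) z * P z"
    by (simp only: Bp.simps(2)[of "Suc k"])
  also have "\<dots> = Dz (\<lambda>z. Dzb (Bp (Suc k)) z * P z) z * P z"
    by (rule covariant_commute[OF smooth_Bp Bp_P, symmetric])
  also have "\<dots> = - (Dz (Bp k) z * P z)"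
    by (simp only: IH D_uminus[OF smooth_Bp] mult_minus_left)
  finally show ?case by simp
qed

lemma Dz_Bm: "Dz (Bm (Suc k)) z * P z = Bm k z"
proof (induction k arbitrary: z)
  case 0
  have "smooth (\<lambda>z. Dzb P z * P z)" by (intro smooth_on_mult smooth_P smooth_Dzb open_UNIV)
  then have "Dz (Bm (Suc 0)) z * P z = - (Dz (\<lambda>z. Dzb P z * P z) z * P z)"
    by (simp add: D_uminus)
  also have "\<dots> = P z" using covariant_commute[OF smooth_P PP] Dzb_Dz_P_P by simp
  finally show ?case by simp
next
  case (Suc k)
  then have IH: "(\<lambda>z. Dz (Bm (Suc k)) z * P z) = Bm k" by (rule ext)
  have s: "smooth (\<lambda>z. Dzb (Bm (Suc k)) z * P z)" by (intro smooth_on_mult smooth_P smooth_Dzb smooth_Bm open_UNIV)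
  have "Dz (Bm (Suc (Suc k))) z * P z = - (Dz (\<lambda>z. Dzb (Bm (Suc k)) z * P z) z * P z)"
    by (simp only: Bm.simps(2)[of "Suc k"] D_uminus[OF s] mult_minus_left)
  also have "\<dots> = - (Dzb (\<lambda>z. Dz (Bm (Suc k)) z * P z) z * P z)"
    by (simp only: covariant_commute[OF smooth_Bm Bm_P])
  also have "\<dots> = - (Dzb (Bm k) z * P z)" by (simp only: IH)
  finally show ?case by simp
qed

lemma smooth_B: "smooth (B a)"
  by (simp add: B_def smooth_Bp smooth_Bm)

lemma B_P: "B a z * P z = B a z"
  by (simp add: B_def Bp_P Bm_P)

lemma B_P_left: "B a z * (P z * A) = B a z * A"
  by (simp add: mult.assoc[symmetric] B_P)

lemma B_0: "B 0 = P" by (simp add: B_def)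

lemma B_1: "B 1 z = Dz P z * P z" by (simp add: B_def)

lemma B_int: "B (int k) = Bp k"
  by (simp add: B_def)

lemma B_minus: "B (- int k) = Bm k"
  by (cases "k = 0") (simp_all add: B_def)

lemma Dz_B: "Dz (B a) z * P z = B (a + 1) z"
proof (cases "a \<ge> 0")
  case True
  then show ?thesis by (simp add: B_def nat_add_distrib)
next
  case False
  then obtain k where "a = - int (Suc k)" by (metis not_less negD of_nat_Suc)
  moreover have "- int (Suc k) + 1 = - int k" by simp
  ultimately show ?thesis by (simp only: B_minus Dz_Bm)
qed

lemma Dzb_B: "Dzb (B a) z * P z = - B (a - 1) z"
proof (cases "a > 0")
  case True
  then obtain k where "a = int (Suc k)" by (metis Suc_pred' nat_0_le nat_less_eq_zless zero_less_nat_eq less_imp_le int_nat_eq)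
  moreover have "int (Suc k) - 1 = int k" by simp
  ultimately show ?thesis by (simp only: B_int Dzb_Bp)
next
  case False
  then obtain k where "a = - int k" by (metis minus_minus nonpos_int_cases not_less)
  moreover have "- int k - 1 = - int (Suc k)" by simp
  ultimately show ?thesis by (simp only: B_minus) simp
qed

section \<open>Gram operators of the sequence and their shift invariance\<close>

definition E :: "int \<Rightarrow> int \<Rightarrow> complex \<Rightarrow> 'm cop" where
  "E a b z = star (B a z) * B b z"

lemma star_E: "star (E a b z) = E b a z"
  by (simp add: E_def star_simps)

lemma P_E: "P z * E a b z = E a b z"
proof -
  have "P z * star (B a z) = star (B a z)"
    by (metis B_P star_P star_mult)
  then show ?thesis by (simp add: E_def mult.assoc[symmetric])
qed

lemma E_P: "E a b z * P z = E a b z"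
  by (simp add: E_def B_P mult.assoc)

lemma smooth_E: "smooth (E a b)"
  unfolding E_def[abs_def] by (intro smooth_on_mult smooth_star smooth_B open_UNIV)

lemma P_star_Dz_B: "P z * star (Dz (B a) z) = star (B (a + 1) z)"
  and P_star_Dzb_B: "P z * star (Dzb (B a) z) = - star (B (a - 1) z)"
  using arg_cong[OF Dz_B[of a z], of star] arg_cong[OF Dzb_B[of a z], of star]
  by (simp_all add: star_simps star_P)

text \<open>On the factor \<open>star (B a)\<close> the derivative \<open>Dz\<close> acts as
  \<open>Dzb\<close> on \<open>B a\<close>, hence lowers \<open>a\<close> and brings the minus sign.
  Compression by \<open>P z\<close> makes both derivatives covariant.\<close>

lemma Dz_E: "P z * Dz (E a b) z * P z = E a (b + 1) z - E (a - 1) b z"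
proof -
  have "P z * Dz (E a b) z * P z = P z * (star (Dzb (B a) z) * B b z + star (B a z) * Dz (B b) z) * P z"
    unfolding E_def[abs_def] by (simp add: D_mult D_star smooth_B smooth_star)
  also have "\<dots> = (P z * star (Dzb (B a) z)) * (B b z * P z) + (P z * star (B a z)) * (Dz (B b) z * P z)"
    by (simp add: algebra_simps)
  also have "P z * star (B a z) = star (B a z)" by (metis B_P star_P star_mult)
  finally show ?thesis by (simp add: P_star_Dzb_B Dz_B B_P E_def[abs_def])
qed

lemma Dzb_E: "P z * Dzb (E a b) z * P z = E (a + 1) b z - E a (b - 1) z"
proof -
  have "P z * Dzb (E a b) z * P z = P z * (star (Dz (B a) z) * B b z + star (B a z) * Dzb (B b) z) * P z"
    unfolding E_def[abs_def] by (simp add: D_mult D_star smooth_B smooth_star)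
  also have "\<dots> = (P z * star (Dz (B a) z)) * (B b z * P z) + (P z * star (B a z)) * (Dzb (B b) z * P z)"
    by (simp add: algebra_simps)
  also have "P z * star (B a z) = star (B a z)" by (metis B_P star_P star_mult)
  finally show ?thesis by (simp add: P_star_Dz_B Dzb_B B_P E_def[abs_def])
qed

text \<open>\<open>P\<close> and 0 have vanishing compressed derivatives, so the two terms of the
  recursion agree. If a whole diagonal \<open>b - a = d\<close> is \<open>P\<close> or 0, the
  diagonals \<open>d + 1\<close> and \<open>d - 1\<close> are invariant under shifting both
  indices.\<close>

lemma
  assumes "E a b = P \<or> E a b = (\<lambda>z. 0)"
  shows E_shift_up: "E a (b + 1) z = E (a - 1) b z"
    and E_shift_down: "E (a + 1) b z = E a (b - 1) z"
  using assms Dz_E[of z a b] Dzb_E[of z a b] by (auto simp: P_Dz_P P_Dzb_P D_const)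

text \<open>The two claims feed each other: a vanishing \<open>E i (i + 1)\<close> links
  \<open>E i i\<close> with \<open>E (i + 1) (i + 1)\<close>, and \<open>E i i = P\<close> links the
  vanishing entries on its two sides. The start is \<open>P_Dz_P\<close>.\<close>

lemma E_diagonal: "E a a = P \<and> E a (a + 1) = (\<lambda>z. 0)"
proof (induction a rule: int_induct[where k = 0])
  case base
  show ?case by (auto simp: E_def B_0 B_1 star_P PP P_Dz_P mult.assoc[symmetric])
next
  case (step1 i)
  have 1: "E (i + 1) (i + 1) = P"
  proof
    fix z
    show "E (i + 1) (i + 1) z = P z" using step1 E_shift_down[of i "i + 1" z] by simp
  qed
  have "E (i + 1) (i + 1 + 1) = (\<lambda>z. 0)"
  proof
    fix z
    show "E (i + 1) (i + 1 + 1) z = 0" using 1 step1 E_shift_up[of "i + 1" "i + 1" z] by simp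
  qed
  with 1 show ?case by simp
next
  case (step2 i)
  have 0: "E (i - 1) i = (\<lambda>z. 0)"
  proof
    fix z
    show "E (i - 1) i z = 0" using step2 E_shift_up[of i i z] by simp
  qed
  have "E (i - 1) (i - 1) = P"
  proof
    fix z
    show "E (i - 1) (i - 1) z = P z" using step2 0 E_shift_down[of "i - 1" i z] by simp
  qed
  with 0 show ?case by simp
qed

end

section \<open>Orthonormality and completeness of the sequence under isotropy\<close>

lemma tr_star_mult_self: "tr (star A * A) = of_real (\<Sum>i\<in>UNIV. \<Sum>j\<in>UNIV. (cmod (mtx A $ j $ i))\<^sup>2)"
  by (simp add: tr.rep_eq times_cop.rep_eq star.rep_eq trace_def matrix_matrix_mult_def mult.commute
      flip: complex_norm_square)

lemma tr_star_mult_self_eq_0: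
  assumes "tr (star A * A) = 0"
  shows "A = 0"
proof -
  have "(\<Sum>i\<in>UNIV. \<Sum>j\<in>UNIV. (cmod (mtx A $ j $ i))\<^sup>2) = 0"
    using assms unfolding tr_star_mult_self of_real_eq_0_iff .
  then have "mtx A $ j $ i = 0" for i j
    by (simp add: sum_nonneg_eq_0_iff sum_nonneg)
  then have "mtx A = 0" by (simp add: vec_eq_iff)
  then show ?thesis by (metis mtx_inject zero_cop.rep_eq)
qed

lemma cop_left_inverse_imp_right: "A * B = 1 \<Longrightarrow> B * A = (1 :: 'm::finite cop)"
  by transfer (simp add: matrix_left_right_inverse)

text \<open>\<open>isotropic\<close> is the vanishing of \<open>E (- int m) 1\<close>: one entry at
  each index distance from 1 to \<open>n\<close>, in the form in which the harmonic sequence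
  delivers it. By \<open>tr_P\<close> and \<open>dim\<close>, exactly \<open>n + 1\<close>
  orthogonal copies of the range of \<open>P z\<close> fill the space.\<close>

locale isotropic_projector = flat_harmonic_projector P for P :: "complex \<Rightarrow> 'm::finite cop" +
  fixes n :: nat
  assumes n: "n \<ge> 1"
    and isotropic: "m < n \<Longrightarrow> star (Bm m z) * (Dz P z * P z) = 0"
    and tr_P: "tr (P z) = 2"
    and dim: "CARD('m) = 2 * (n + 1)"
begin

text \<open>Induction on the diagonal: since diagonal \<open>d\<close> is constant, diagonal
  \<open>d + 1\<close> is shift invariant, and its entry in row \<open>- int d\<close> vanishes by
  \<open>isotropic\<close> with \<open>m = d\<close>.\<close>

lemma E_upper: "d \<le> n \<Longrightarrow> E a (a + int d) = (if d = 0 then P else (\<lambda>z. 0))"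
proof (induction d arbitrary: a)
  case 0
  then show ?case using E_diagonal by simp
next
  case (Suc d)
  then have IH: "E b (b + int d) = P \<or> E b (b + int d) = (\<lambda>z. 0)" for b by simp
  have shift: "E b (b + int (Suc d)) = E (b - 1) (b - 1 + int (Suc d))" for b
    using E_shift_up[OF IH[of b]] by (auto simp: add_ac fun_eq_iff)
  have "E (- int d) (- int d + int (Suc d)) z = star (Bm d z) * (Dz P z * P z)" for z
    by (simp add: E_def B_minus B_1)
  then have base: "E (- int d) (- int d + int (Suc d)) = (\<lambda>z. 0)" using isotropic[of d] Suc.prems by auto
  have "E a (a + int (Suc d)) = (\<lambda>z. 0)"
  proof (induction a rule: int_induct[where k = "- int d"])
    case base
    then show ?case using \<open>E (- int d) (- int d + int (Suc d)) = (\<lambda>z. 0)\<close> .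
  next
    case (step1 i)
    then show ?case using shift[of "i + 1"] by simp
  next
    case (step2 i)
    then show ?case using shift[of i] by simp
  qed
  then show ?case by simp
qed

lemma E_orthonormal:
  assumes "\<bar>a - b\<bar> \<le> int n"
  shows "E a b z = (if a = b then P z else 0)"
proof (cases "a \<le> b")
  case True
  then show ?thesis using E_upper[of "nat (b - a)" a] assms by auto
next
  case False
  then have "E b a z = 0" using E_upper[of "nat (a - b)" b] assms by auto
  then show ?thesis using False star_E[of b a z] by (simp add: star_zero)
qed

text \<open>By orthonormality the sum is a Hermitian idempotent whose trace is the full dimension.
  So its complement has Frobenius norm 0.\<close>

lemma completeness: "(\<Sum>k\<le>n. B (int k) z * star (B (int k) z)) = 1"
proof -
  define R where "R = (\<Sum>k\<le>n. B (int k) z * star (B (int k) z))"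
  have star_R: "star R = R" by (simp add: R_def star_sum star_simps)
  have "R * R = (\<Sum>k\<le>n. \<Sum>l\<le>n. B (int k) z * E (int k) (int l) z * star (B (int l) z))"
    by (simp add: R_def sum_product E_def mult.assoc)
  also have "\<dots> = (\<Sum>k\<le>n. \<Sum>l\<le>n. if l = k then B (int k) z * star (B (int k) z) else 0)"
    by (intro sum.cong refl) (auto simp: E_orthonormal B_P)
  also have "\<dots> = R" by (simp add: R_def)
  finally have RR: "R * R = R" .
  have "tr (B (int k) z * star (B (int k) z)) = 2" for k
    using E_orthonormal[of "int k" "int k" z] tr_mult_commute[of "B (int k) z" "star (B (int k) z)"] tr_P
    by (simp add: E_def)
  then have tr_R: "tr R = of_nat (2 * (n + 1))" by (simp add: R_def tr_sum algebra_simps)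
  have "star (1 - R) * (1 - R) = 1 - R"
    by (simp add: star_simps star_R algebra_simps RR)
  then have "tr (star (1 - R) * (1 - R)) = 0" using tr_R dim by (simp add: tr_simps)
  then show ?thesis using tr_star_mult_self_eq_0[of "1 - R"] R_def by simp
qed

lemma cop_eq_on_B:
  assumes "\<And>k. k \<le> n \<Longrightarrow> A * B (int k) z = C * B (int k) z"
  shows "A = C"
proof -
  have "A = A * (\<Sum>k\<le>n. B (int k) z * star (B (int k) z))" by (simp add: completeness)
  also have "\<dots> = C * (\<Sum>k\<le>n. B (int k) z * star (B (int k) z))"
    by (simp add: sum_distrib_left mult.assoc[symmetric] assms)
  finally show ?thesis by (simp add: completeness)
qed

section \<open>Periodicity of the sequence up to a monodromy\<close>

abbreviation N :: int where "N \<equiv> int n + 1"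

text \<open>The monodromy: \<open>B N\<close> takes values in the original bundle again, and
  \<open>h z\<close> is its coefficient along \<open>B 0\<close>.\<close>

definition h :: "complex \<Rightarrow> 'm cop" where "h z = E 0 N z"

lemma smooth_h: "smooth h"
  using smooth_E[of 0 N] by (simp add: h_def[abs_def])

lemma P_h: "P z * h z = h z" and h_P: "h z * P z = h z"
  by (simp_all add: h_def P_E E_P)

text \<open>The indices 1 to \<open>n\<close> are at distance at most \<open>n\<close> from
  \<open>N\<close>, so \<open>B N\<close> is orthogonal to these members and completeness leaves
  only the component along \<open>B 0\<close>.\<close>

lemma B_N: "B N z = P z * h z"
proof -
  have "B N z = (\<Sum>k\<le>n. B (int k) z * star (B (int k) z)) * B N z" by (simp add: completeness)
  also have "\<dots> = (\<Sum>k\<le>n. B (int k) z * E (int k) N z)"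
    by (simp add: sum_distrib_right E_def mult.assoc)
  also have "\<dots> = (\<Sum>k\<le>n. if k = 0 then P z * h z else 0)"
    by (intro sum.cong refl) (auto simp: E_orthonormal h_def B_0)
  finally show ?thesis by simp
qed

lemma star_h_h: "star (h z) * h z = P z"
  using E_orthonormal[of N N z] by (simp add: E_def B_N P_h)

lemma h_star_h: "h z * star (h z) = P z"
proof -
  have sh: "star (h z) * P z = star (h z)" "P z * star (h z) = star (h z)"
    by (metis P_h star_P star_mult, metis h_P star_P star_mult)
  \<comment> \<open>Extended by the identity on the complement, \<open>h z\<close> becomes a square
    isometry, for which a left inverse is a right inverse.\<close>
  have "star (h z + (1 - P z)) * (h z + (1 - P z)) = 1"
    by (simp add: star_simps star_P algebra_simps star_h_h PP P_h sh)
  then have "(h z + (1 - P z)) * star (h z + (1 - P z)) = 1" by (rule cop_left_inverse_imp_right)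
  then show ?thesis
    by (simp add: star_simps star_P algebra_simps PP h_P P_h sh)
qed

lemma
  assumes "B b = (\<lambda>z. B a z * h z)"
  shows B_step_up: "B (b + 1) z = B (a + 1) z * h z + B a z * (P z * Dz h z * P z)"
    and B_step_down: "- B (b - 1) z = - B (a - 1) z * h z + B a z * (P z * Dzb h z * P z)"
proof -
  have "B (b + 1) z = Dz (\<lambda>z. B a z * h z) z * P z" using Dz_B[of b z] assms by simp
  also have "\<dots> = Dz (B a) z * P z * h z + B a z * (P z * Dz h z * P z)"
    by (simp add: D_mult smooth_B smooth_h algebra_simps h_P P_h B_P_left)
  finally show "B (b + 1) z = B (a + 1) z * h z + B a z * (P z * Dz h z * P z)" by (simp only: Dz_B)
  have "- B (b - 1) z = Dzb (\<lambda>z. B a z * h z) z * P z" using Dzb_B[of b z] assms by simp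
  also have "\<dots> = Dzb (B a) z * P z * h z + B a z * (P z * Dzb h z * P z)"
    by (simp add: D_mult smooth_B smooth_h algebra_simps h_P P_h B_P_left)
  finally show "- B (b - 1) z = - B (a - 1) z * h z + B a z * (P z * Dzb h z * P z)" by (simp only: Dzb_B)
qed

text \<open>Since all \<open>B a\<close> are isometric on the range of \<open>P\<close>, the component \<open>P h\<^sub>z P\<close> of \<open>B (N + 1)\<close>
  orthogonal to \<open>B 1 h\<close> has to vanish.\<close>

lemma Dz_h: "P z * Dz h z * P z = 0"
proof -
  define k where "k = P z * Dz h z * P z"
  have Pk: "P z * k = k" by (simp add: k_def mult.assoc[symmetric] PP)
  have "B N = (\<lambda>z. B 0 z * h z)" using B_N by (simp add: B_0 fun_eq_iff)
  from B_step_up[OF this, of z] have B: "B (N + 1) z = B 1 z * h z + k"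
    by (simp add: B_0 k_def mult.assoc[symmetric] PP)
  have "star (B 1 z) * k = E 1 0 z * k" by (simp add: E_def B_0 mult.assoc Pk)
  then have E10: "star (B 1 z) * k = 0" using n by (simp add: E_orthonormal)
  have E01: "star k * B 1 z = 0" using arg_cong[OF E10, of star] by (simp add: star_simps)
  have E11: "star (B 1 z) * (B 1 z * h z) = h z"
    using E_orthonormal[of 1 1 z] by (simp add: E_def mult.assoc[symmetric] P_h)
  have "P z = star (B (N + 1) z) * B (N + 1) z"
    using E_orthonormal[of "N + 1" "N + 1" z] by (simp add: E_def)
  also have "\<dots> = star (B 1 z * h z + k) * (B 1 z * h z + k)" by (simp only: B)
  also have "\<dots> = star (h z) * (star (B 1 z) * (B 1 z * h z)) + star (h z) * (star (B 1 z) * k)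
      + star k * B 1 z * h z + star k * k"
    by (simp add: star_simps algebra_simps)
  also have "\<dots> = P z + star k * k" by (simp only: E10 E01 E11 star_h_h mult_zero_left mult_zero_right add_0_right)
  finally have "star k * k = 0" by (rule add_cancel_right_right[THEN iffD1])
  then show ?thesis using star_mult_self_eq_0 k_def by metis
qed

text \<open>Here the Gram recursion suffices, since \<open>E 1 N\<close> and
  \<open>E 0 (int n)\<close> both have index distance \<open>n\<close>. For \<open>Dz\<close> it
  would lead to distance \<open>n + 2\<close>, beyond orthonormality; hence the separate argument
  for \<open>Dz_h\<close>.\<close>

lemma Dzb_h: "P z * Dzb h z * P z = 0"
proof -
  have "P z * Dzb h z * P z = E 1 N z - E 0 (int n) z"
    using Dzb_E[of z 0 N] by (simp add: h_def[abs_def])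
  also have "\<dots> = 0" using n by (simp add: E_orthonormal)
  finally show ?thesis .
qed

text \<open>The compressed derivatives of \<open>h\<close> vanish, so the covariant derivatives
  carry the relation from index 0 to both neighbours and onwards.\<close>

lemma B_plus_N: "B (a + N) z = B a z * h z"
proof -
  have "B (a + N) = (\<lambda>z. B a z * h z)"
  proof (induction a rule: int_induct[where k = 0])
    case base
    then show ?case using B_N by (auto simp: B_0)
  next
    case (step1 i)
    show ?case using B_step_up[OF step1(2)] by (auto simp: Dz_h add_ac)
  next
    case (step2 i)
    show ?case
    proof
      fix z
      show "B (i - 1 + N) z = B (i - 1) z * h z" using B_step_down[OF step2(2), of z] by (simp add: Dzb_h)
    qed
  qed
  then show ?thesis by simp
qed

lemma B_minus_N: "B (a - N) z = B a z * star (h z)"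
  using B_plus_N[of "a - N" z] by (simp add: mult.assoc h_star_h B_P)

section \<open>The constant unitary shift\<close>

definition T :: "complex \<Rightarrow> 'm cop" where
  "T z = (\<Sum>k\<le>n. B (int k + 1) z * star (B (int k) z))"

lemma smooth_T: "smooth T"
  unfolding T_def[abs_def] by (intro smooth_on_sum smooth_on_mult smooth_star smooth_B open_UNIV)

text \<open>For the indices 0 to \<open>n\<close> this is orthonormality. Right multiplication by
  \<open>h z\<close> or its adjoint is compatible with \<open>T z\<close> acting on the left and
  extends it to all integers congruent to these modulo \<open>N\<close>.\<close>

lemma T_B: "T z * B a z = B (a + 1) z"
proof -
  have base: "T z * B (int l) z = B (int l + 1) z" if "l \<le> n" for l
  proof -
    have "T z * B (int l) z = (\<Sum>k\<le>n. B (int k + 1) z * E (int k) (int l) z)"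
      by (simp add: T_def sum_distrib_right E_def mult.assoc)
    also have "\<dots> = (\<Sum>k\<le>n. if k = l then B (int l + 1) z else 0)"
      using that by (intro sum.cong refl) (auto simp: E_orthonormal B_P)
    finally show ?thesis using that by simp
  qed
  have up: "T z * B (b + N) z = B (b + N + 1) z" if "T z * B b z = B (b + 1) z" for b
    using that B_plus_N[of b z] B_plus_N[of "b + 1" z] by (simp add: mult.assoc[symmetric] add_ac)
  have down: "T z * B (b - N) z = B (b - N + 1) z" if "T z * B b z = B (b + 1) z" for b
  proof -
    have "B (b - N + 1) z = B (b + 1) z * star (h z)"
      using B_minus_N[of "b + 1" z] by (simp add: algebra_simps)
    then show ?thesis using that B_minus_N[of b z] by (simp add: mult.assoc[symmetric])
  qed
  have all: "T z * B (int l + N * q) z = B (int l + N * q + 1) z" if "l \<le> n" for l q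
  proof (induction q rule: int_induct[where k = 0])
    case base
    then show ?case using \<open>l \<le> n\<close> \<open>l \<le> n \<Longrightarrow> T z * B (int l) z = B (int l + 1) z\<close> by simp
  next
    case (step1 i)
    then show ?case using up[of "int l + N * i"] by (simp add: algebra_simps)
  next
    case (step2 i)
    then show ?case using down[of "int l + N * i"] by (simp add: algebra_simps)
  qed
  have "N > 0" by simp
  then have m: "0 \<le> a mod N" "a mod N < N" by (rule pos_mod_sign, rule pos_mod_bound)
  from m(2) have "a mod N \<le> int n" by (rule zle_add1_eq_le[THEN iffD1])
  with m(1) have "nat (a mod N) \<le> n" "int (nat (a mod N)) = a mod N" by (simp_all add: nat_le_iff)
  moreover have "a mod N + N * (a div N) = a" by (rule mod_mult_div_eq)
  ultimately show ?thesis using all[of "nat (a mod N)" "a div N"] by (simp only:)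
qed

lemma star_T_T: "star (T z) * T z = 1"
proof -
  have "star (T z) * T z = (\<Sum>k\<le>n. \<Sum>l\<le>n. B (int k) z * E (int k + 1) (int l + 1) z * star (B (int l) z))"
    by (simp add: T_def star_sum star_simps sum_product E_def mult.assoc)
  also have "\<dots> = (\<Sum>k\<le>n. \<Sum>l\<le>n. if l = k then B (int k) z * star (B (int k) z) else 0)"
    by (intro sum.cong refl) (auto simp: E_orthonormal B_P)
  finally show ?thesis by (simp add: completeness)
qed

lemma star_T_B: "star (T z) * B a z = B (a - 1) z"
  using T_B[of z "a - 1"] star_T_T[of z] by (metis diff_add_cancel mult.assoc mult_1)

text \<open>Covariant differentiation shifts both sides of \<open>T z * B a z = B (a + 1) z\<close>
  alike, so the product rule leaves 0 for the derivative of \<open>T\<close> times each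
  \<open>B (int k) z\<close>, and the ranges of these span the space.\<close>

lemma Dz_T: "Dz T z = 0" and Dzb_T: "Dzb T z = 0"
proof -
  have TB: "(\<lambda>z. T z * B a z) = B (a + 1)" for a by (simp add: T_B)
  show "Dz T z = 0"
  proof (rule cop_eq_on_B)
    fix k
    have "Dz T z * B (int k) z = Dz T z * B (int k) z * P z" by (simp add: mult.assoc B_P)
    also have "\<dots> = Dz (\<lambda>z. T z * B (int k) z) z * P z - T z * (Dz (B (int k)) z * P z)"
      by (simp add: D_mult smooth_T smooth_B algebra_simps)
    also have "\<dots> = 0" by (simp only: TB Dz_B T_B) simp
    finally show "Dz T z * B (int k) z = 0 * B (int k) z" by simp
  qed
  show "Dzb T z = 0"
  proof (rule cop_eq_on_B)
    fix k
    have "Dzb T z * B (int k) z = Dzb T z * B (int k) z * P z" by (simp add: mult.assoc B_P)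
    also have "\<dots> = Dzb (\<lambda>z. T z * B (int k) z) z * P z - T z * (Dzb (B (int k)) z * P z)"
      by (simp add: D_mult smooth_T smooth_B algebra_simps)
    also have "\<dots> = 0" by (simp only: TB Dzb_B) (simp add: T_B)
    finally show "Dzb T z * B (int k) z = 0 * B (int k) z" by simp
  qed
qed

lemma T_constant: "T z = T w"
  by (rule D_zero_imp_constant[OF smooth_T Dz_T Dzb_T])

lemma T_power_P: "T w ^ k * P z = B (int k) z"
proof (induction k)
  case (Suc k)
  then show ?case using T_B[of z "int k"] T_constant[of w z] by (simp add: mult.assoc add.commute)
qed (simp add: B_0)

text \<open>The differential equation of conjugation by \<open>exp (z T - cnj z star T)\<close>. One
  block of \<open>Dz P z\<close> is \<open>B 1 z = T w * P z\<close>, the other is the adjoint of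
  \<open>Dzb P z * P z\<close>.\<close>

lemma Dz_P_eq: "Dz P z = T w * P z - P z * T w"
  and Dzb_P_eq: "Dzb P z = P z * star (T w) - star (T w) * P z"
proof -
  have 1: "Dz P z * P z = T w * P z"
    using T_B[of z 0] T_constant[of w z] by (simp add: B_0 B_1)
  have 2: "Dzb P z * P z = - star (T w) * P z"
    using Dzb_B[of 0 z] star_T_B[of z 0] T_constant[of w z] by (simp add: B_0)
  have s: "star (Dzb P z) = Dz P z" "star (Dz P z) = Dzb P z"
    using D_star[OF smooth_P, of z] unfolding star_P by - (rule sym, assumption)+
  have 3: "P z * Dz P z = - P z * T w" "P z * Dzb P z = P z * star (T w)"
    using arg_cong[OF 2, of star] arg_cong[OF 1, of star] by (simp_all add: star_simps s star_P)
  have "Dz P z = Dz P z * P z + P z * Dz P z" by (rule Dz_P)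
  also have "\<dots> = T w * P z - P z * T w" by (simp add: 1 3)
  finally show "Dz P z = T w * P z - P z * T w" .
  have "Dzb P z = Dzb P z * P z + P z * Dzb P z" by (rule Dzb_P)
  also have "\<dots> = P z * star (T w) - star (T w) * P z" by (simp add: 2 3)
  finally show "Dzb P z = P z * star (T w) - star (T w) * P z" .
qed

lemma T_orthogonal:
  assumes "i \<le> n" "j \<le> n" "i \<noteq> j"
  shows "star (T w ^ i * P z) * (T w ^ j * P z) = 0"
  using E_orthonormal[of "int i" "int j" z] assms by (simp add: T_power_P E_def)

lemma T_N_P: "T w ^ (n + 1) * P z = P z * (T w ^ (n + 1) * P z)"
  using B_N[of z] T_power_P[of w "n + 1" z] by (simp add: add.commute PP_left)

text \<open>A constant matrix commuting with \<open>P\<close> and vanishing on its range vanishes, because it commutes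
  with all \<open>B k\<close>.\<close>

lemma commuting_zero:
  assumes "\<And>z. D * P z = P z * D" "\<And>z. D * P z = 0"
  shows "D = 0"
proof -
  have "D * Bp k z = Bp k z * D" for k z
  proof (induction k arbitrary: z)
    case 0
    then show ?case by (simp add: assms(1))
  next
    case (Suc k)
    have "D * Dz (Bp k) z = Dz (\<lambda>z. D * Bp k z) z" by (simp add: Dz_const_mult smooth_Bp)
    also have "\<dots> = Dz (Bp k) z * D" by (simp only: Suc) (simp add: D_mult smooth_Bp smooth_on_const D_const)
    finally have "D * Dz (Bp k) z * P z = Dz (Bp k) z * (P z * D)" by (simp add: mult.assoc assms(1))
    then show ?case by (simp add: mult.assoc)
  qed
  then have "D * Bp k z = 0" for k z
    using assms by (metis Bp_P mult.assoc mult_zero_right)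
  then show ?thesis using cop_eq_on_B[of D 0 0] by (simp add: B_def)
qed

end

section \<open>The projector onto a quaternionic line\<close>

definition qproj :: "complex ^ ('n::finite \<times> bool) \<Rightarrow> ('n \<times> bool) cop" where
  "qproj q = outer q q + outer (jmul q) (jmul q)"

lemma act_qproj: "act (qproj q) v = herm v q *s q + herm v (jmul q) *s jmul q"
  by (simp add: qproj_def act_simps act_outer)

lemma hor_eq: "hor q v = v - act (qproj q) v"
  by (simp add: hor_def act_qproj algebra_simps)

lemma star_qproj: "star (qproj q) = qproj q"
  by (simp add: qproj_def star_simps)

lemma herm_unit:
  assumes "norm q = 1"
  shows "herm q q = 1" "herm (jmul q) (jmul q) = 1"
  unfolding herm_jmul_jmul using assms by (simp_all add: herm_self)

lemma qproj_fixes: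
  assumes "norm q = 1"
  shows "act (qproj q) q = q" "act (qproj q) (jmul q) = jmul q"
  by (simp_all add: act_qproj herm_unit[OF assms] herm_jmul_self)

lemma qproj_idem:
  assumes "norm q = 1"
  shows "qproj q * qproj q = qproj q"
  by (rule cop_eqI)
    (simp add: act_mult act_qproj[of q] act_vadd act_vscale qproj_fixes[OF assms, unfolded act_qproj] act_qproj)

lemma tr_qproj: "norm q = 1 \<Longrightarrow> tr (qproj q) = 2"
  by (simp add: qproj_def tr_simps herm_unit)

lemma jc_qproj: "jc (qproj q) = qproj q"
proof (rule cop_eqI)
  fix v
  have "herm (jmul v) q = - cnj (herm v (jmul q))" by (simp add: herm_cnj herm_jmul_left[of v q])
  then show "act (jc (qproj q)) v = act (qproj q) v"
    by (simp add: act_jc act_qproj jmul_simps herm_jmul_jmul herm_cnj add.commute)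
qed

lemma qline_eq_fixed:
  assumes "norm q = 1"
  shows "qline q = {v. act (qproj q) v = v}"
proof (intro equalityI subsetI)
  fix v assume "v \<in> qline q"
  then show "v \<in> {v. act (qproj q) v = v}"
    by (auto simp: qline_def act_vec_simps qproj_fixes[OF assms])
next
  fix v assume "v \<in> {v. act (qproj q) v = v}"
  then have "v = herm v q *s q + herm v (jmul q) *s jmul q" by (simp add: act_qproj)
  then show "v \<in> qline q" unfolding qline_def by blast
qed

text \<open>Each projector fixes the range of the other, which determines both products; one product
  is the adjoint of the other.\<close>

lemma qproj_cong:
  assumes "norm q = 1" "norm q' = 1" "qline q = qline q'"
  shows "qproj q = qproj q'"
proof -
  have fixed: "act (qproj r) v = v" if "norm r = 1" "v \<in> qline r" for r v :: "complex ^ ('a \<times> bool)"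
    using that by (simp add: qline_eq_fixed)
  have mem: "act (qproj r) v \<in> qline r" if "norm r = 1" for r v :: "complex ^ ('a \<times> bool)"
    using that by (simp add: qline_eq_fixed act_mult[symmetric] qproj_idem)
  have 1: "qproj q * qproj q' = qproj q'"
    by (rule cop_eqI) (use assms mem[OF assms(2)] in \<open>simp add: act_mult fixed\<close>)
  have 2: "qproj q' * qproj q = qproj q"
    by (rule cop_eqI) (use assms mem[OF assms(1)] in \<open>simp add: act_mult fixed flip: assms(3)\<close>)
  show ?thesis using arg_cong[OF 1, of star] 2 by (simp add: star_simps star_qproj)
qed

text \<open>By \<open>qproj_cong\<close> the chosen unit vector does not matter, so smoothness can
  be read off from any local lift.\<close>

definition proj_field :: "(complex \<Rightarrow> (complex ^ ('n::finite \<times> bool)) set) \<Rightarrow> complex \<Rightarrow> ('n \<times> bool) cop" where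
  "proj_field \<phi> z = qproj (SOME q. norm q = 1 \<and> \<phi> z = qline q)"

lemma proj_field_eq:
  assumes "norm q = 1" "\<phi> z = qline q"
  shows "proj_field \<phi> z = qproj q"
proof -
  have "norm (SOME q. norm q = 1 \<and> \<phi> z = qline q) = 1 \<and> \<phi> z = qline (SOME q. norm q = 1 \<and> \<phi> z = qline q)"
    by (rule someI[of "\<lambda>q. norm q = 1 \<and> \<phi> z = qline q"]) (use assms in auto)
  then show ?thesis unfolding proj_field_def by (intro qproj_cong) (use assms in auto)
qed

section \<open>From the geometry of the surface to the projector\<close>

locale flat_totally_real_minimal =
  fixes \<phi> :: "complex \<Rightarrow> (complex ^ ('n::finite \<times> bool)) set"
  assumes smooth_HP: "smooth_HP \<phi>"
    and flat: "induced_metric_flat \<phi>"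
    and minimal: "minimal_surface \<phi>"
    and real: "totally_real \<phi>"
begin

abbreviation P :: "complex \<Rightarrow> ('n \<times> bool) cop" where "P \<equiv> proj_field \<phi>"

lemma lift:
  obtains f U where "local_lift \<phi> f U" "z \<in> U"
  using smooth_HP unfolding smooth_HP_def by metis

lemma P_lift: "local_lift \<phi> f U \<Longrightarrow> z \<in> U \<Longrightarrow> P z = qproj (f z)"
  unfolding local_lift_def by (intro proj_field_eq) auto

lemma smooth_P: "smooth P"
proof (rule smooth_on_local)
  fix z
  obtain f U where fU: "local_lift \<phi> f U" "z \<in> U" by (rule lift)
  then have U: "open U" and f: "smooth_on U f" by (auto simp: local_lift_def)
  have "smooth_on U (\<lambda>z. qproj (f z))"
    unfolding qproj_def
    by (intro smooth_on_add smooth_on_bounded_bilinear[OF bounded_bilinear_outer]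
        smooth_on_bounded_linear[OF bounded_linear_jmul] U f)
  then have "smooth_on U P"
    by (rule smooth_on_cong[OF U, rotated]) (simp add: P_lift[OF fU(1)])
  then show "\<exists>U. open U \<and> z \<in> U \<and> smooth_on U P" using U fU by blast
qed

lemma obtain_unit:
  obtains q where "norm q = 1" "\<phi> z = qline q" "P z = qproj q"
proof -
  obtain f U where fU: "local_lift \<phi> f U" "z \<in> U" by (rule lift)
  then show ?thesis using that[of "f z"] P_lift[OF fU] by (auto simp: local_lift_def)
qed

lemma PP: "P z * P z = P z" and star_P: "star (P z) = P z" and tr_P: "tr (P z) = 2"
  and jc_P: "jc (P z) = P z" and range_P: "\<phi> z = {v. act (P z) v = v}"
  by (rule obtain_unit[of z]; simp add: qproj_idem star_qproj tr_qproj jc_qproj qline_eq_fixed)+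

lemma star_dir_P: "star (dir X P z) = dir X P z"
proof -
  have "star (dir X P z) = dir X (\<lambda>z. star (P z)) z"
    by (intro dir_bounded_linear[symmetric] bounded_linear_star smooth_differentiable smooth_P)
  then show ?thesis by (simp only: star_P)
qed

lemma smooth_dir_P: "smooth (dir X P)"
  by (intro smooth_on_dir smooth_P)

lemma star_dir_dir_P: "star (dir Y (dir X P) z) = dir Y (dir X P) z"
proof -
  have "star (dir Y (dir X P) z) = dir Y (\<lambda>z. star (dir X P z)) z"
    by (intro dir_bounded_linear[symmetric] bounded_linear_star smooth_differentiable smooth_dir_P)
  then show ?thesis by (simp only: star_dir_P)
qed

lemma jc_dir_P: "jc (dir X P z) = dir X P z"
proof -
  have "jc (dir X P z) = dir X (\<lambda>z. jc (P z)) z"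
    by (intro dir_bounded_linear[symmetric] bounded_linear_jc smooth_differentiable smooth_P)
  then show ?thesis by (simp only: jc_P)
qed

lemma jc_dir_dir_P: "jc (dir Y (dir X P) z) = dir Y (dir X P) z"
proof -
  have "jc (dir Y (dir X P) z) = dir Y (\<lambda>z. jc (dir X P z)) z"
    by (intro dir_bounded_linear[symmetric] bounded_linear_jc smooth_differentiable smooth_dir_P)
  then show ?thesis by (simp only: jc_dir_P)
qed

lemma PP_left: "P z * (P z * A) = P z * A"
  by (simp add: mult.assoc[symmetric] PP)

lemma dir_P: "dir X P z = dir X P z * P z + P z * dir X P z"
proof -
  have "dir X P z = dir X (\<lambda>z. P z * P z) z" by (simp add: PP)
  also have "\<dots> = P z * dir X P z + dir X P z * P z"
    by (intro dir_mult smooth_differentiable smooth_P)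
  also have "\<dots> = dir X P z * P z + P z * dir X P z" by (rule add.commute)
  finally show ?thesis .
qed

lemma P_dir_P: "P z * dir X P z * P z = 0"
proof -
  have "P z * dir X P z * P z = P z * (dir X P z * P z + P z * dir X P z) * P z"
    using arg_cong[OF dir_P[of X z], of "\<lambda>A. P z * A * P z"] .
  also have "\<dots> = P z * dir X P z * P z + P z * dir X P z * P z"
    by (simp add: algebra_simps PP PP_left)
  finally show ?thesis by simp
qed

lemma act_jmul: "jc A = A \<Longrightarrow> act A (jmul v) = jmul (act A v)"
  using act_jc[of A "jmul v"] by (simp add: jmul_simps act_vec_simps)

section \<open>Computations along a local lift\<close>

context
  fixes f U z
  assumes fU: "local_lift \<phi> f U" and z: "z \<in> U"
begin

lemma U: "open U" and f: "smooth_on U f" and norm_f: "w \<in> U \<Longrightarrow> norm (f w) = 1"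
  using fU by (auto simp: local_lift_def)

lemma act_P_f: "w \<in> U \<Longrightarrow> act (P w) (f w) = f w"
  by (simp add: P_lift[OF fU] qproj_fixes norm_f)

lemma dmap_eq: "w \<in> U \<Longrightarrow> dmap f X w = dir X f w - act (P w) (dir X f w)"
  by (simp add: dmap_def hor_eq P_lift[OF fU])

text \<open>Differentiating \<open>act (P w) (f w) = f w\<close> leaves the horizontal part of
  \<open>dir X f w\<close>; so \<open>P\<close> determines the differential of the map.\<close>

lemma act_dir_P_f:
  assumes w: "w \<in> U"
  shows "act (dir X P w) (f w) = dmap f X w"
proof -
  have d: "f differentiable at w" by (rule smooth_on_differentiable[OF f w])
  have "dir X f w = dir X (\<lambda>w. act (P w) (f w)) w"
    by (rule dir_cong[OF U w _ d]) (simp add: act_P_f)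
  also have "\<dots> = act (P w) (dir X f w) + act (dir X P w) (f w)"
    by (rule dir_bounded_bilinear[OF bounded_bilinear_act smooth_differentiable[OF smooth_P] d])
  finally show ?thesis by (simp add: dmap_eq[OF w] algebra_simps)
qed

lemma act_dir_P_jf: "w \<in> U \<Longrightarrow> act (dir X P w) (jmul (f w)) = jmul (dmap f X w)"
  by (simp add: act_jmul jc_dir_P act_dir_P_f)

text \<open>The metric gives the real part, the vanishing two-form of \<open>I\<close> the imaginary
  part; those of \<open>J\<close> and \<open>K\<close> give the next lemma.\<close>

lemma herm_dmap: "herm (dmap f X z) (dmap f Y z) = of_real (2 * (X \<bullet> Y))"
proof (rule complex_eqI)
  have "dmap f X z \<bullet> dmap f Y z = 2 * (X \<bullet> Y)"
    using flat fU z unfolding induced_metric_flat_def induced_metric_def by blast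
  then show "Re (herm (dmap f X z) (dmap f Y z)) = Re (of_real (2 * (X \<bullet> Y)))"
    by (simp add: inner_eq_Re_herm)
  have "(\<i> *s dmap f X z) \<bullet> dmap f Y z = 0"
    using real fU z unfolding totally_real_def by blast
  then show "Im (herm (dmap f X z) (dmap f Y z)) = Im (of_real (2 * (X \<bullet> Y)))"
    by (simp add: inner_eq_Re_herm herm_simps)
qed

lemma herm_jmul_dmap: "herm (jmul (dmap f X z)) (dmap f Y z) = 0"
proof (rule complex_eqI)
  have "jmul (dmap f X z) \<bullet> dmap f Y z = 0" "(\<i> *s jmul (dmap f X z)) \<bullet> dmap f Y z = 0"
    using real fU z unfolding totally_real_def by blast+
  then show "Re (herm (jmul (dmap f X z)) (dmap f Y z)) = Re 0" "Im (herm (jmul (dmap f X z)) (dmap f Y z)) = Im 0"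
    by (simp_all add: inner_eq_Re_herm herm_simps)
qed

lemma dir_P_P: "dir X P z * P z = outer (dmap f X z) (f z) + outer (jmul (dmap f X z)) (jmul (f z))"
  by (simp add: P_lift[OF fU z] qproj_def distrib_left outer_mult_left act_dir_P_f[OF z] act_dir_P_jf[OF z])

text \<open>The derivative sends \<open>f z\<close> and \<open>jmul (f z)\<close> to
  \<open>dmap f X z\<close> and its \<open>jmul\<close>. Total reality removes the cross terms, and
  the others are the metric; the resulting symmetry in \<open>X\<close> and \<open>Y\<close> is what
  makes the curvature vanish.\<close>

lemma P_dir_P_dir_P_P_lift: "P z * dir X P z * dir Y P z * P z = (2 * (X \<bullet> Y)) *\<^sub>R P z"
proof -
  have oo: "outer v w * outer x y = outer (herm x w *s v) y" for v w x y :: "complex ^ ('n \<times> bool)"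
    by (simp add: outer_mult_left act_outer)
  have os: "outer (of_real r *s v) w = r *\<^sub>R outer v w" for r and v w :: "complex ^ ('n \<times> bool)"
    by (rule cop_eqI) (simp add: act_outer act_simps vec_eq_iff scaleR_conv_of_real[where 'a = complex])
  have o0: "outer 0 w = 0" for w :: "complex ^ ('n \<times> bool)"
    by (rule cop_eqI) (simp add: act_outer act_simps)
  have j: "herm (dmap f Y z) (jmul (dmap f X z)) = 0"
    using arg_cong[OF herm_jmul_dmap[of X Y], of cnj] by (simp add: herm_cnj)
  have "P z * dir X P z * dir Y P z * P z = star (dir X P z * P z) * (dir Y P z * P z)"
    by (simp add: star_simps star_P star_dir_P mult.assoc)
  also have "\<dots> = (2 * (X \<bullet> Y)) *\<^sub>R (outer (f z) (f z) + outer (jmul (f z)) (jmul (f z)))"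
    unfolding dir_P_P star_add star_outer distrib_left distrib_right oo herm_jmul_jmul herm_jmul_dmap j herm_dmap os
    by (simp add: o0 inner_commute scaleR_add_right)
  finally show ?thesis by (simp add: P_lift[OF fU z] qproj_def)
qed

text \<open>The vertical part of \<open>dir X f z\<close> contributes exactly the correction
  subtracted in \<open>levi_civita\<close>. Its horizontal part is sent by \<open>dir X P z\<close>
  into the range of \<open>P z\<close> and is removed by \<open>1 - P z\<close>.\<close>

lemma levi_civita_dmap:
  "levi_civita f X (dmap f X) z = act ((1 - P z) * dir X (dir X P) z) (f z)"
proof -
  let ?V = "dmap f X z" and ?Q = "1 - P z"
  have d: "f differentiable at z" by (rule smooth_on_differentiable[OF f z])
  have dd: "(\<lambda>w. act (dir X P w) (f w)) differentiable at z"
    using bounded_bilinear.FDERIV[OF bounded_bilinear_act has_derivative_dir[OF smooth_differentiable[OF smooth_dir_P]]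
        has_derivative_dir[OF d]] by (rule differentiableI)
  have "dir X (dmap f X) z = dir X (\<lambda>w. act (dir X P w) (f w)) z"
    by (rule dir_cong[OF U z _ dd, symmetric]) (simp add: act_dir_P_f)
  also have "\<dots> = act (dir X P z) (dir X f z) + act (dir X (dir X P) z) (f z)"
    by (rule dir_bounded_bilinear[OF bounded_bilinear_act smooth_differentiable[OF smooth_dir_P] d])
  finally have 1: "dir X (dmap f X) z = act (dir X P z) (dir X f z) + act (dir X (dir X P) z) (f z)" .
  have "dir X f z = herm (dir X f z) (f z) *s f z + herm (dir X f z) (jmul (f z)) *s jmul (f z) + ?V"
    by (simp add: dmap_eq[OF z] P_lift[OF fU z] act_qproj)
  then have "act (dir X P z) (dir X f z) =
      act (dir X P z) (herm (dir X f z) (f z) *s f z + herm (dir X f z) (jmul (f z)) *s jmul (f z) + ?V)"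
    by (rule arg_cong)
  then have 2: "act (dir X P z) (dir X f z) = herm (dir X f z) (f z) *s ?V
      + herm (dir X f z) (jmul (f z)) *s jmul ?V + act (dir X P z) ?V"
    by (simp add: act_vec_simps act_dir_P_f[OF z] act_dir_P_jf[OF z])
  have PV: "act (P z) ?V = 0"
    by (simp add: dmap_eq[OF z] act_vec_simps act_mult[symmetric] PP)
  have PjV: "act (P z) (jmul ?V) = 0"
    by (simp add: act_jmul jc_P PV jmul_simps)
  have "act ?Q (act (dir X P z) ?V) = act ?Q (act (dir X P z * P z + P z * dir X P z) ?V)"
    using arg_cong[OF dir_P[of X z], of "\<lambda>A. act ?Q (act A ?V)"] .
  also have "\<dots> = act ((1 - P z) * P z) (act (dir X P z) ?V)"
    by (simp add: act_add act_mult PV act_vec_simps act_zero)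
  also have "(1 - P z) * P z = 0" by (simp add: left_diff_distrib PP)
  finally have QV: "act ?Q (act (dir X P z) ?V) = 0" by (simp only: act_zero)
  have hor: "hor (f z) v = act ?Q v" for v
    by (simp add: hor_eq P_lift[OF fU z] act_simps)
  show ?thesis
    unfolding levi_civita_def hor 1 2
    by (simp add: act_vadd QV) (simp add: act_simps act_vec_simps PV PjV)
qed

lemma dmap_scaleR: "dmap f (r *\<^sub>R X) z = r *\<^sub>R dmap f X z"
  using dir_linear[OF smooth_on_differentiable[OF f z], of r X 0 X]
  by (simp add: dmap_eq[OF z] act_vec_simps scaleR_diff_right)

end

lemma P_dir_P_dir_P_P: "P z * dir X P z * dir Y P z * P z = (2 * (X \<bullet> Y)) *\<^sub>R P z"
  by (rule lift[of z]) (rule P_dir_P_dir_P_P_lift)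

lemma dir_P_dir_P_P: "dir X P z * dir Y P z * P z = (2 * (X \<bullet> Y)) *\<^sub>R P z"
proof -
  have "dir X P z * (dir Y P z * P z) = (dir X P z * P z + P z * dir X P z) * (dir Y P z * P z)"
    by (rule arg_cong[OF dir_P])
  also have "\<dots> = dir X P z * (P z * dir Y P z * P z) + P z * dir X P z * dir Y P z * P z"
    by (simp add: algebra_simps)
  also have "\<dots> = (2 * (X \<bullet> Y)) *\<^sub>R P z"
    by (simp only: P_dir_P P_dir_P_dir_P_P mult_zero_right add_0)
  finally show ?thesis by (simp only: mult.assoc)
qed

lemma P_dir_P_dir_P: "P z * dir X P z * dir Y P z = (2 * (X \<bullet> Y)) *\<^sub>R P z"
  using arg_cong[OF dir_P_dir_P_P[of Y z X], of star]
  by (simp add: star_simps star_P star_dir_P inner_commute mult.assoc)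

text \<open>The Koszul argument: the tangential part of the second derivative of \<open>P\<close> is zero because the
  coefficients of the metric are constant.\<close>

definition K :: "complex \<Rightarrow> complex \<Rightarrow> complex \<Rightarrow> complex \<Rightarrow> ('n \<times> bool) cop" where
  "K z X Y Z = P z * dir X P z * dir Z (dir Y P) z * P z"

text \<open>Metric compatibility: \<open>dir X P z * dir Y P z * P z\<close> is a constant multiple
  of \<open>P z\<close>, and the derivative of \<open>P z\<close> disappears under compression by
  \<open>P z\<close>.\<close>

lemma K_antisym: "star (K z Y X Z) + K z X Y Z = 0"
proof -
  have d: "P differentiable at z" "dir X P differentiable at z" for X
    by (intro smooth_differentiable smooth_P smooth_dir_P)+
  have s: "smooth (\<lambda>z. dir X P z * dir Y P z)"
    by (intro smooth_on_mult smooth_dir_P open_UNIV)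
  have "dir Z (\<lambda>z. dir X P z * dir Y P z * P z) z = (2 * (X \<bullet> Y)) *\<^sub>R dir Z P z"
    unfolding dir_P_dir_P_P by (rule dir_scaleR[OF d(1)])
  moreover have "dir Z (\<lambda>z. dir X P z * dir Y P z * P z) z =
      dir X P z * dir Y P z * dir Z P z + (dir X P z * dir Z (dir Y P) z + dir Z (dir X P) z * dir Y P z) * P z"
    by (simp add: dir_mult d s[THEN smooth_differentiable])
  ultimately have "P z * ((2 * (X \<bullet> Y)) *\<^sub>R dir Z P z) * P z = P z * (dir X P z * dir Y P z * dir Z P z
      + (dir X P z * dir Z (dir Y P) z + dir Z (dir X P) z * dir Y P z) * P z) * P z"
    by simp
  also have "\<dots> = (P z * dir X P z * dir Y P z) * dir Z P z * P z + P z * dir X P z * dir Z (dir Y P) z * P z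
      + P z * dir Z (dir X P) z * dir Y P z * P z"
    by (simp add: distrib_left distrib_right mult.assoc PP)
  also have "(P z * dir X P z * dir Y P z) * dir Z P z * P z = 0"
    by (simp add: P_dir_P_dir_P P_dir_P)
  finally have "P z * dir X P z * dir Z (dir Y P) z * P z + P z * dir Z (dir X P) z * dir Y P z * P z = 0"
    by (simp add: P_dir_P)
  moreover have "star (K z Y X Z) = P z * dir Z (dir X P) z * dir Y P z * P z"
    by (simp add: K_def star_simps star_P star_dir_P star_dir_dir_P mult.assoc)
  ultimately show ?thesis by (simp add: K_def add.commute)
qed

lemma Re_K_antisym: "Re (herm (act (K z Y X Z) v) v) + Re (herm (act (K z X Y Z) v) v) = 0"
proof -
  have "herm (act (K z X Y Z) v) v = - herm (act (star (K z Y X Z)) v) v"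
    using K_antisym[of z Y X Z] by (simp add: add_eq_0_iff act_simps herm_simps)
  also have "herm (act (star (K z Y X Z)) v) v = cnj (herm (act (K z Y X Z) v) v)"
    by (simp add: herm_act star_simps herm_cnj)
  finally show ?thesis by simp
qed

text \<open>Antisymmetry swaps the first two arguments, symmetry of second derivatives the last two;
  for the order \<open>Z Z X\<close> the real part is its own negative.\<close>

lemma Re_K_eq_0: "Re (herm (act (K z X Z Z) v) v) = 0"
proof -
  have "K z Z X Z = K z Z Z X" by (simp add: K_def dir_commute[OF smooth_P, of Z X])
  moreover have "Re (herm (act (K z Z Z X) v) v) = 0" using Re_K_antisym[of z Z Z X v] by simp
  ultimately show ?thesis using Re_K_antisym[of z Z X Z v] by simp
qed

lemma laplacian_normal: "(1 - P z) * (dir 1 (dir 1 P) z + dir \<i> (dir \<i> P) z) * P z = 0"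
proof -
  obtain f U where fU: "local_lift \<phi> f U" and z: "z \<in> U" by (rule lift)
  \<comment> \<open>In the metric 2 (dx^2 + dy^2) this factor makes the multiples of 1 and
    \<open>\<i>\<close> orthonormal, as \<open>minimal_surface\<close> requires.\<close>
  define c where "c = 1 / sqrt 2"
  have cc: "c * c = 1 / 2" by (simp add: c_def)
  have dirc: "dir (c *\<^sub>R X) F = (\<lambda>w. c *\<^sub>R dir X F w)" if "smooth F" for X and F :: "complex \<Rightarrow> ('n \<times> bool) cop"
    using dir_linear[OF smooth_differentiable[OF that], of c X 0 X] by (auto simp: fun_eq_iff)
  define \<tau> where "\<tau> X = act ((1 - P z) * dir X (dir X P) z) (f z)" for X
  have \<tau>: "levi_civita f (c *\<^sub>R X) (dmap f (c *\<^sub>R X)) z = (1 / 2) *\<^sub>R \<tau> X" for X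
    unfolding levi_civita_dmap[OF fU z] \<tau>_def
    by (simp add: dirc smooth_P smooth_on_scaleR smooth_dir_P
        dir_scaleR smooth_differentiable act_simps act_vec_simps cc scaleR_diff_right)
  \<comment> \<open>By the Koszul argument the second derivatives have no tangential component, so
    the projection \<open>normal\<close> in \<open>mean_curvature\<close> changes nothing.\<close>
  have tan: "\<tau> X \<bullet> dmap f (c *\<^sub>R Y) z = 0" for X Y
  proof -
    have PV: "act (P z) (dmap f Y z) = 0"
      by (simp add: dmap_eq[OF fU z z] act_vec_simps act_mult[symmetric] PP)
    have "herm (\<tau> X) (dmap f Y z) = herm (act (dir X (dir X P) z) (f z)) (dmap f Y z)"
      by (simp add: \<tau>_def act_mult act_diff act_one herm_ldiff herm_act[of "P z"] star_P PV herm_rzero)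
    also have "\<dots> = herm (act (dir X (dir X P) z) (f z)) (act (dir Y P z) (f z))"
      by (simp add: act_dir_P_f[OF fU z z])
    also have "\<dots> = herm (act (dir Y P z) (act (dir X (dir X P) z) (f z))) (f z)"
      by (simp add: herm_act star_dir_P)
    also have "\<dots> = herm (act (K z Y X X) (f z)) (f z)"
      using act_P_f[OF fU z z] by (simp add: K_def act_mult herm_act[of "P z"] star_P)
    finally have "Re (herm (\<tau> X) (dmap f Y z)) = 0" by (simp add: Re_K_eq_0)
    then show ?thesis by (simp add: dmap_scaleR[OF fU z] inner_eq_Re_herm herm_scaleR)
  qed
  have met: "induced_metric f z X Y = 2 * (X \<bullet> Y)" for X Y
    using flat fU z unfolding induced_metric_flat_def by blast
  have "mean_curvature f (c *\<^sub>R 1) (c *\<^sub>R \<i>) z = 0"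
    using minimal fU z met cc unfolding minimal_surface_def
    by (auto simp: inner_complex_def)
  then have "\<tau> 1 + \<tau> \<i> = 0"
    unfolding mean_curvature_def Let_def \<tau> by (simp add: tan flip: scaleR_add_right)
  then have 0: "act ((1 - P z) * (dir 1 (dir 1 P) z + dir \<i> (dir \<i> P) z)) (f z) = 0"
    by (simp add: \<tau>_def distrib_left act_simps)
  \<comment> \<open>The operator commutes with \<open>jmul\<close>, so its vanishing passes from
    \<open>f z\<close> to \<open>jmul (f z)\<close>, and these two span the range of
    \<open>P z\<close>.\<close>
  have "jc ((1 - P z) * (dir 1 (dir 1 P) z + dir \<i> (dir \<i> P) z)) = (1 - P z) * (dir 1 (dir 1 P) z + dir \<i> (dir \<i> P) z)"
    by (simp add: left_diff_distrib jc_simps jc_P jc_dir_dir_P)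
  then have "act ((1 - P z) * (dir 1 (dir 1 P) z + dir \<i> (dir \<i> P) z)) (jmul (f z)) = 0"
    by (simp only: act_jmul 0 jmul_zero)
  note 1 = this
  have Pv: "act (P z) v = herm v (f z) *s f z + herm v (jmul (f z)) *s jmul (f z)" for v
    by (simp add: P_lift[OF fU z] act_qproj)
  show ?thesis
    by (rule cop_eqI) (simp only: act_mult[of _ "P z"] Pv act_vadd act_vscale 0 1 act_zero, simp)
qed

sublocale flat_harmonic_projector P
proof
  fix z
  have S: "P z * (dir X P z * (dir Y P z * P z)) = (2 * (X \<bullet> Y)) *\<^sub>R P z" for X Y
    using P_dir_P_dir_P_P[of z X Y] by (simp add: mult.assoc)
  have i: "iu * (iu * A) = - A" "P z * (iu * A) = iu * (P z * A)" "dir X P z * (iu * A) = iu * (dir X P z * A)"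
    for A :: "('n \<times> bool) cop" and X
    by (simp add: mult.assoc[symmetric] iu_mult_iu, rule iu_mult_left, rule iu_mult_left)
  have half: "(1 / 2) *\<^sub>R A + (1 / 2) *\<^sub>R A = A" for A :: "('n \<times> bool) cop"
    by (simp flip: scaleR_left_distrib)
  \<comment> \<open>Expanding gives (1/4) (2 + 2) times \<open>P z\<close>; the mixed terms vanish
    because 1 and \<open>\<i>\<close> are orthogonal.\<close>
  show "P z * Dz P z * Dzb P z * P z = P z" "P z * Dzb P z * Dz P z * P z = P z"
    by (simp_all add: Dz_def Dzb_def distrib_left distrib_right left_diff_distrib right_diff_distrib
        mult.assoc i S inner_complex_def half scaleR_add_right scaleR_diff_right)
  show "Dzb (Dz P) z * P z = P z * Dzb (Dz P) z * P z"
  proof -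
    define L where "L = dir 1 (dir 1 P) z + dir \<i> (dir \<i> P) z"
    have "L * P z = P z * L * P z"
      using laplacian_normal[of z] by (simp add: L_def[symmetric] left_diff_distrib)
    then show ?thesis
      by (simp add: Dz_Dzb_eq[OF smooth_P] L_def[symmetric])
  qed
qed (simp_all add: smooth_P PP star_P)

end

section \<open>Isotropy\<close>

lemma vec_span_pair: "v \<in> vec.span {s, t} \<longleftrightarrow> (\<exists>a b. v = a *s s + b *s (t :: complex ^ 'm::finite))"
proof -
  have "v \<in> vec.span {s, t} \<longleftrightarrow> (\<exists>a b. v - a *s s = b *s t)"
    by (simp add: vec.span_insert vec.span_singleton image_iff)
  then show ?thesis by (simp add: algebra_simps)
qed

lemma exists_orthogonal_projection_pair:
  "\<exists>w. (\<forall>u\<in>vec.span {s, t}. herm w u = 0) \<and> v - w \<in> vec.span {s, t :: complex ^ 'm::finite}"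
proof -
  \<comment> \<open>For \<open>y = 0\<close> division by zero yields \<open>pr x y = 0\<close>, so
    Gram-Schmidt needs no independence of \<open>s\<close> and \<open>t\<close>.\<close>
  define pr where "pr x y = (herm x y / herm y y) *s y" for x y :: "complex ^ 'm"
  have pr: "herm (x - pr x y) y = 0" for x y
    by (cases "y = 0") (simp_all add: pr_def herm_simps herm_self_eq_0)
  define t' where "t' = t - pr t s"
  define w where "w = v - pr v s - pr (v - pr v s) t'"
  have t's: "herm t' s = 0" by (simp add: t'_def pr)
  have "herm w s = herm (v - pr v s) s - herm (pr (v - pr v s) t') s"
    by (simp only: w_def herm_ldiff)
  also have "\<dots> = 0" by (simp only: pr) (simp add: pr_def herm_lscale t's)
  finally have ws: "herm w s = 0" .
  have wt': "herm w t' = 0" unfolding w_def by (rule pr)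
  have "t = t' + (herm t s / herm s s) *s s" by (simp add: t'_def pr_def)
  then have "herm w t = herm w (t' + (herm t s / herm s s) *s s)" by (rule arg_cong)
  then have wt: "herm w t = 0" by (simp add: herm_simps ws wt')
  have st: "s \<in> vec.span {s, t}" "t \<in> vec.span {s, t}" by (simp_all add: vec.span_base)
  have prs: "pr x y \<in> vec.span {s, t}" if "y \<in> vec.span {s, t}" for x y
    unfolding pr_def using that by (rule vec.span_scale)
  have "t' \<in> vec.span {s, t}" unfolding t'_def by (intro vec.span_diff prs st)
  then have "pr v s + pr (v - pr v s) t' \<in> vec.span {s, t}" by (intro vec.span_add prs st)
  then have "v - w \<in> vec.span {s, t}" by (simp add: w_def)
  moreover have "herm w u = 0" if "u \<in> vec.span {s, t}" for u
    using that by (auto simp: vec_span_pair herm_simps ws wt)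
  ultimately show ?thesis by blast
qed

lemma perp_proj_eqI:
  assumes "vec.subspace W" "\<And>u. u \<in> W \<Longrightarrow> herm w u = 0" "v - w \<in> W"
  shows "perp_proj W v = w"
  unfolding perp_proj_def
proof (rule the_equality)
  fix x assume x: "(\<forall>u\<in>W. herm x u = 0) \<and> v - x \<in> W"
  have "v - w - (v - x) \<in> W" using vec.subspace_diff[OF assms(1,3)] x by blast
  then have "x - w \<in> W" by simp
  then have "herm (x - w) (x - w) = 0" using x assms(2) by (simp add: herm_ldiff)
  then show "x = w" by (simp add: herm_self_eq_0)
qed (use assms in auto)

lemma diff_perp_proj_mem:
  assumes "W = vec.span {s, t}"
  shows "v - perp_proj W v \<in> W"
proof -
  obtain w where w: "\<forall>u\<in>W. herm w u = 0" "v - w \<in> W"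
    using exists_orthogonal_projection_pair[of s t v] assms by blast
  have "perp_proj W v = w" by (rule perp_proj_eqI) (use w assms in auto)
  then show ?thesis using w by simp
qed

text \<open>The value at a point of \<open>S\<close> is a limit of values outside \<open>S\<close>.
  This covers the isolated points where a fibre of the sequence is only an extension of the image of
  A'.\<close>

lemma eq_zero_off_sparse:
  fixes g :: "complex \<Rightarrow> 'b::real_normed_vector"
  assumes "S sparse_in UNIV" "open U" "z \<in> U" "continuous_on U g" "\<And>w. w \<in> U \<Longrightarrow> w \<notin> S \<Longrightarrow> g w = 0"
  shows "g z = 0"
proof -
  obtain B where B: "open B" "z \<in> B" "\<forall>y\<in>B. y \<noteq> z \<longrightarrow> y \<notin> S"
    using sparse_in_not_in[OF assms(1) UNIV_I] by blast
  have "g \<midarrow>z\<rightarrow> g z"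
    using assms(2,3,4) by (simp add: continuous_on_eq_continuous_at isCont_def)
  moreover have "\<forall>\<^sub>F w in at z. g w = 0"
    unfolding eventually_at_topological
    by (rule exI[of _ "B \<inter> U"]) (use B assms in auto)
  then have "g \<midarrow>z\<rightarrow> 0" by (rule tendsto_eventually)
  ultimately show ?thesis using tendsto_unique[OF at_neq_bot] by blast
qed

lemma dz_scaleR: "dz s z = (1 / 2) *\<^sub>R (dir 1 s z - \<i> *s dir \<i> s z)"
  by (simp add: dz_def vec_eq_iff scaleR_conv_of_real[where 'a = complex])

lemma dz_act:
  assumes "smooth F" "\<sigma> differentiable at z"
  shows "dz (\<lambda>z. act (F z) (\<sigma> z)) z = act (Dz F z) (\<sigma> z) + act (F z) (dz \<sigma> z)"
  by (simp add: dz_scaleR Dz_def dir_bounded_bilinear[OF bounded_bilinear_act smooth_differentiable[OF assms(1)] assms(2)]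
      act_simps act_vec_simps vec_eq_iff algebra_simps)

lemma dz_eq_zero:
  assumes "open U" "z \<in> U" "\<And>w. w \<in> U \<Longrightarrow> f w = 0"
  shows "dz f z = 0"
proof -
  have "(f has_derivative (\<lambda>X. 0)) (at z)"
    by (rule has_derivative_transform_within_open[of "\<lambda>z. 0" _ _ _ U]) (use assms in auto)
  then show ?thesis by (simp add: dz_def dir_eqI[of f "\<lambda>X. 0"])
qed

lemma dz_cong:
  assumes "open U" "z \<in> U" "\<And>w. w \<in> U \<Longrightarrow> f w = g w" "f differentiable at z"
  shows "dz f z = dz g z"
  using dir_cong[OF assms] by (simp add: dz_def)

lemma rank2_bundle_section:
  assumes "rank2_bundle W" "v \<in> W z"
  obtains U \<sigma> where "open U" "z \<in> U" "smooth_on U \<sigma>" "\<And>w. w \<in> U \<Longrightarrow> \<sigma> w \<in> W w" "\<sigma> z = v"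
proof -
  obtain U s t where U: "open U" "z \<in> U" "smooth_on U s" "smooth_on U t" "\<And>w. w \<in> U \<Longrightarrow> W w = vec.span {s w, t w}"
    using assms(1) unfolding rank2_bundle_def by metis
  then obtain a b where ab: "v = a *s s z + b *s t z" using assms(2) by (auto simp: vec_span_pair)
  have bl: "bounded_linear (\<lambda>v :: complex ^ 'a. c *s v)" for c
  proof -
    have "linear (\<lambda>v :: complex ^ 'a. c *s v)" by (rule linearI) (simp_all add: vec_eq_iff algebra_simps)
    then show ?thesis by (simp add: linear_conv_bounded_linear)
  qed
  show thesis
  proof
    show "smooth_on U (\<lambda>w. a *s s w + b *s t w)"
      by (intro smooth_on_add smooth_on_bounded_linear[OF bl] U)
    show "a *s s w + b *s t w \<in> W w" if "w \<in> U" for w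
      using U(5)[OF that] by (auto simp: vec_span_pair)
  qed (use U ab in auto)
qed

lemma rank2_bundle_split:
  assumes "rank2_bundle W"
  shows "v - perp_proj (W z) v \<in> W z"
proof -
  obtain s t where "W z = vec.span {s, t}" using assms unfolding rank2_bundle_def by metis
  then show ?thesis by (rule diff_perp_proj_mem)
qed

context flat_harmonic_projector
begin

text \<open>The adjoint form of the recursion: differentiating \<open>\<langle>s, B (- m)\<rangle> = 0\<close> along a section \<open>s\<close> of
  \<open>\<psi> i\<close> moves the derivative to \<open>B (- m)\<close>, because \<open>s\<^sub>z\<close> lies in \<open>\<psi> i + \<psi> (Suc i)\<close>.\<close>

lemma star_Bm_sequence:
  assumes seq: "harmonic_sequence \<phi> \<psi>" and perp: "perp_upto \<psi> n"
    and rng: "\<And>z v. act (P z) v \<in> \<phi> z"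
    and "1 \<le> i" "i + m \<le> n" "v \<in> \<psi> i z"
  shows "act (star (Bm m z)) v = 0"
  using assms(4-6)
proof (induction m arbitrary: i v z)
  case 0
  have "herm (act (P z) v) (act (P z) v) = herm v (act (P z) (act (P z) v))"
    by (simp add: herm_act star_P)
  also have "\<dots> = cnj (herm (act (P z) (act (P z) v)) v)" by (simp add: herm_cnj)
  also have "\<dots> = 0"
    using perp seq rng 0 unfolding perp_upto_def harmonic_sequence_def by fastforce
  finally show ?case by (simp add: herm_self_eq_0 star_P)
next
  case (Suc m)
  have bdl: "rank2_bundle (\<psi> i)" and sparse: "{z. A'_image (\<psi> i) z \<noteq> \<psi> (Suc i) z} sparse_in UNIV"
    using seq unfolding harmonic_sequence_def by blast+
  obtain U \<sigma> where U: "open U" "z \<in> U" "smooth_on U \<sigma>" "\<And>w. w \<in> U \<Longrightarrow> \<sigma> w \<in> \<psi> i w" "\<sigma> z = v"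
    using rank2_bundle_section[OF bdl Suc.prems(3)] by blast
  have "act (star (Bm (Suc m) z)) (\<sigma> z) = 0"
  proof (rule eq_zero_off_sparse[OF sparse U(1,2)])
    show "continuous_on U (\<lambda>w. act (star (Bm (Suc m) w)) (\<sigma> w))"
      by (intro bounded_bilinear.continuous_on[OF bounded_bilinear_act] smooth_on_continuous_on U
          smooth_on_subset[OF smooth_star[OF smooth_Bm]] subset_UNIV)
    fix w assume w: "w \<in> U" "w \<notin> {z. A'_image (\<psi> i) z \<noteq> \<psi> (Suc i) z}"
    have "perp_proj (\<psi> i w) (dz \<sigma> w) \<in> A'_image (\<psi> i) w"
      using U w unfolding A'_image_def by blast
    then have "perp_proj (\<psi> i w) (dz \<sigma> w) \<in> \<psi> (Suc i) w" using w by simp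
    \<comment> \<open>Since \<open>Suc i + m = i + Suc m\<close>, the induction hypothesis covers
      \<open>\<psi> (Suc i)\<close> too.\<close>
    then have 1: "act (star (Bm m w)) (perp_proj (\<psi> i w) (dz \<sigma> w)) = 0"
      using Suc.prems by (intro Suc.IH) auto
    have 2: "act (star (Bm m w)) (dz \<sigma> w - perp_proj (\<psi> i w) (dz \<sigma> w)) = 0"
      using Suc.prems rank2_bundle_split[OF bdl] by (intro Suc.IH) auto
    have 3: "act (star (Bm m w)) (dz \<sigma> w) = 0" using 1 2 by (simp add: act_vec_simps)
    have "dz (\<lambda>w. act (star (Bm m w)) (\<sigma> w)) w = 0"
      using Suc.prems U(4) by (intro dz_eq_zero[OF U(1) w(1)] Suc.IH) auto
    then have "act (star (Dzb (Bm m) w)) (\<sigma> w) = 0"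
      using 3 dz_act[OF smooth_star[OF smooth_Bm] smooth_on_differentiable[OF U(3) w(1)], of m]
      by (simp add: D_star smooth_Bm)
    then show "act (star (Bm (Suc m) w)) (\<sigma> w) = 0"
      by (simp add: star_simps star_P act_simps act_vec_simps)
  qed
  then show ?case by (simp add: U)
qed

text \<open>For a section \<open>\<sigma>\<close> of \<open>\<phi>\<close>, the part of its
  derivative orthogonal to the bundle is \<open>act (Dz P w) (\<sigma> w)\<close>. So off the
  exceptional set \<open>Dz P w * P w\<close> takes values in \<open>\<psi> 1\<close>, and the
  preceding lemma applies with \<open>i = 1\<close>.\<close>

lemma isotropic_of_sequence:
  assumes seq: "harmonic_sequence \<phi> \<psi>" and perp: "perp_upto \<psi> n"
    and rng: "\<And>z. \<phi> z = {v. act (P z) v = v}"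
    and "m < n"
  shows "star (Bm m z) * (Dz P z * P z) = 0"
proof -
  have \<psi>0: "\<psi> 0 = \<phi>" and bdl: "rank2_bundle \<phi>"
    and sparse: "{z. A'_image \<phi> z \<noteq> \<psi> (Suc 0) z} sparse_in UNIV"
    using seq unfolding harmonic_sequence_def by metis+
  have mem: "act (P z) v \<in> \<phi> z" for z v by (simp add: rng act_mult[symmetric] PP)
  have sub: "vec.subspace (\<phi> z)" for z
    unfolding rng by (rule vec.subspaceI) (simp_all add: act_vec_simps)
  show ?thesis
  proof (rule eq_zero_off_sparse[OF sparse open_UNIV UNIV_I])
    show "continuous_on UNIV (\<lambda>z. star (Bm m z) * (Dz P z * P z))"
      by (intro smooth_on_continuous_on smooth_on_mult smooth_star smooth_Bm smooth_Dz smooth_P open_UNIV)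
    fix w assume w: "w \<notin> {z. A'_image \<phi> z \<noteq> \<psi> (Suc 0) z}"
    show "star (Bm m w) * (Dz P w * P w) = 0"
    proof (rule cop_eqI)
      fix v
      obtain U \<sigma> where U: "open U" "w \<in> U" "smooth_on U \<sigma>" "\<And>x. x \<in> U \<Longrightarrow> \<sigma> x \<in> \<phi> x" "\<sigma> w = act (P w) v"
        using rank2_bundle_section[OF bdl mem] by blast
      have P\<sigma>: "act (P x) (\<sigma> x) = \<sigma> x" if "x \<in> U" for x using U(4)[OF that] rng by simp
      have d: "\<sigma> differentiable at w" using smooth_on_differentiable[OF U(3,2)] .
      have "dz \<sigma> w = dz (\<lambda>x. act (P x) (\<sigma> x)) w"
        by (rule dz_cong[OF U(1,2)]) (use P\<sigma> d in auto)
      also have "\<dots> = act (Dz P w) (\<sigma> w) + act (P w) (dz \<sigma> w)" by (rule dz_act[OF smooth_P d])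
      finally have 1: "act (Dz P w) (\<sigma> w) = dz \<sigma> w - act (P w) (dz \<sigma> w)" by (simp add: eq_diff_eq)
      have "perp_proj (\<phi> w) (dz \<sigma> w) = act (Dz P w) (\<sigma> w)"
      proof (rule perp_proj_eqI[OF sub])
        show "dz \<sigma> w - act (Dz P w) (\<sigma> w) \<in> \<phi> w" by (simp add: 1 mem)
        fix u assume "u \<in> \<phi> w"
        then have u: "act (P w) u = u"  using rng by simp
        have "herm (act (Dz P w) (\<sigma> w)) u = herm (act (Dz P w) (\<sigma> w)) (act (P w) u)" by (simp add: u)
        also have "\<dots> = herm (act (P w) (act (Dz P w) (\<sigma> w))) u" by (simp add: herm_act star_P)
        also have "act (P w) (act (Dz P w) (\<sigma> w)) = 0"
          by (simp add: 1 act_vec_simps act_mult[symmetric] PP)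
        finally show "herm (act (Dz P w) (\<sigma> w)) u = 0" by (simp add: herm_simps)
      qed
      moreover have "perp_proj (\<phi> w) (dz \<sigma> w) \<in> A'_image \<phi> w"
        using U unfolding A'_image_def by blast
      ultimately have "act (Dz P w) (\<sigma> w) \<in> \<psi> 1 w" using w by simp
      then have "act (star (Bm m w)) (act (Dz P w) (\<sigma> w)) = 0"
        using \<open>m < n\<close> by (intro star_Bm_sequence[OF seq perp mem, of 1]) auto
      then show "act (star (Bm m w) * (Dz P w * P w)) v = act 0 v"
        by (simp add: act_simps U(5))
    qed
  qed
qed

end

section \<open>Linear algebra of quaternionic lines\<close>

lemma qline_memI: "a *s q + b *s jmul q \<in> qline q"
  unfolding qline_def by blast

lemma qline_trans:
  assumes "w \<in> qline q"
  shows "qline w \<subseteq> qline q"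
proof
  obtain a b where w: "w = a *s q + b *s jmul q" using assms by (auto simp: qline_def)
  fix v assume "v \<in> qline w"
  then obtain c d where v: "v = c *s w + d *s jmul w" by (auto simp: qline_def)
  \<comment> \<open>The quaternion product (c + d j)(a + b j).\<close>
  have "v = (c * a - d * cnj b) *s q + (c * b + d * cnj a) *s jmul q"
    unfolding v w by (simp add: jmul_simps vec_eq_iff algebra_simps)
  then show "v \<in> qline q" by (simp only: qline_memI)
qed

lemma qline_eqI:
  assumes "w \<in> qline q" "w \<noteq> 0"
  shows "qline w = qline q"
proof
  obtain a b where w: "w = a *s q + b *s jmul q" using assms by (auto simp: qline_def)
  define r where "r = a * cnj a + b * cnj b"
  have "r = of_real ((cmod a)\<^sup>2 + (cmod b)\<^sup>2)" by (simp add: r_def flip: complex_norm_square)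
  then have r: "r \<noteq> 0" using assms(2) w by (auto simp: sum_power2_eq_zero_iff simp del: of_real_add)
  \<comment> \<open>Left multiplication by the conjugate quaternion of a + b j; \<open>r\<close> is
    its squared norm.\<close>
  have "cnj a *s w - b *s jmul w = r *s q"
    unfolding w r_def by (simp add: jmul_simps vec_eq_iff algebra_simps)
  then have "(1 / r) *s (cnj a *s w - b *s jmul w) = q" using r by simp
  then have "q = (cnj a / r) *s w + (- b / r) *s jmul w" by (simp add: vec_eq_iff algebra_simps diff_divide_distrib) 
  then have "q \<in> qline w" using qline_memI by metis
  then show "qline q \<subseteq> qline w" by (rule qline_trans)
qed (rule qline_trans[OF assms(1)])

lemma eigenvector_in_qline:
  assumes "norm q = 1" "act S q \<in> qline q" "act S (jmul q) \<in> qline q"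
  obtains u \<mu> where "u \<in> qline q" "norm u = 1" "act S u = \<mu> *s u"
proof -
  obtain \<alpha> \<beta> where Sq: "act S q = \<alpha> *s q + \<beta> *s jmul q" using assms(2) by (auto simp: qline_def)
  obtain \<gamma> \<delta> where Sj: "act S (jmul q) = \<gamma> *s q + \<delta> *s jmul q" using assms(3) by (auto simp: qline_def)
  have "\<exists>u \<mu>. u \<in> qline q \<and> u \<noteq> 0 \<and> act S u = \<mu> *s u"
  proof (cases "\<gamma> = 0")
    case True
    have "jmul q \<noteq> 0" using herm_unit(2)[OF assms(1)] by (auto simp: herm_lzero)
    moreover have "jmul q \<in> qline q" using qline_memI[of 0 q 1] by simp
    ultimately show ?thesis using Sj True by auto
  next
    case False
    \<comment> \<open>A root of the discriminant of the 2 by 2 matrix of \<open>S\<close> in the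
      basis \<open>q\<close>, \<open>jmul q\<close>, so that \<open>\<mu>\<close> is an eigenvalue;
      \<open>\<gamma> \<noteq> 0\<close> makes the eigenvector \<open>u\<close> below
      nonzero.\<close>
    define \<Delta> where "\<Delta> = csqrt ((\<alpha> - \<delta>)\<^sup>2 + 4 * \<beta> * \<gamma>)"
    define \<mu> where "\<mu> = (\<alpha> + \<delta> + \<Delta>) / 2"
    have "\<Delta>\<^sup>2 = (\<alpha> - \<delta>)\<^sup>2 + 4 * \<beta> * \<gamma>" by (simp add: \<Delta>_def)
    moreover have "2 * \<mu> = \<alpha> + \<delta> + \<Delta>" by (simp add: \<mu>_def)
    ultimately have "4 * (\<gamma> * \<beta> + (\<mu> - \<alpha>) * \<delta>) = 4 * (\<mu> * (\<mu> - \<alpha>))" by algebra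
    then have \<mu>: "\<gamma> * \<beta> + (\<mu> - \<alpha>) * \<delta> = \<mu> * (\<mu> - \<alpha>)"
      by (rule mult_left_cancel[THEN iffD1, rotated]) simp
    define u where "u = \<gamma> *s q + (\<mu> - \<alpha>) *s jmul q"
    have "herm u q = \<gamma>" by (simp add: u_def herm_simps herm_unit[OF assms(1)] herm_jmul_self)
    then have "u \<noteq> 0" using False by (auto simp: herm_lzero)
    moreover have "act S u = (\<mu> * \<gamma>) *s q + (\<gamma> * \<beta> + (\<mu> - \<alpha>) * \<delta>) *s jmul q"
      by (simp add: u_def act_vec_simps Sq Sj vec_eq_iff algebra_simps)
    then have "act S u = \<mu> *s u" unfolding \<mu> u_def by (simp add: vec_eq_iff algebra_simps)
    ultimately show ?thesis unfolding u_def using qline_memI by blast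
  qed
  then obtain u \<mu> where u: "u \<in> qline q" "u \<noteq> 0" "act S u = \<mu> *s u" by blast
  have "of_real (1 / norm u) *s u = (1 / norm u) *\<^sub>R u"
    by (simp add: vec_eq_iff scaleR_conv_of_real[where 'a = complex])
  moreover have "of_real (1 / norm u) *s u \<in> qline u" using qline_memI[of _ u 0] by simp
  ultimately have "(1 / norm u) *\<^sub>R u \<in> qline q" using qline_trans[OF u(1)] by auto
  then show thesis
    using that[of "(1 / norm u) *\<^sub>R u" \<mu>] u by (simp add: act_vec_simps) (simp add: vec_eq_iff)
qed

section \<open>The constant frame\<close>

lemma root_of_unity_power:
  assumes "N > 0" "\<epsilon> = exp (\<i> * of_real (2 * pi / real N))"
  shows "\<epsilon> ^ j = exp (\<i> * of_real (2 * real j * pi / real N))" and "\<epsilon> ^ N = 1"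
    and "\<epsilon> ^ j = 1 \<longleftrightarrow> N dvd j" and "\<epsilon> * cnj \<epsilon> = 1"
proof -
  show 1: "\<epsilon> ^ j = exp (\<i> * of_real (2 * real j * pi / real N))" for j
    by (simp add: assms(2) exp_of_nat_mult[symmetric] mult_ac)
  have 2: "\<epsilon> ^ j = exp (2 * of_real pi * \<i> * of_nat j / of_nat N)" for j
    by (simp add: 1 mult_ac)
  show 3: "\<epsilon> ^ j = 1 \<longleftrightarrow> N dvd j" for j
    unfolding 2 by (rule complex_root_unity_eq_1) (use assms(1) in simp)
  then show "\<epsilon> ^ N = 1" by simp
  have "cmod \<epsilon> = 1" by (simp add: assms(2))
  then show "\<epsilon> * cnj \<epsilon> = 1" by (simp flip: complex_norm_square)
qed

text \<open>What remains of the surface at one point: a unitary \<open>T\<close> and a vector with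
  orthogonal orbit that is an eigenvector of \<open>T ^ N\<close>. The eigenvalue is written
  \<open>\<tau> ^ N\<close>, so its \<open>N\<close>-th roots are \<open>\<tau>\<close> times powers
  of the primitive root of unity \<open>\<epsilon>\<close>.\<close>

locale eigenframe =
  fixes T :: "('n::finite \<times> bool) cop" and u :: "complex ^ ('n \<times> bool)" and \<tau> \<epsilon> :: complex and N :: nat
  assumes star_T_T: "star T * T = 1" and T_star_T: "T * star T = 1"
    and jc_T: "jc T = - star T"
    and N: "N > 0" and unit: "herm u u = 1"
    and orth: "i < N \<Longrightarrow> j < N \<Longrightarrow> i \<noteq> j \<Longrightarrow> herm (act (T ^ i) u) (act (T ^ j) u) = 0"
    and orth_j: "i < N \<Longrightarrow> j < N \<Longrightarrow> herm (act (T ^ i) u) (act (T ^ j) (jmul u)) = 0"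
    and eigen: "act (T ^ N) u = \<tau> ^ N *s u"
    and \<tau>: "\<tau> * cnj \<tau> = 1" and \<epsilon>: "\<epsilon> * cnj \<epsilon> = 1" and \<epsilon>N: "\<epsilon> ^ N = 1" and \<epsilon>_eq_1: "\<And>j. \<epsilon> ^ j = 1 \<longleftrightarrow> N dvd j"
begin

definition \<zeta> :: "nat \<Rightarrow> complex" where "\<zeta> k = \<tau> * \<epsilon> ^ k"

text \<open>A discrete Fourier component of the orbit: the projection of \<open>u\<close> to the
  eigenspace of \<open>T\<close> for \<open>\<zeta> k\<close>.\<close>

definition v :: "nat \<Rightarrow> complex ^ ('n \<times> bool)" where
  "v k = (1 / of_nat N) *s (\<Sum>j<N. cnj (\<zeta> k) ^ j *s act (T ^ j) u)"

lemma \<zeta>: "\<zeta> k * cnj (\<zeta> k) = 1"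
proof -
  have "\<zeta> k * cnj (\<zeta> k) = (\<tau> * cnj \<tau>) * (\<epsilon> * cnj \<epsilon>) ^ k"
    by (simp add: \<zeta>_def power_mult_distrib mult_ac)
  then show ?thesis by (simp add: \<tau> \<epsilon>)
qed

lemma \<zeta>_N: "\<zeta> k ^ N = \<tau> ^ N"
  by (simp add: \<zeta>_def power_mult_distrib \<epsilon>N flip: power_mult) (metis \<epsilon>N mult.commute power_mult power_one)

lemma \<epsilon>_inj:
  assumes "k < N" "l < N" "\<epsilon> ^ k = \<epsilon> ^ l"
  shows "k = l"
  using assms
proof (induction k l rule: linorder_wlog)
  case (le k l)
  have "\<epsilon> \<noteq> 0" using \<epsilon> by auto
  have "\<epsilon> ^ l = \<epsilon> ^ k * \<epsilon> ^ (l - k)" using le(1) by (simp flip: power_add)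
  then have "\<epsilon> ^ (l - k) = 1" using le(4) \<open>\<epsilon> \<noteq> 0\<close> by simp
  then have "N dvd l - k" by (simp add: \<epsilon>_eq_1)
  then show ?case using le by (metis diff_is_0_eq dvd_imp_le le_antisym less_imp_diff_less not_gr_zero not_le)
next
  case (sym k l)
  then show ?case by simp
qed

text \<open>Up to the factor \<open>\<zeta> k\<close>, \<open>T\<close> shifts the summands
  cyclically; the cycle closes because \<open>\<zeta> k ^ N\<close> is the eigenvalue of
  \<open>T ^ N\<close> at \<open>u\<close>.\<close>

lemma T_v: "act T (v k) = \<zeta> k *s v k"
proof -
  let ?c = "cnj (\<zeta> k)"
  define g where "g j = ?c ^ j *s act (T ^ j) u" for j
  have step: "act T (g j) = \<zeta> k *s g (Suc j)" for j
  proof -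
    have "\<zeta> k *s g (Suc j) = (\<zeta> k * ?c * ?c ^ j) *s act T (act (T ^ j) u)"
      by (simp add: g_def act_mult mult.assoc)
    then show ?thesis by (simp add: \<zeta> g_def act_vec_simps)
  qed
  have "g N = (?c ^ N * \<tau> ^ N) *s u" by (simp add: g_def eigen)
  also have "?c ^ N * \<tau> ^ N = (\<zeta> k * ?c) ^ N" by (simp add: power_mult_distrib \<zeta>_N mult.commute)
  finally have gN: "g N = g 0" by (simp add: \<zeta> g_def act_one)
  have "(\<Sum>j<N. g (Suc j)) = (\<Sum>j<N. g j)"
    using sum.lessThan_Suc_shift[of g N] gN by simp
  then show ?thesis
    by (simp add: v_def act_vec_simps act_vsum step flip: g_def) (simp add: vec.scale_sum_right[symmetric] mult.commute)
qed

lemma star_T_v: "act (star T) (v k) = cnj (\<zeta> k) *s v k"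
proof -
  have "act (star T) (act T (v k)) = v k" by (simp add: act_mult[symmetric] star_T_T act_one)
  then have "\<zeta> k *s act (star T) (v k) = v k" by (simp add: T_v act_vec_simps)
  then have "cnj (\<zeta> k) *s (\<zeta> k *s act (star T) (v k)) = cnj (\<zeta> k) *s v k" by simp
  moreover have "cnj (\<zeta> k) * \<zeta> k = 1" using \<zeta>[of k] by (simp add: mult.commute)
  ultimately show ?thesis by simp
qed

text \<open>Orthogonality of characters: summed over \<open>k\<close>, only the terms with
  \<open>j = 0\<close> survive.\<close>

lemma sum_v: "(\<Sum>k<N. v k) = u"
proof -
  have geo: "(\<Sum>k<N. cnj (\<zeta> k) ^ j) = (if j = 0 then of_nat N else 0)" if "j < N" for j
  proof (cases "j = 0")
    case False
    let ?w = "cnj \<epsilon> ^ j"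
    have "\<epsilon> ^ j \<noteq> 1" using that False by (auto simp: \<epsilon>_eq_1 dest: dvd_imp_le)
    then have w1: "?w \<noteq> 1" by (metis complex_cnj_one complex_cnj_power complex_cnj_cnj)
    have "?w ^ N = cnj ((\<epsilon> ^ N) ^ j)" by (simp add: mult.commute flip: power_mult)
    then have wN: "?w ^ N = 1" by (simp add: \<epsilon>N)
    have "(?w - 1) * (\<Sum>k<N. ?w ^ k) = 0" using power_diff_1_eq[of ?w N] wN by simp
    then have "(\<Sum>k<N. ?w ^ k) = 0" using w1 by simp
    moreover have "cnj (\<zeta> k) ^ j = cnj \<tau> ^ j * ?w ^ k" for k
      by (simp add: \<zeta>_def power_mult_distrib mult.commute flip: power_mult)
    ultimately show ?thesis using False by (simp flip: sum_distrib_left)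
  qed simp
  have "(\<Sum>k<N. v k) = (1 / of_nat N) *s (\<Sum>k<N. \<Sum>j<N. cnj (\<zeta> k) ^ j *s act (T ^ j) u)"
    by (simp add: v_def vec.scale_sum_right)
  also have "(\<Sum>k<N. \<Sum>j<N. cnj (\<zeta> k) ^ j *s act (T ^ j) u) = (\<Sum>j<N. \<Sum>k<N. cnj (\<zeta> k) ^ j *s act (T ^ j) u)"
    by (rule sum.swap)
  also have "\<dots> = (\<Sum>j<N. (\<Sum>k<N. cnj (\<zeta> k) ^ j) *s act (T ^ j) u)"
    by (simp add: vec.scale_sum_left)
  also have "\<dots> = (\<Sum>j<N. if j = 0 then of_nat N *s u else 0)"
    by (intro sum.cong refl) (simp add: geo act_one)
  finally show ?thesis using N by simp
qed

lemma herm_v: 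
  assumes "k < N" "l < N"
  shows "herm (v k) (v l) = (if k = l then 1 / of_nat N else 0)"
proof -
  have off: "herm (v k) (v l) = 0" if "k < N" "l < N" "k \<noteq> l" for k l
  proof -
    have "herm (v k) (v l) = herm (act T (v k)) (act T (v l))"
      by (simp add: herm_act act_mult[symmetric] star_T_T act_one)
    then have "herm (v k) (v l) = \<zeta> k * cnj (\<zeta> l) * herm (v k) (v l)"
      by (simp add: T_v herm_simps mult_ac)
    moreover have "\<zeta> k * cnj (\<zeta> l) \<noteq> 1"
    proof
      assume "\<zeta> k * cnj (\<zeta> l) = 1"
      then have "\<zeta> k * (\<zeta> l * cnj (\<zeta> l)) = \<zeta> l" by (simp add: mult_ac)
      then have "\<zeta> k = \<zeta> l" by (simp add: \<zeta>)
      moreover have "\<tau> \<noteq> 0" using \<tau> by auto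
      ultimately show False using \<epsilon>_inj that by (simp add: \<zeta>_def)
    qed
    ultimately show ?thesis by (metis mult_cancel_right1)
  qed
  \<comment> \<open>The norm is computed through \<open>u\<close>: by \<open>sum_v\<close> and
    orthogonality the product with \<open>u\<close> is the squared norm, and orthogonality of the
    orbit leaves only the summand \<open>j = 0\<close> of \<open>v k\<close>.\<close>
  have "herm (v k) u = herm (v k) (v k)"
  proof -
    have "herm (v k) u = (\<Sum>l<N. herm (v k) (v l))" by (simp add: sum_v flip: herm_rsum)
    also have "\<dots> = (\<Sum>l<N. if l = k then herm (v k) (v k) else 0)"
      using off assms by (intro sum.cong refl) auto
    finally show ?thesis using assms by simp
  qed
  moreover have "herm (v k) u = 1 / of_nat N"
  proof -
    have "herm (v k) u = (1 / of_nat N) * (\<Sum>j<N. cnj (\<zeta> k) ^ j * herm (act (T ^ j) u) u)"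
      by (simp add: v_def herm_simps herm_lsum)
    also have "(\<Sum>j<N. cnj (\<zeta> k) ^ j * herm (act (T ^ j) u) u) = (\<Sum>j<N. if j = 0 then 1 else 0)"
      using orth[of _ 0] N by (intro sum.cong refl) (auto simp: act_one unit)
    finally show ?thesis using N by simp
  qed
  ultimately show ?thesis using off assms by auto
qed

lemma T_jmul: "act T (jmul x) = - jmul (act (star T) x)"
proof -
  have "jmul (act T (jmul x)) = act (star T) x"
    using arg_cong[OF jc_T, of "\<lambda>A. act A x"] by (simp add: act_jc act_simps)
  then have "- act T (jmul x) = jmul (act (star T) x)" by (simp flip: jmul_jmul)
  then show ?thesis by (metis minus_minus)
qed

lemma star_T_jmul: "act (star T) (jmul x) = - jmul (act T x)"
proof -
  have "act T (jmul (act T x)) = - jmul x"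
    by (simp add: T_jmul act_mult[symmetric] star_T_T act_one)
  then have "act (star T) (act T (jmul (act T x))) = - act (star T) (jmul x)"
    by (simp add: act_vec_simps)
  then have "jmul (act T x) = - act (star T) (jmul x)"
    by (simp add: act_mult[symmetric] star_T_T act_one)
  then show ?thesis by simp
qed

lemma jmul_T_power: "jmul (act (T ^ j) u) = (- 1) ^ j *s act (star T ^ j) (jmul u)"
proof (induction j)
  case 0
  then show ?case by (simp add: act_one)
next
  case (Suc j)
  have "jmul (act (T ^ Suc j) u) = - act (star T) (jmul (act (T ^ j) u))"
    by (simp add: star_T_jmul act_mult)
  then show ?case by (simp add: Suc act_vec_simps act_mult)
qed

lemma T_power_star_T_power: "T ^ (i + j) * star T ^ j = T ^ i"
proof (induction j)
  case (Suc j)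
  have "T ^ (i + Suc j) * star T ^ Suc j = (T ^ (i + j) * T) * (star T * star T ^ j)"
    by (simp only: add_Suc_right power_Suc2[of T] power_Suc[of "star T"])
  also have "\<dots> = T ^ (i + j) * (T * star T) * star T ^ j" by (simp only: mult.assoc)
  finally show ?case by (simp add: T_star_T Suc)
qed simp

text \<open>\<open>jmul (v l)\<close> is an eigenvector of \<open>T\<close> for
  \<open>- \<zeta> l\<close>, but for even \<open>N\<close> this may equal \<open>\<zeta> k\<close>,
  so eigenvalues alone do not separate the vectors. Applying \<open>T ^ m\<close> with
  \<open>m = N - 1\<close>, which only rescales \<open>jmul (v l)\<close>, turns all powers of
  \<open>star T\<close> in its expansion into powers \<open>T ^ (m - j)\<close>, to which
  \<open>orth_j\<close> applies.\<close>

lemma herm_v_jmul_v: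
  assumes "k < N" "l < N"
  shows "herm (v k) (jmul (v l)) = 0"
proof -
  obtain m where m: "N = Suc m" using N by (cases N) auto
  have T_jv: "act T (jmul (v l)) = - \<zeta> l *s jmul (v l)"
    by (simp add: T_jmul star_T_v jmul_simps)
  have T_pow: "act (T ^ i) (jmul (v l)) = (- \<zeta> l) ^ i *s jmul (v l)" for i
    by (induction i) (simp_all add: act_one act_mult act_vec_simps T_jv mult_ac)
  have "act (T ^ m) (jmul (v l)) = (1 / of_nat N) *s (\<Sum>j<N. (\<zeta> l ^ j * (- 1) ^ j) *s act (T ^ (m - j)) (jmul u))"
  proof -
    have "act (T ^ m) (jmul (v l)) = (1 / of_nat N) *s (\<Sum>j<N. (\<zeta> l ^ j * (- 1) ^ j) *s act (T ^ m * star T ^ j) (jmul u))"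
      by (simp add: v_def jmul_simps jmul_sum jmul_T_power act_vec_simps act_vsum act_mult)
    also have "(\<Sum>j<N. (\<zeta> l ^ j * (- 1) ^ j) *s act (T ^ m * star T ^ j) (jmul u))
      = (\<Sum>j<N. (\<zeta> l ^ j * (- 1) ^ j) *s act (T ^ (m - j)) (jmul u))"
      by (intro sum.cong refl arg_cong2[where f = act] arg_cong2[where f = "(*s)"])
        (use m T_power_star_T_power in \<open>metis le_add_diff_inverse2 less_Suc_eq_le lessThan_iff\<close>)
    finally show ?thesis .
  qed
  moreover have "herm (act (T ^ i) u) (act (T ^ (m - j)) (jmul u)) = 0" if "i < N" for i j
    using that m by (intro orth_j) auto
  ultimately have "herm (v k) (act (T ^ m) (jmul (v l))) = 0"
    by (simp add: v_def[of k] herm_simps herm_lsum herm_rsum)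
  then have "cnj ((- \<zeta> l) ^ m) * herm (v k) (jmul (v l)) = 0" by (simp add: T_pow herm_simps)
  moreover have "\<zeta> l \<noteq> 0" using \<zeta>[of l] by auto
  ultimately show ?thesis by simp
qed

end

section \<open>The solution curve in the eigenframe\<close>

context eigenframe
begin

definition e :: "nat \<Rightarrow> complex \<Rightarrow> complex" where
  "e k z = exp (\<zeta> k * z - cnj (\<zeta> k) * cnj z)"

text \<open>The curve \<open>exp (z T - cnj z star T) u\<close>, expanded in eigenvectors.\<close>

definition f :: "complex \<Rightarrow> complex ^ ('n \<times> bool)" where
  "f z = (\<Sum>k<N. e k z *s v k)"

lemma f_has_derivative:
  "(f has_derivative (\<lambda>X. X *s act T (f z) - cnj X *s act (star T) (f z))) (at z)"
proof -
  have bl: "bounded_linear (\<lambda>c. c *s x)" for x :: "complex ^ ('n \<times> bool)"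
  proof -
    have "linear (\<lambda>c. c *s x)" by (rule linearI) (simp_all add: vec_eq_iff algebra_simps)
    then show ?thesis by (simp add: linear_conv_bounded_linear)
  qed
  have e: "(e k has_derivative (\<lambda>X. e k z * (\<zeta> k * X - cnj (\<zeta> k) * cnj X))) (at z)" for k
  proof -
    have "((\<lambda>z. \<zeta> k * z - cnj (\<zeta> k) * cnj z) has_derivative (\<lambda>X. \<zeta> k * X - cnj (\<zeta> k) * cnj X)) (at z)"
      by (intro has_derivative_diff has_derivative_mult_right bounded_linear.has_derivative[OF bounded_linear_cnj] has_derivative_ident)
    moreover have "(exp has_derivative (*) (e k z)) (at (\<zeta> k * z - cnj (\<zeta> k) * cnj z))"
      using DERIV_exp[of "\<zeta> k * z - cnj (\<zeta> k) * cnj z"] by (simp add: has_field_derivative_def e_def)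
    ultimately show ?thesis
      unfolding e_def[abs_def] using diff_chain_at by (fastforce simp: o_def)
  qed
  have "(f has_derivative (\<lambda>X. \<Sum>k<N. (e k z * (\<zeta> k * X - cnj (\<zeta> k) * cnj X)) *s v k)) (at z)"
    unfolding f_def[abs_def]
    by (intro has_derivative_sum bounded_linear.has_derivative[OF bl] e)
  moreover have "(\<Sum>k<N. (e k z * (\<zeta> k * X - cnj (\<zeta> k) * cnj X)) *s v k)
      = X *s act T (f z) - cnj X *s act (star T) (f z)" for X
    unfolding f_def act_vsum act_vscale T_v star_T_v vec.scale_sum_right sum_subtractf[symmetric]
    by (intro sum.cong refl) (simp add: vec_eq_iff algebra_simps)
  ultimately show ?thesis by simp
qed

text \<open>The component of \<open>f\<close> orthogonal to the range of \<open>P\<close> satisfies the same skew-Hermitian linear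
  equations as \<open>f\<close>, so its norm is constant.\<close>

lemma f_in_range:
  assumes "smooth P" "\<And>z. Dz P z = T * P z - P z * T" "\<And>z. Dzb P z = P z * star T - star T * P z"
    and "act (P 0) u = u"
  shows "act (P z) (f z) = f z"
proof -
  \<comment> \<open>The coefficient \<open>X T - cnj X star T\<close> of the linear equations for
    \<open>X = 1\<close> and \<open>X = \<i>\<close>; both are skew-Hermitian.\<close>
  define A where "A X = (if X = 1 then T - star T else iu * (T + star T))" for X :: complex
  have star_A: "star (A X) = - A X" for X
    by (simp add: A_def star_simps algebra_simps iu_commute)
  have df: "f differentiable at z" for z using f_has_derivative by (rule differentiableI)
  have dP: "P differentiable at z" for z by (rule smooth_differentiable[OF assms(1)])
  have dir_f: "dir X f z = act (A X) (f z)" if "X = 1 \<or> X = \<i>" for X z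
    using that by (auto simp: dir_eqI[OF f_has_derivative] A_def act_simps act_vec_simps vec_eq_iff algebra_simps)
  have dir_P: "dir X P z = A X * P z - P z * A X" if "X = 1 \<or> X = \<i>" for X z
  proof -
    have "dir 1 P z = Dz P z + Dzb P z"
      by (simp add: Dz_def Dzb_def scaleR_add_right scaleR_diff_right flip: scaleR_left_distrib)
    then have 1: "dir 1 P z = A 1 * P z - P z * A 1"
      by (simp add: A_def assms algebra_simps)
    have "Dzb P z - Dz P z = iu * dir \<i> P z"
      by (simp add: Dz_def Dzb_def scaleR_add_right scaleR_diff_right flip: scaleR_left_distrib)
    then have "iu * (Dzb P z - Dz P z) = iu * iu * dir \<i> P z" by (simp add: mult.assoc)
    then have "iu * (Dzb P z - Dz P z) = - dir \<i> P z" by (simp add: iu_mult_iu)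
    then have "dir \<i> P z = iu * (Dz P z - Dzb P z)"
      by (simp add: right_diff_distrib) (metis minus_diff_eq minus_minus)
    then have 2: "dir \<i> P z = A \<i> * P z - P z * A \<i>"
      by (simp add: A_def assms algebra_simps iu_mult_left[of "P z"])
    show ?thesis using that 1 2 by auto
  qed
  define g where "g z = f z - act (P z) (f z)" for z
  have g': "(g has_derivative (\<lambda>X. dir X f z - (act (P z) (dir X f z) + act (dir X P z) (f z)))) (at z)" for z
    unfolding g_def[abs_def]
    by (intro has_derivative_diff has_derivative_dir[OF df]
        bounded_bilinear.FDERIV[OF bounded_bilinear_act] has_derivative_dir[OF dP])
  have dg: "g differentiable at z" for z using g' by (rule differentiableI)
  have dir_g: "dir X g z = act (A X) (g z)" if "X = 1 \<or> X = \<i>" for X z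
    by (simp add: dir_eqI[OF g'] dir_f[OF that] dir_P[OF that] g_def act_simps act_vec_simps)
  define G where "G z = g z \<bullet> g z" for z
  have G': "(G has_derivative (\<lambda>X. g z \<bullet> dir X g z + dir X g z \<bullet> g z)) (at z)" for z
    unfolding G_def[abs_def]
    by (intro bounded_bilinear.FDERIV[OF bounded_bilinear_inner] has_derivative_dir[OF dg])
  have dir_G: "dir X G z = 0" if "X = 1 \<or> X = \<i>" for X z
  proof -
    have "herm (act (A X) (g z)) (g z) = - herm (g z) (act (A X) (g z))"
      by (simp add: herm_act[of "A X"] star_A act_simps herm_simps)
    then have "Re (herm (act (A X) (g z)) (g z)) = - Re (herm (g z) (act (A X) (g z)))" by simp
    then show ?thesis by (simp add: dir_eqI[OF G'] dir_g[OF that] inner_eq_Re_herm)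
  qed
  have "G z = G 0"
    by (rule dir_zero_imp_constant) (use G' dir_G in \<open>auto intro: differentiableI\<close>)
  moreover have "f 0 = u" by (simp add: f_def e_def sum_v)
  ultimately have "G z = 0" by (simp add: G_def g_def assms(4))
  then show ?thesis by (simp add: G_def g_def)
qed

lemma herm_f_v: "k < N \<Longrightarrow> herm (f z) (v k) = e k z / of_nat N"
proof -
  assume k: "k < N"
  have "herm (f z) (v k) = (\<Sum>l<N. if l = k then e k z / of_nat N else 0)"
    unfolding f_def herm_lsum by (intro sum.cong refl) (simp add: herm_simps herm_v k)
  then show ?thesis using k by simp
qed

lemma herm_f_jmul_v: "k < N \<Longrightarrow> herm (f z) (jmul (v k)) = 0"
  unfolding f_def herm_lsum by (intro sum.neutral) (simp add: herm_simps herm_v_jmul_v)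

end

section \<open>Symplectic frames\<close>

text \<open>With conjugated rows \<open>w k\<close> and \<open>jmul (w k)\<close>, multiplication by
  the matrix yields the coordinates of a vector in an orthonormal quaternionic frame.\<close>

definition frame_mat :: "('n::finite \<Rightarrow> complex ^ ('n \<times> bool)) \<Rightarrow> complex ^ ('n \<times> bool) ^ ('n \<times> bool)" where
  "frame_mat w = (\<chi> p q. cnj ((if snd p then jmul (w (fst p)) else w (fst p)) $ q))"

lemma frame_mat_mv: "(frame_mat w *v x) $ p = herm x (if snd p then jmul (w (fst p)) else w (fst p))"
  by (simp add: frame_mat_def matrix_vector_mult_def herm_def mult.commute)

lemma frame_mat_jmul: "frame_mat w *v jmul x = jmul (frame_mat w *v x)"
  by (rule jmul_eqI)
    (simp_all add: jmul_nth frame_mat_mv herm_cnj herm_jmul_jmul herm_jmul_left[of x])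

lemma matrix_mult_nth: "(A ** B) $ i $ j = (\<Sum>k\<in>UNIV. A $ i $ k * B $ k $ j)"
  by (simp add: matrix_matrix_mult_def)

lemma frame_mat_Sp:
  assumes "\<And>k l. herm (w k) (w l) = (if k = l then 1 else 0)" "\<And>k l. herm (w k) (jmul (w l)) = 0"
  shows "frame_mat w \<in> Sp"
proof -
  define r where "r p = (if snd p then jmul (w (fst p)) else w (fst p))" for p
  have jw: "herm (jmul (w k)) (w l) = 0" for k l
    using arg_cong[OF assms(2)[of l k], of cnj] by (simp add: herm_cnj)
  have orth: "herm (r p) (r q) = (if p = q then 1 else 0)" for p q
    by (cases p; cases q) (auto simp: r_def assms jw herm_jmul_jmul)
  have "frame_mat w ** (\<chi> p q. cnj (frame_mat w $ q $ p)) = mat 1"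
    using orth by (auto simp: vec_eq_iff matrix_matrix_mult_def frame_mat_def mat_def herm_def r_def mult.commute)
  moreover have "frame_mat w ** Jmat ** transpose (frame_mat w) = Jmat"
  proof -
    have nth: "frame_mat w $ p $ s = cnj (r p $ s)" for p s
      by (simp add: frame_mat_def r_def)
    have "(Jmat ** transpose (frame_mat w)) $ s $ q = jmul (r q) $ s" for s q
      by (simp add: matrix_mult_nth transpose_def nth jmul_def matrix_vector_mult_def)
    then have "(frame_mat w ** (Jmat ** transpose (frame_mat w))) $ p $ q = herm (jmul (r q)) (r p)" for p q
      by (simp only: matrix_mult_nth[of "frame_mat w"] nth) (simp add: herm_def mult.commute)
    moreover have "herm (jmul (r q)) (r p) = Jmat $ p $ q" for p q
      by (cases p; cases q) (auto simp: r_def assms jw herm_jmul_jmul jmul_jmul herm_simps Jmat_def)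
    ultimately show ?thesis by (simp add: vec_eq_iff matrix_mul_assoc)
  qed
  ultimately show ?thesis by (simp add: Sp_def)
qed

lemma frame_mat_qline: "(*v) (frame_mat w) ` qline x = qline (frame_mat w *v x)"
proof -
  have "frame_mat w *v (a *s x + b *s jmul x) = a *s (frame_mat w *v x) + b *s jmul (frame_mat w *v x)" for a b
    by (simp add: frame_mat_jmul[symmetric] matrix_vector_right_distrib matrix_vector_mult_scaleR
        vector_scalar_commute)
  then show ?thesis unfolding qline_def by (auto simp: image_iff) metis+
qed

text \<open>\<open>jc\<close> exchanges the two derivatives of \<open>P\<close>, hence
  \<open>T w * P z\<close> and \<open>- star (T w) * P z\<close>. So
  \<open>jc (T w) + star (T w)\<close> annihilates the range of \<open>P z\<close> and commutes with
  \<open>P z\<close>, for every \<open>z\<close>, and \<open>commuting_zero\<close> applies.\<close>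

lemma jc_T:
  fixes P :: "complex \<Rightarrow> ('n::finite \<times> bool) cop"
  assumes "isotropic_projector P n" "\<And>z. jc (P z) = P z"
  shows "jc (isotropic_projector.T P n w) = - star (isotropic_projector.T P n w)"
proof -
  interpret isotropic_projector P n by fact
  have jcP: "(\<lambda>z. jc (P z)) = P" by (simp add: assms(2))
  have jcDz: "jc (Dz P z) = Dzb P z" for z
    using D_jc(2)[OF smooth_P, of z] unfolding jcP by (rule sym)
  have "jc (Dz P z * P z) = - (star (T w) * P z)" for z
    using star_T_B[of z 0] Dzb_B[of 0 z] T_constant[of w z]
    by (simp add: jc_mult jcDz assms(2) B_0)
  moreover have "Dz P z * P z = T w * P z" for z
    using T_B[of z 0] T_constant[of w z] by (simp add: B_0 B_1)
  ultimately have 1: "jc (T w) * P z = - (star (T w) * P z)" for z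
    by (metis assms(2) jc_mult)
  have "jc (T w) * P z - P z * jc (T w) = P z * star (T w) - star (T w) * P z" for z
  proof -
    have "jc (T w) * P z - P z * jc (T w) = jc (T w * P z - P z * T w)" by (simp add: jc_simps assms(2))
    also have "\<dots> = Dzb P z" unfolding Dz_P_eq[symmetric] by (rule jcDz)
    finally show ?thesis by (simp only: Dzb_P_eq[of z w])
  qed
  then have "- (P z * jc (T w)) = P z * star (T w)" for z by (simp add: 1 algebra_simps)
  then have 2: "P z * jc (T w) = - (P z * star (T w))" for z by (metis minus_minus)
  have "jc (T w) + star (T w) = 0"
    by (rule commuting_zero) (simp_all add: distrib_left distrib_right 1 2)
  then show ?thesis by (simp add: eq_neg_iff_add_eq_0)
qed

theorem theorem4p2:
  fixes n :: nat
    and idx :: "'n::finite \<Rightarrow> nat"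
    and \<phi> :: "complex \<Rightarrow> (complex ^ ('n \<times> bool)) set"
    and \<psi> :: "nat \<Rightarrow> complex \<Rightarrow> (complex ^ ('n \<times> bool)) set"
  assumes "n \<ge> 1"
    and "bij_betw idx UNIV {0..n}"
    and "smooth_HP \<phi>"
    and "induced_metric_flat \<phi>"
    and "minimal_surface \<phi>"
    and "totally_real \<phi>"
    and "linearly_full \<phi>"
    and "harmonic_sequence \<phi> \<psi>"
    and "isotropy_order_is \<psi> n"
  shows "\<exists>U\<in>Sp. \<exists>\<theta>::real. \<exists>a :: nat \<Rightarrow> complex.
           ((\<forall>k\<in>{0..n}. a k = exp (\<i> * of_real (2 * real k * pi / real (n + 1)))) \<or>
            (\<forall>k\<in>{0..n}. a k = exp (\<i> * of_real (real k * pi / real (n + 1))))) \<and>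
           (\<forall>z. (*v) U ` \<phi> z \<in> CPn \<and> (*v) U ` \<phi> z = exp_map idx a (exp (\<i> * of_real \<theta>) * z))"
proof -
  interpret flat_totally_real_minimal \<phi>
    by (rule flat_totally_real_minimal.intro) (fact assms)+
  have card: "CARD('n) = n + 1" using bij_betw_same_card[OF assms(2)] by simp
  have idx_less: "idx k < n + 1" for k
    using bij_betwE[OF assms(2)] by (auto simp: less_Suc_eq_le)
  have idx_eq: "idx k = idx l \<longleftrightarrow> k = l" for k l
    using bij_betw_imp_inj_on[OF assms(2)] by (auto dest: injD)
  have perp: "perp_upto \<psi> n" using assms(9) by (simp add: isotropy_order_is_def)
  have iso: "isotropic_projector P n"
  proof
    show "star (Bm m z) * (Dz P z * P z) = 0" if "m < n" for m z
      by (rule isotropic_of_sequence[OF assms(8) perp range_P that])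
  qed (use assms(1) tr_P card in auto)
  interpret iso: isotropic_projector P n by (rule iso)
  define T where "T = iso.T 0"
  note star_T_T = iso.star_T_T[of 0, folded T_def]
  have T_star_T: "T * star T = 1" by (rule cop_left_inverse_imp_right[OF star_T_T])
  have isometric: "star (T ^ k) * T ^ k = 1" for k
  proof (induction k)
    case (Suc k)
    have "star (T ^ Suc k) * T ^ Suc k = star (T ^ k) * (star T * T) * T ^ k"
      by (simp only: power_Suc star_mult mult.assoc)
    then show ?case by (simp add: star_T_T Suc)
  qed (simp add: star_simps)
  obtain q where q: "norm q = 1" "\<phi> 0 = qline q" by (rule obtain_unit)
  have mem: "act (T ^ (n + 1)) x \<in> qline q" if "x \<in> qline q" for x
  proof -
    have x: "act (P 0) x = x" using that range_P q(2) by auto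
    have "act (T ^ (n + 1)) x = act (P 0) (act (T ^ (n + 1)) x)"
      using arg_cong[OF iso.T_N_P[of 0 0], of "\<lambda>A. act A x"] by (simp only: act_mult x T_def)
    then show ?thesis using range_P q(2) by auto
  qed
  have "q \<in> qline q" "jmul q \<in> qline q"
    using qline_memI[of 1 q 0] qline_memI[of 0 q 1] by simp_all
  from eigenvector_in_qline[OF q(1) mem[OF this(1)] mem[OF this(2)]]
  obtain u \<mu> where u: "u \<in> qline q" "norm u = 1" and \<mu>: "act (T ^ (n + 1)) u = \<mu> *s u" .
  have Pu: "act (P 0) u = u" using u(1) range_P q(2) by auto
  have Pju: "act (P 0) (jmul u) = jmul u" by (simp add: act_jmul jc_P Pu)
  have hu: "herm u u = 1" by (rule herm_unit(1)[OF u(2)])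
  have "herm (act (T ^ (n + 1)) u) (act (T ^ (n + 1)) u) = 1"
    by (simp only: herm_act[of "T ^ (n + 1)"] act_mult[symmetric] isometric act_one hu)
  then have "\<mu> * cnj \<mu> = 1" unfolding \<mu> by (simp add: herm_simps hu mult.commute)
  then have "(cmod \<mu>)\<^sup>2 = 1\<^sup>2" unfolding complex_norm_square[symmetric] of_real_eq_1_iff by simp
  then have norm_\<mu>: "cmod \<mu> = 1" by (rule power2_eq_imp_eq) simp_all
  \<comment> \<open>This makes \<open>\<tau>\<close> an \<open>(n + 1)\<close>-st root of
    \<open>\<mu>\<close>. Taken out of the eigenvalues of \<open>T\<close>, it leaves roots of unity
    and becomes the rotation of \<open>z\<close>.\<close>
  define \<theta> where "\<theta> = Arg \<mu> / real (n + 1)"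
  define \<tau> where "\<tau> = exp (\<i> * of_real \<theta>)"
  define \<epsilon> where "\<epsilon> = exp (\<i> * of_real (2 * pi / real (n + 1)))"
  note \<epsilon> = root_of_unity_power[OF _ \<epsilon>_def]
  have "\<mu> = exp (\<i> * of_real (Arg \<mu>))"
    using Arg_eq[of \<mu>] norm_\<mu> by (cases "\<mu> = 0") simp_all
  also have "\<dots> = \<tau> ^ (n + 1)"
    unfolding \<tau>_def \<theta>_def exp_of_nat_mult[symmetric] by (simp add: field_simps del: of_nat_Suc)
  finally have \<mu>_\<tau>: "\<mu> = \<tau> ^ (n + 1)" .
  have orth: "herm (act (T ^ i) x) (act (T ^ j) y) = 0"
    if "act (P 0) x = x" "act (P 0) y = y" "i < n + 1" "j < n + 1" "i \<noteq> j" for i j x y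
  proof -
    have "herm (act (T ^ i) x) (act (T ^ j) y) = herm (act (T ^ i * P 0) x) (act (T ^ j * P 0) y)"
      by (simp only: act_mult that)
    also have "\<dots> = herm x (act (star (T ^ i * P 0) * (T ^ j * P 0)) y)"
      by (simp only: herm_act[of "T ^ i * P 0"] act_mult[of "star (T ^ i * P 0)"])
    also have "star (T ^ i * P 0) * (T ^ j * P 0) = 0"
      unfolding T_def by (rule iso.T_orthogonal) (use that in auto)
    finally show ?thesis by (simp add: act_simps herm_simps)
  qed
  interpret ef: eigenframe T u \<tau> \<epsilon> "n + 1"
  proof
    show "jc T = - star T" unfolding T_def by (rule jc_T[OF iso jc_P])
    show "herm (act (T ^ i) u) (act (T ^ j) u) = 0" if "i < n + 1" "j < n + 1" "i \<noteq> j" for i j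
      by (rule orth[OF Pu Pu that])
    show "herm (act (T ^ i) u) (act (T ^ j) (jmul u)) = 0" if "i < n + 1" "j < n + 1" for i j
    proof (cases "i = j")
      case True
      then show ?thesis
        by (simp add: herm_act[of "T ^ j"] act_mult[symmetric] isometric act_one herm_jmul_self)
    qed (rule orth[OF Pu Pju that])
    have "cmod \<tau> = 1" by (simp add: \<tau>_def)
    then show "\<tau> * cnj \<tau> = 1" by (simp flip: complex_norm_square)
    show "\<epsilon> ^ j = 1 \<longleftrightarrow> n + 1 dvd j" for j by (rule \<epsilon>(3)) simp
    show "act (T ^ (n + 1)) u = \<tau> ^ (n + 1) *s u" unfolding \<mu> \<mu>_\<tau> ..
    show "\<epsilon> * cnj \<epsilon> = 1" by (rule \<epsilon>(4)) simp
    show "\<epsilon> ^ (n + 1) = 1" by (rule \<epsilon>(2)) simp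
  qed (use star_T_T T_star_T hu in auto)
  \<comment> \<open>Each \<open>ef.v k\<close> with \<open>k \<le> n\<close> has squared norm 1 / (n
    + 1); scaling by \<open>s\<close> makes the frame orthonormal.\<close>
  define s where "s = complex_of_real (sqrt (real (n + 1)))"
  have s: "s * s = of_nat (n + 1)" "s \<noteq> 0" "cnj s = s"
    by (simp_all add: s_def del: of_nat_Suc of_nat_add flip: of_real_mult)
  define w where "w k = s *s ef.v (idx k)" for k
  define U where "U = frame_mat w"
  define a where "a k = \<epsilon> ^ k" for k
  have "U \<in> Sp"
    unfolding U_def
  proof (rule frame_mat_Sp)
    fix k l
    have "herm (ef.v (idx k)) (ef.v (idx l)) = (if k = l then 1 / (s * s) else 0)"
      by (simp only: ef.herm_v[OF idx_less idx_less] idx_eq s(1))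
    then show "herm (w k) (w l) = (if k = l then 1 else 0)"
      using s(2) by (simp add: w_def herm_simps s(3))
    show "herm (w k) (jmul (w l)) = 0"
      by (simp only: w_def jmul_scale herm_lscale herm_rscale ef.herm_v_jmul_v[OF idx_less idx_less] mult_zero_right)
  qed
  moreover have "\<forall>k\<in>{0..n}. a k = exp (\<i> * of_real (2 * real k * pi / real (n + 1)))"
    unfolding a_def by (intro ballI \<epsilon>(1)) simp
  moreover have "(*v) U ` \<phi> z \<in> CPn \<and> (*v) U ` \<phi> z = exp_map idx a (\<tau> * z)" for z
  proof -
    define X :: "complex ^ ('n \<times> bool)" where "X = (\<chi> p. if snd p then 0 else ef.e (idx (fst p)) z)"
    have X_nz: "X \<noteq> 0"
    proof
      assume "X = 0"
      then have "X $ (undefined, False) = 0" by simp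
      then show False by (simp add: X_def ef.e_def)
    qed
    have UX: "U *v ef.f z = (1 / s) *s X"
    proof (rule jmul_eqI)
      fix k
      have "herm (ef.f z) (w k) = s * (ef.e (idx k) z / (s * s))"
        by (simp only: w_def herm_rscale s ef.herm_f_v[OF idx_less])
      then show "(U *v ef.f z) $ (k, False) = ((1 / s) *s X) $ (k, False)"
        using s(2) by (simp add: U_def frame_mat_mv X_def)
      show "(U *v ef.f z) $ (k, True) = ((1 / s) *s X) $ (k, True)"
      proof -
        have "herm (ef.f z) (jmul (w k)) = 0"
          by (simp only: w_def jmul_scale herm_rscale ef.herm_f_jmul_v[OF idx_less] mult_zero_right)
        then show ?thesis by (simp add: U_def frame_mat_mv X_def)
      qed
    qed
    have "act (P z) (ef.f z) = ef.f z"
      by (rule ef.f_in_range[OF smooth_P _ _ Pu])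
        (simp_all only: T_def iso.Dz_P_eq[of _ 0] iso.Dzb_P_eq[of _ 0])
    then have "ef.f z \<in> \<phi> z" using range_P by auto
    \<comment> \<open>A quaternionic line is spanned by any nonzero vector in it; the curve does not
      vanish because its coordinates are exponentials up to the factor \<open>1 / s\<close>.\<close>
    moreover have "ef.f z \<noteq> 0"
    proof
      assume "ef.f z = 0"
      then have "(1 / s) *s X = 0" unfolding UX[symmetric] by simp
      then show False using X_nz s(2) by simp
    qed
    moreover obtain q' where "\<phi> z = qline q'" by (rule obtain_unit)
    ultimately have "\<phi> z = qline (ef.f z)" using qline_eqI by metis
    then have "(*v) U ` \<phi> z = qline ((1 / s) *s X)"
      by (simp only: U_def frame_mat_qline UX[unfolded U_def])
    also have "\<dots> = qline X"
      by (rule qline_eqI) (use qline_memI[of "1 / s" X 0] X_nz s(2) in simp_all)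
    finally have image: "(*v) U ` \<phi> z = qline X" .
    have "X = (\<chi> p. if snd p then 0 else exp (a (idx (fst p)) * (\<tau> * z) - cnj (a (idx (fst p))) * cnj (\<tau> * z)))"
      by (simp add: X_def ef.e_def ef.\<zeta>_def a_def vec_eq_iff mult_ac)
    then have "exp_map idx a (\<tau> * z) = qline X" by (simp add: exp_map_def)
    moreover have "qline X \<in> CPn"
      unfolding CPn_def using X_nz by (auto simp: X_def)
    ultimately show ?thesis using image by simp
  qed
  ultimately show ?thesis unfolding \<tau>_def by blast
qed

end
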